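(* There exists $\delta>0$ such that the following holds. Let $(w_1(0,r),w_2(0,r))$ be odd functions of $r\in\mathbb{R}$ satisfying $$\left\|\frac{w_1(0)}{(1+r^2)^{1/2}}\right\|_{L^2(\mathbb{R})}+\|w_{1,r}(0)\|_{L^2(\mathbb{R})}+\|w_2(0)\|_{L^2(\mathbb{R})}<\delta ,$$ and let $(w_1(t),w_2(t))$ be the corresponding solution, for $t\ge 0$, of $$\dot w_1=w_2,\qquad \dot w_2=\partial_{rr}w_1-Vw_1-\frac{6H w_1^2}{(1+r^2)^{5/4}}-\frac{2w_1^3}{(1+r^2)^{3/2}},\qquad r\in\mathbb{R}.$$ Then for any $R>0$ $$\lim_{t\to\infty}\int_{-R}^{R}\left(|w_2(t)|^2+|\partial_r w_1(t)|^2+|w_1(t)|^2\right)dr=0,$$ and also $$\lim_{t\to\infty}\int_{\mathbb{R}}\frac{\min\{1,|r|^{-1}\}}{1+r^2}\,|w_1(t)|^2\,dr=0 .$$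
   Context: Here $H(r)=\frac{r}{\sqrt{1+r^2}}$ and $V(r)=\frac{3}{4}\,\frac{5r^2-2}{(1+r^2)^2}$. A dot denotes $\partial_t$ and a subscript $r$ denotes $\partial_r$. Solutions are understood in the energy space, i.e. continuous in $t\ge 0$ with values in the space of pairs $(w_1,w_2)$ of odd functions of $r$ for which $\frac{w_1}{(1+r^2)^{1/2}}$, $w_{1,r}$ and $w_2$ belong to $L^2(\mathbb{R})$. *)

theory Defs
  imports "HOL-Analysis.Analysis"
begin

text \<open>
  Functions of \<open>r\<close> are representatives of classes modulo Lebesgue-null sets. All the notions below
  depend only on these classes; in particular oddness is required almost everywhere.
\<close>

definition kink_H :: "real \<Rightarrow> real" where
  "kink_H r = r / sqrt (1 + r\<^sup>2)"

definition potential_V :: "real \<Rightarrow> real" where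
  "potential_V r = 3 / 4 * ((5 * r\<^sup>2 - 2) / (1 + r\<^sup>2)\<^sup>2)"

definition in_L2 :: "(real \<Rightarrow> real) \<Rightarrow> bool" where
  "in_L2 f \<longleftrightarrow> f \<in> borel_measurable lebesgue \<and> integrable lebesgue (\<lambda>r. (f r)\<^sup>2)"

definition L2_norm_fun :: "(real \<Rightarrow> real) \<Rightarrow> real" where
  "L2_norm_fun f = sqrt (LINT r|lebesgue. (f r)\<^sup>2)"

definition odd_ae :: "(real \<Rightarrow> real) \<Rightarrow> bool" where
  "odd_ae f \<longleftrightarrow> (AE r in lebesgue. f (- r) = - f r)"

definition test_function :: "(real \<Rightarrow> real) \<Rightarrow> bool" where
  "test_function \<phi> \<longleftrightarrow>
     (\<forall>k. (deriv ^^ k) \<phi> differentiable_on UNIV) \<and> (\<exists>M. \<forall>r. \<bar>r\<bar> > M \<longrightarrow> \<phi> r = 0)"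

definition locally_integrable :: "(real \<Rightarrow> real) \<Rightarrow> bool" where
  "locally_integrable f \<longleftrightarrow> (\<forall>a b. set_integrable lebesgue {a..b} f)"

definition has_weak_deriv :: "(real \<Rightarrow> real) \<Rightarrow> (real \<Rightarrow> real) \<Rightarrow> bool" where
  "has_weak_deriv f g \<longleftrightarrow>
     locally_integrable f \<and> locally_integrable g \<and>
     (\<forall>\<phi>. test_function \<phi> \<longrightarrow>
        (LINT r|lebesgue. f r * deriv \<phi> r) = - (LINT r|lebesgue. g r * \<phi> r))"

text \<open>Like \<open>deriv\<close>, this is meaningful only if some weak derivative exists; it is then determined
  almost everywhere.\<close>

definition weak_deriv :: "(real \<Rightarrow> real) \<Rightarrow> real \<Rightarrow> real" where
  "weak_deriv f = (SOME g. has_weak_deriv f g)"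

definition energy_space :: "((real \<Rightarrow> real) \<times> (real \<Rightarrow> real)) set" where
  "energy_space =
     {(u1, u2). odd_ae u1 \<and> odd_ae u2 \<and>
        in_L2 (\<lambda>r. u1 r / sqrt (1 + r\<^sup>2)) \<and>
        (\<exists>g. has_weak_deriv u1 g) \<and> in_L2 (weak_deriv u1) \<and>
        in_L2 u2}"

definition energy_norm :: "(real \<Rightarrow> real) \<Rightarrow> (real \<Rightarrow> real) \<Rightarrow> real" where
  "energy_norm u1 u2 =
     L2_norm_fun (\<lambda>r. u1 r / sqrt (1 + r\<^sup>2)) + L2_norm_fun (weak_deriv u1) + L2_norm_fun u2"

definition energy_continuous ::
    "(real \<Rightarrow> real \<Rightarrow> real) \<Rightarrow> (real \<Rightarrow> real \<Rightarrow> real) \<Rightarrow> bool" where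
  "energy_continuous w1 w2 \<longleftrightarrow>
     (\<forall>t\<ge>0. (w1 t, w2 t) \<in> energy_space) \<and>
     (\<forall>t\<ge>0. ((\<lambda>s. energy_norm (\<lambda>r. w1 s r - w1 t r) (\<lambda>r. w2 s r - w2 t r)) \<longlongrightarrow> 0)
              (at t within {0..}))"

text \<open>
  At this regularity the system is an identity of distributions in \<open>r\<close> for each \<open>t \<ge> 0\<close>: paired
  with a test function, both components are differentiable in time (one-sidedly at \<open>t = 0\<close>), and
  \<open>\<partial>\<^sub>r\<^sub>r w1\<close> is the distributional second derivative.
\<close>

definition energy_solution ::
    "(real \<Rightarrow> real \<Rightarrow> real) \<Rightarrow> (real \<Rightarrow> real \<Rightarrow> real) \<Rightarrow> bool" where
  "energy_solution w1 w2 \<longleftrightarrow>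
     energy_continuous w1 w2 \<and>
     (\<forall>\<phi>. test_function \<phi> \<longrightarrow> (\<forall>t\<ge>0.
        ((\<lambda>s. LINT r|lebesgue. w1 s r * \<phi> r) has_real_derivative
           (LINT r|lebesgue. w2 t r * \<phi> r)) (at t within {0..}) \<and>
        ((\<lambda>s. LINT r|lebesgue. w2 s r * \<phi> r) has_real_derivative
           (LINT r|lebesgue. w1 t r * (deriv ^^ 2) \<phi> r) -
           (LINT r|lebesgue.
              (potential_V r * w1 t r
               + 6 * kink_H r * (w1 t r)\<^sup>2 / (1 + r\<^sup>2) powr (5 / 4)
               + 2 * (w1 t r) ^ 3 / (1 + r\<^sup>2) powr (3 / 2)) * \<phi> r)) (at t within {0..})))"

end

theory Submission
  imports Defs
begin

text \<open>
  In one space dimension \<open>w2 \<plusminus> \<partial>\<^sub>r w1\<close> solve transport equations with source in \<open>L\<^sup>2\<close>. Along characteristics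
  such a solution is strongly differentiable in \<open>L\<^sup>2\<close>, by duality with test functions, so that all
  quadratic identities below hold at the energy regularity without any smoothing.

  Oddness enters only through \<open>w1 = 0\<close> at \<open>r = 0\<close>, which gives Hardy inequalities
  \<open>\<integral>\<kappa> w\<^sub>r\<^sup>2 + (p' + p\<^sup>2 / \<kappa>) w\<^sup>2 \<ge> 0\<close> for weights \<open>p\<close> with a pole at \<open>0\<close>. With \<open>\<kappa> = 1\<close> and
  \<open>p = 1 / (r (1 + r\<^sup>2))\<close> the quadratic part of the conserved energy is coercive, and small data stay
  small. The virial functional \<open>\<integral> H w\<^sub>r w2\<close> has derivative
  \<open>- 1/2 \<integral> H' (w2\<^sup>2 + w\<^sub>r\<^sup>2) + 1/2 \<integral> (H V)' w\<^sup>2\<close> up to small terms, and a Hardy inequality with \<open>\<kappa> = H'\<close>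
  absorbs the last integral. Thus \<open>\<integral> H' (w2\<^sup>2 + w\<^sub>r\<^sup>2)\<close>, which is Lipschitz in time, is bounded by
  minus the derivative of a bounded function, and it tends to \<open>0\<close>.
\<close>

section \<open>Smooth functions and test functions\<close>

text \<open>At this regularity w1 may grow like sqrt |r| and need not lie in L^2, while V decays
  only like 1/r^2. The powers 5/4 and 3/2 in the nonlinearity are exactly those for which each
  further factor w1 costs a factor (1 + r^2)^(1/4) that the coefficient pays for. Cubic and quartic
  terms are therefore quadratic ones times a power of the norm of w_r, and smallness of that norm
  suffices to absorb them. The weight 1 / (r (1 + r^2)) is H'/H: since -H'' = 3 H / (1 + r^2)^2, it
  gives the sharp constant in int w_r^2 >= 3 int w^2 / (1 + r^2)^2, and V + 3 / (1 + r^2)^2 >= (3/2)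
  / (1 + r^2). For the weight H' an explicit rational multiplier takes this role, and positivity
  becomes a polynomial inequality in r^2 with room to spare; that margin absorbs the nonlinear
  terms. Because w1 is not in L^2, only its increments w1(s) - w1(t) are estimated there. Finally,
  the virial estimate alone makes the local energy integrable in time, which does not force
  convergence; the Lipschitz bound excludes thin spikes.\<close>

definition smooth :: "(real \<Rightarrow> real) \<Rightarrow> bool" where
  "smooth f \<longleftrightarrow> (\<forall>k. (deriv ^^ k) f differentiable_on UNIV)"

text \<open>A class of functions closed under differentiation consists of smooth functions.
  Exhibiting such a class replaces every computation of iterated derivatives.\<close>

lemma smooth_coinduct:
  assumes "f \<in> S"
    and "\<And>f. f \<in> S \<Longrightarrow> \<exists>f'\<in>S. \<forall>x. (f has_real_derivative f' x) (at x)"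
  shows "smooth f"
proof -
  have deriv: "deriv f \<in> S" "f differentiable_on UNIV" if fS: "f \<in> S" for f
  proof -
    obtain f' where f': "f' \<in> S" "\<forall>x. (f has_real_derivative f' x) (at x)"
      using assms(2)[OF fS] by blast
    then have "deriv f = f'" by (auto intro: DERIV_imp_deriv)
    with f' show "deriv f \<in> S" by simp
    show "f differentiable_on UNIV"
      using f'(2) by (meson differentiable_at_withinI differentiable_on_def real_differentiable_def)
  qed
  have "(deriv ^^ k) f \<in> S" for k
    by (induction k) (use assms(1) deriv in auto)
  then show ?thesis using deriv by (auto simp: smooth_def)
qed

lemma smooth_has_deriv: "smooth f \<Longrightarrow> (f has_real_derivative deriv f x) (at x)"
  unfolding smooth_def using DERIV_deriv_iff_real_differentiable[of f x]
  by (metis UNIV_I differentiable_on_def funpow_0)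

lemma smooth_deriv: "smooth f \<Longrightarrow> smooth (deriv f)"
  unfolding smooth_def by (auto simp: funpow_swap1 dest: spec[of _ "Suc _"])

lemma smooth_continuous: "smooth f \<Longrightarrow> continuous_on S f"
  by (meson DERIV_isCont continuous_at_imp_continuous_on smooth_has_deriv)

text \<open>The product rule leaves the set of products but not the algebra that they generate, so
  the coinduction runs on this algebra and no Leibniz formula is needed.\<close>

inductive_set smooth_algebra :: "(real \<Rightarrow> real) set" where
  base: "smooth f \<Longrightarrow> f \<in> smooth_algebra"
| add: "f \<in> smooth_algebra \<Longrightarrow> g \<in> smooth_algebra \<Longrightarrow> (\<lambda>x. f x + g x) \<in> smooth_algebra"
| mult: "f \<in> smooth_algebra \<Longrightarrow> g \<in> smooth_algebra \<Longrightarrow> (\<lambda>x. f x * g x) \<in> smooth_algebra"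

lemma smooth_algebra_smooth: "f \<in> smooth_algebra \<Longrightarrow> smooth f"
proof (erule smooth_coinduct)
  fix f assume "f \<in> smooth_algebra"
  then show "\<exists>f'\<in>smooth_algebra. \<forall>x. (f has_real_derivative f' x) (at x)"
  proof induction
    case (base f)
    then show ?case by (meson smooth_algebra.base smooth_deriv smooth_has_deriv)
  next
    case (add f g)
    then obtain f' g' where "f' \<in> smooth_algebra" "g' \<in> smooth_algebra"
      "\<And>x. (f has_real_derivative f' x) (at x)" "\<And>x. (g has_real_derivative g' x) (at x)" by blast
    then show ?case
      by (intro bexI[of _ "\<lambda>x. f' x + g' x"]) (auto intro!: DERIV_add smooth_algebra.add)
  next
    case (mult f g)
    then obtain f' g' where "f' \<in> smooth_algebra" "g' \<in> smooth_algebra"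
      "\<And>x. (f has_real_derivative f' x) (at x)" "\<And>x. (g has_real_derivative g' x) (at x)" by blast
    with mult.hyps show ?case
      by (intro bexI[of _ "\<lambda>x. f' x * g x + g' x * f x"])
        (auto intro!: DERIV_mult smooth_algebra.add smooth_algebra.mult)
  qed
qed

lemma smooth_add: "smooth f \<Longrightarrow> smooth g \<Longrightarrow> smooth (\<lambda>x. f x + g x)"
  and smooth_mult: "smooth f \<Longrightarrow> smooth g \<Longrightarrow> smooth (\<lambda>x. f x * g x)"
  by (auto intro: smooth_algebra_smooth[OF smooth_algebra.add[OF smooth_algebra.base smooth_algebra.base]]
      smooth_algebra_smooth[OF smooth_algebra.mult[OF smooth_algebra.base smooth_algebra.base]])

lemma smooth_affine:
  assumes "smooth f"
  shows "smooth (\<lambda>x. c * f (a * x + b))"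
proof (rule smooth_coinduct)
  show "(\<lambda>x. c * f (a * x + b)) \<in> {\<lambda>x. c * f (a * x + b) | c f. smooth f}"
    using assms by blast
  fix g assume "g \<in> {\<lambda>x. c * f (a * x + b) | c f. smooth f}"
  then obtain d h where g: "g = (\<lambda>x. d * h (a * x + b))" "smooth h" by blast
  have "(g has_real_derivative (d * a) * deriv h (a * x + b)) (at x)" for x
    unfolding g(1)
    by (rule derivative_eq_intros DERIV_chain2[OF smooth_has_deriv[OF g(2)]] refl)+ simp
  with g(2) show "\<exists>f'\<in>{\<lambda>x. c * f (a * x + b) | c f. smooth f}. \<forall>x. (g has_real_derivative f' x) (at x)"
    by (intro bexI[of _ "\<lambda>x. (d * a) * deriv h (a * x + b)"]) (auto intro: smooth_deriv)
qed

lemma smooth_const: "smooth (\<lambda>x. c)"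
proof (rule smooth_coinduct[of _ "range (\<lambda>c x. c)"])
  fix f assume "f \<in> range (\<lambda>c (x::real). c :: real)"
  then obtain c where f: "f = (\<lambda>x. c)" by blast
  show "\<exists>f'\<in>range (\<lambda>c x. c). \<forall>x. (f has_real_derivative f' x) (at x)"
    unfolding f by (rule bexI[of _ "\<lambda>x. 0"]) auto
qed auto

lemma smooth_linear: "smooth (\<lambda>x. a * x + b)"
proof (rule smooth_coinduct[of _ "insert (\<lambda>x. a * x + b) {f. smooth f}"])
  fix f assume "f \<in> insert (\<lambda>x. a * x + b) {f. smooth f}"
  then show "\<exists>f'\<in>insert (\<lambda>x. a * x + b) {f. smooth f}. \<forall>x. (f has_real_derivative f' x) (at x)"
  proof
    assume f: "f = (\<lambda>x. a * x + b)"
    have "(f has_real_derivative a) (at x)" for x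
      unfolding f by (auto intro!: derivative_eq_intros)
    then show ?thesis
      by (intro bexI[of _ "\<lambda>x. a"]) (auto intro: smooth_const)
  next
    assume "f \<in> {f. smooth f}"
    then have f: "smooth f" by simp
    show ?thesis
      using smooth_has_deriv[OF f] smooth_deriv[OF f] by blast
  qed
qed simp

lemma smooth_polynomial: "real_polynomial_function p \<Longrightarrow> smooth p" for p :: "real \<Rightarrow> real"
proof (induction rule: real_polynomial_function.induct)
  case (linear f)
  have "f x = f 1 * x + 0" for x
    using linear_simps(5)[OF linear, of x 1] by simp
  then have "f = (\<lambda>x. f 1 * x + 0)" by blast
  with smooth_linear[of "f 1" 0] show ?case by metis
qed (auto intro: smooth_const smooth_add smooth_mult)

section \<open>Flat exponentials and bump functions\<close>

text \<open>The case \<open>n = 0\<close> is the classical flat function exp (-1/x). The factors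
  x^(-n) are included because differentiation produces them, so that the span of the family is
  closed under derivatives.\<close>

definition flat_exp :: "nat \<Rightarrow> real \<Rightarrow> real" where
  "flat_exp n x = (if x > 0 then (1 / x) ^ n * exp (- (1 / x)) else 0)"

text \<open>With y = 1/x, a single term of the exponential series gives y^(n+2) <= (n+2)! exp y. The
  quadratic order in x is what makes the derivative at 0 vanish.\<close>

lemma flat_exp_bound: "\<bar>flat_exp n x\<bar> \<le> fact (n + 2) * x\<^sup>2"
proof (cases "x > 0")
  case True
  define y where "y = 1 / x"
  have y: "y > 0" "x = 1 / y" using True by (auto simp: y_def)
  have sm: "summable (\<lambda>k. y ^ k /\<^sub>R fact k)" by (rule summable_exp_generic)
  have "y ^ (n + 2) /\<^sub>R fact (n + 2) = (\<Sum>k\<in>{n + 2}. y ^ k /\<^sub>R fact k)" by simp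
  also have "\<dots> \<le> exp y"
    unfolding exp_def by (rule sum_le_suminf[OF sm]) (use y in auto)
  finally have "y ^ (n + 2) \<le> fact (n + 2) * exp y"
    by (simp add: field_simps del: fact_Suc power_Suc)
  then have "y ^ n * y\<^sup>2 * exp (- y) \<le> fact (n + 2) * (exp y * exp (- y))"
    unfolding power_add[symmetric] mult.assoc[symmetric] by (intro mult_right_mono) auto
  then have "y ^ n * exp (- y) * y\<^sup>2 \<le> fact (n + 2)"
    by (simp add: exp_minus mult_ac)
  then have "y ^ n * exp (- y) \<le> fact (n + 2) * x\<^sup>2"
    using y by (simp add: power_divide pos_le_divide_eq del: fact_Suc)
  moreover have "flat_exp n x = y ^ n * exp (- y)" "0 \<le> y ^ n * exp (- y)"
    using True y(1) by (auto simp: flat_exp_def y_def)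
  ultimately show ?thesis by linarith
qed (simp add: flat_exp_def)

lemma flat_exp_deriv:
  "(flat_exp n has_real_derivative flat_exp (n + 2) x - n * flat_exp (n + 1) x) (at x)"
proof -
  consider "x > 0" | "x < 0" | "x = 0" by linarith
  then show ?thesis
  proof cases
    case 1
    have D1: "((\<lambda>x. (1 / x) ^ n * exp (- (1 / x))) has_real_derivative
        flat_exp (n + 2) x - n * flat_exp (n + 1) x) (at x)"
    proof -
      have "((\<lambda>y. y ^ n * exp (- y)) has_real_derivative
          n * (1 / x) ^ (n - 1) * exp (- (1 / x)) - (1 / x) ^ n * exp (- (1 / x))) (at (1 / x))"
        by (auto intro!: derivative_eq_intros)
      moreover have "((\<lambda>x. 1 / x) has_real_derivative - ((1 / x) * (1 / x))) (at x)"
        using 1 by (auto intro!: derivative_eq_intros)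
      ultimately have D: "((\<lambda>x. (1 / x) ^ n * exp (- (1 / x))) has_real_derivative
          (n * (1 / x) ^ (n - 1) * exp (- (1 / x)) - (1 / x) ^ n * exp (- (1 / x))) *
          - ((1 / x) * (1 / x))) (at x)"
        by (rule DERIV_chain2)
      \<comment> \<open>The truncated subtraction \<open>n - 1\<close> is harmless: for
        \<open>n = 0\<close> the term carries the factor 0.\<close>
      have eq: "(n * y ^ (n - 1) * e - y ^ n * e) * - (y * y)
          = y ^ (n + 2) * e - n * (y ^ (n + 1) * e)" for y e :: real
        by (cases n) (simp_all add: algebra_simps)
      have "(1 / x) ^ (n + 2) * exp (- (1 / x)) - n * ((1 / x) ^ (n + 1) * exp (- (1 / x)))
          = flat_exp (n + 2) x - n * flat_exp (n + 1) x"
        unfolding flat_exp_def using 1 by presburger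
      with D[unfolded eq] show ?thesis by (simp only:)
    qed
    have ev: "\<forall>\<^sub>F y in nhds x. flat_exp n y = (1 / y) ^ n * exp (- (1 / y))"
      using eventually_nhds_in_open[of "{0<..}" x] 1
      by (auto elim!: eventually_mono simp: flat_exp_def)
    show ?thesis by (rule DERIV_cong_ev[OF refl ev refl, THEN iffD2, OF D1])
  next
    case 2
    have ev: "\<forall>\<^sub>F y in nhds x. flat_exp n y = 0"
      using eventually_nhds_in_open[of "{..<0}" x] 2
      by (auto elim!: eventually_mono simp: flat_exp_def)
    have "(flat_exp n has_real_derivative 0) (at x)"
      by (rule DERIV_cong_ev[OF refl ev refl, THEN iffD2]) simp
    then show ?thesis using 2 by (simp add: flat_exp_def)
  next
    case 3
    have "((\<lambda>y. flat_exp n y / y) \<longlongrightarrow> 0) (at 0)"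
    proof (rule Lim_null_comparison)
      show "\<forall>\<^sub>F y in at 0. norm (flat_exp n y / y) \<le> fact (n + 2) * \<bar>y\<bar>"
      proof (rule always_eventually, rule allI)
        fix y show "norm (flat_exp n y / y) \<le> fact (n + 2) * \<bar>y\<bar>"
          using flat_exp_bound[of n y]
          by (cases "y = 0") (auto simp: divide_le_eq power2_eq_square mult.assoc simp del: fact_Suc)
      qed
      show "((\<lambda>y. fact (n + 2) * \<bar>y\<bar>) \<longlongrightarrow> 0) (at (0::real))"
        by (auto intro!: tendsto_eq_intros)
    qed
    then show ?thesis using 3 by (simp add: has_field_derivative_iff flat_exp_def)
  qed
qed

inductive_set flat_span :: "(real \<Rightarrow> real) set" where
  base: "flat_exp n \<in> flat_span"
| lin: "f \<in> flat_span \<Longrightarrow> g \<in> flat_span \<Longrightarrow> (\<lambda>x. f x - c * g x) \<in> flat_span"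

lemma smooth_flat_exp: "smooth (flat_exp n)"
proof (rule smooth_coinduct[of _ flat_span])
  show "flat_exp n \<in> flat_span" by (rule flat_span.base)
  fix f assume "f \<in> flat_span"
  then show "\<exists>f'\<in>flat_span. \<forall>x. (f has_real_derivative f' x) (at x)"
  proof induction
    case (base n)
    then show ?case
      by (intro bexI[of _ "\<lambda>x. flat_exp (n + 2) x - real n * flat_exp (n + 1) x"])
        (auto intro: flat_exp_deriv[simplified] flat_span.intros[simplified])
  next
    case (lin f g c)
    then obtain f' g' where "f' \<in> flat_span" "g' \<in> flat_span"
      "\<And>x. (f has_real_derivative f' x) (at x)" "\<And>x. (g has_real_derivative g' x) (at x)" by blast
    then show ?case
      by (intro bexI[of _ "\<lambda>x. f' x - c * g' x"])
        (auto intro!: DERIV_diff DERIV_cmult flat_span.lin)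
  qed
qed

text \<open>The factor \<open>exp 2\<close> normalises the value at 0 to 1, which is the maximum.
  For fixed x the values tend to 1 as N grows, so that one family provides both compact support and
  an exhaustion of the line.\<close>

definition bump :: "real \<Rightarrow> real \<Rightarrow> real" where
  "bump N x = exp 2 * (flat_exp 0 (1 - x / N) * flat_exp 0 (1 + x / N))"

lemma smooth_bump: "smooth (bump N)"
proof -
  have "smooth (\<lambda>x. 1 * flat_exp 0 (c * x + 1))" for c
    by (rule smooth_affine[OF smooth_flat_exp])
  then have "smooth (\<lambda>x. flat_exp 0 (c * x + 1))" for c by simp
  from smooth_mult[OF smooth_const smooth_mult[OF this[of "- (1 / N)"] this[of "1 / N"]]]
  have "smooth (\<lambda>x. exp 2 * (flat_exp 0 (- (1 / N) * x + 1) * flat_exp 0 (1 / N * x + 1)))" .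
  moreover have "bump N = (\<lambda>x. exp 2 * (flat_exp 0 (- (1 / N) * x + 1) * flat_exp 0 (1 / N * x + 1)))"
  proof
    fix x
    have "- (1 / N) * x + 1 = 1 - x / N" "1 / N * x + 1 = 1 + x / N" by auto
    then show "bump N x = exp 2 * (flat_exp 0 (- (1 / N) * x + 1) * flat_exp 0 (1 / N * x + 1))"
      unfolding bump_def by metis
  qed
  ultimately show ?thesis by metis
qed

lemma bump_nonneg: "0 \<le> bump N x"
  by (simp add: bump_def flat_exp_def)

lemma bump_eq_0: 
  assumes "N > 0" "\<bar>x\<bar> \<ge> N" shows "bump N x = 0"
proof -
  have "\<bar>x / N\<bar> \<ge> 1" using assms by simp
  then have "\<not> 0 < 1 - x / N \<or> \<not> 0 < 1 + x / N" by linarith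
  then show ?thesis by (auto simp: bump_def flat_exp_def)
qed

lemma bump_pos:
  assumes "N > 0" "\<bar>x\<bar> < N" shows "0 < bump N x"
proof -
  have "\<bar>x / N\<bar> < 1" using assms by simp
  then have "0 < 1 - x / N" "0 < 1 + x / N" by linarith+
  then show ?thesis by (simp add: bump_def flat_exp_def)
qed

lemma bump_le_1: "N > 0 \<Longrightarrow> bump N x \<le> 1"
proof -
  assume N: "N > 0"
  show ?thesis
  proof (cases "\<bar>x\<bar> < N")
    case True
    define y where "y = x / N"
    have y: "\<bar>y\<bar> < 1" using True N by (simp add: y_def)
    then have y2: "y\<^sup>2 < 1" by (simp add: abs_square_less_1)
    have "bump N x = exp (2 + (- (1 / (1 - y))) + (- (1 / (1 + y))))"
      using y by (simp add: bump_def flat_exp_def y_def[symmetric] exp_add[symmetric] abs_less_iff)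
    \<comment> \<open>Partial fractions put the exponent in the form 2 - 2 / (1 - y^2), which is at
      most 0 and vanishes only at y = 0.\<close>
    also have "2 + (- (1 / (1 - y))) + (- (1 / (1 + y))) = 2 - 2 / (1 - y\<^sup>2)"
      using y y2 by (simp add: abs_less_iff field_simps power2_eq_square)
    also have "\<dots> \<le> 0" using y2 by (simp add: field_simps)
    finally show ?thesis by simp
  qed (use N bump_eq_0 in auto)
qed

lemma bump_tendsto_1: "(\<lambda>n. bump (real (Suc n)) x) \<longlonglongrightarrow> 1"
proof -
  have l: "(\<lambda>n. x / real (Suc n)) \<longlonglongrightarrow> 0"
    by (rule LIMSEQ_Suc[OF lim_const_over_n])
  have c: "isCont (flat_exp 0) 1" by (rule DERIV_isCont[OF flat_exp_deriv])
  have "(\<lambda>n. flat_exp 0 (1 - x / real (Suc n))) \<longlonglongrightarrow> flat_exp 0 1"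
    "(\<lambda>n. flat_exp 0 (1 + x / real (Suc n))) \<longlonglongrightarrow> flat_exp 0 1"
    using isCont_tendsto_compose[OF c, of "\<lambda>n. 1 - x / real (Suc n)" sequentially]
      isCont_tendsto_compose[OF c, of "\<lambda>n. 1 + x / real (Suc n)" sequentially]
      tendsto_diff[OF tendsto_const l, of 1] tendsto_add[OF tendsto_const l, of 1] by auto
  then have "(\<lambda>n. bump (real (Suc n)) x) \<longlonglongrightarrow> exp 2 * (flat_exp 0 1 * flat_exp 0 1)"
    unfolding bump_def by (intro tendsto_intros)
  then show ?thesis by (simp add: flat_exp_def mult_exp_exp)
qed

section \<open>Closure properties and approximation power of test functions\<close>

lemma test_function_smooth: "test_function \<phi> \<Longrightarrow> smooth \<phi>"
  by (simp add: test_function_def smooth_def)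

lemma test_functionI: "smooth \<phi> \<Longrightarrow> (\<And>r. \<bar>r\<bar> > M \<Longrightarrow> \<phi> r = 0) \<Longrightarrow> test_function \<phi>"
  by (auto simp: test_function_def smooth_def)

lemma test_function_support:
  assumes "test_function \<phi>" obtains M where "M > 0" "\<And>r. \<bar>r\<bar> > M \<Longrightarrow> \<phi> r = 0"
proof -
  obtain M where M: "\<forall>r. \<bar>r\<bar> > M \<longrightarrow> \<phi> r = 0" using assms by (auto simp: test_function_def)
  then show ?thesis using that[of "max M 1"] by auto
qed

lemma test_function_deriv:
  assumes "test_function \<phi>" shows "test_function (deriv \<phi>)"
proof -
  obtain M where M0: "M > 0" and M: "\<And>r. \<bar>r\<bar> > M \<Longrightarrow> \<phi> r = 0" using test_function_support[OF assms] by blast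
  show ?thesis
  proof (rule test_functionI[of _ M])
    show "smooth (deriv \<phi>)" using assms smooth_deriv test_function_smooth by blast
    fix r assume r: "\<bar>r\<bar> > M"
    have "\<forall>\<^sub>F y in nhds r. y \<in> {y. \<bar>y\<bar> > M}"
      by (rule eventually_nhds_in_open) (use r in \<open>auto intro!: open_Collect_less continuous_intros\<close>)
    then have ev: "\<forall>\<^sub>F y in nhds r. \<phi> y = 0" using M by (auto elim: eventually_mono)
    have "(\<phi> has_real_derivative 0) (at r)"
      by (rule DERIV_cong_ev[OF refl ev refl, THEN iffD2]) simp
    then show "deriv \<phi> r = 0" by (rule DERIV_imp_deriv)
  qed
qed

lemma test_function_shift:
  assumes "test_function \<phi>" shows "test_function (\<lambda>x. \<phi> (x + c))"
proof -
  obtain M where M0: "M > 0" and M: "\<And>r. \<bar>r\<bar> > M \<Longrightarrow> \<phi> r = 0" using test_function_support[OF assms] by blast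
  show ?thesis
  proof (rule test_functionI[of _ "M + \<bar>c\<bar>"])
    show "smooth (\<lambda>x. \<phi> (x + c))"
      using smooth_affine[OF test_function_smooth[OF assms], of 1 1 c] by simp
  qed (use M in auto)
qed

lemma test_function_mult_smooth:
  "test_function \<phi> \<Longrightarrow> smooth f \<Longrightarrow> test_function (\<lambda>x. f x * \<phi> x)"
proof -
  assume \<phi>: "test_function \<phi>" and f: "smooth f"
  obtain M where M0: "M > 0" and M: "\<And>r. \<bar>r\<bar> > M \<Longrightarrow> \<phi> r = 0" using test_function_support[OF \<phi>] by blast
  show ?thesis
    by (rule test_functionI[of _ M]) (auto simp: M intro: smooth_mult f test_function_smooth[OF \<phi>])
qed

lemma test_function_bump: "N > 0 \<Longrightarrow> test_function (bump N)"
  by (rule test_functionI[of _ N]) (auto simp: smooth_bump bump_eq_0)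

lemma test_function_bounded:
  assumes "test_function \<phi>" obtains B where "B > 0" "\<And>r. \<bar>\<phi> r\<bar> \<le> B"
proof -
  obtain M where M0: "M > 0" and M: "\<And>r. \<bar>r\<bar> > M \<Longrightarrow> \<phi> r = 0" using test_function_support[OF assms] by blast
  have "compact (\<phi> ` {-M..M})"
    by (intro compact_continuous_image smooth_continuous test_function_smooth assms) auto
  then have "bounded (\<phi> ` {-M..M})" by (rule compact_imp_bounded)
  then obtain B where B: "B > 0" "\<And>x. x \<in> {-M..M} \<Longrightarrow> \<bar>\<phi> x\<bar> \<le> B"
    unfolding bounded_pos by force
  show ?thesis
  proof (rule that[of B])
    fix r show "\<bar>\<phi> r\<bar> \<le> B"
      using B M[of r] by (cases "r \<in> {-M..M}") auto
  qed (rule B)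
qed

text \<open>Mollification is avoided: a measurable function is an almost everywhere limit of
  continuous ones, these are clipped to height \<open>C\<close>, approximated by polynomials on
  [-N, N], and multiplied by the bump. The limit carries the factor \<open>bump N\<close> for this
  reason, and the bound \<open>C + 1\<close> leaves room for the polynomial error.\<close>

lemma test_approx:
  assumes s: "s \<in> borel_measurable lebesgue" "\<And>x. \<bar>s x\<bar> \<le> C" and N: "N > 0"
  obtains \<phi> where "\<And>n. test_function (\<phi> n)" "\<And>n x. \<bar>\<phi> n x\<bar> \<le> C + 1"
    "\<And>n x. \<bar>x\<bar> \<ge> N \<Longrightarrow> \<phi> n x = 0"
    "AE x in lebesgue. (\<lambda>n. \<phi> n x) \<longlonglongrightarrow> bump N x * s x"
proof -
  obtain Z g where Z: "negligible Z" and g: "\<And>n. continuous_on UNIV (g n)"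
    "\<And>x. x \<notin> Z \<Longrightarrow> (\<lambda>n. g n x) \<longlonglongrightarrow> s x"
    using lebesgue_measurable_imp_measurable_on_real[OF s(1), of UNIV] by (auto simp: measurable_on_def)
  define h where "h n x = max (- C) (min C (g n x))" for n :: nat and x :: real
  have h: "continuous_on UNIV (h n)" "\<bar>h n x\<bar> \<le> C" for n x
    unfolding h_def using s(2)[of 0] by (auto intro!: continuous_intros g)
  have hl: "(\<lambda>n. h n x) \<longlonglongrightarrow> s x" if "x \<notin> Z" for x
  proof -
    have "(\<lambda>n. h n x) \<longlonglongrightarrow> max (- C) (min C (s x))"
      unfolding h_def by (intro tendsto_intros g that)
    moreover have "max (- C) (min C (s x)) = s x" using s(2)[of x] by auto
    ultimately show ?thesis by simp
  qed
  \<comment> \<open>The tolerance tends to 0, so the polynomials inherit the pointwise limit, and it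
    never exceeds 1, which keeps the bound uniform.\<close>
  have "\<exists>p. real_polynomial_function p \<and> (\<forall>x\<in>{-N..N}. \<bar>h n x - p x\<bar> < 1 / Suc n)" for n
    by (rule Stone_Weierstrass_real_polynomial_function[of "{-N..N}" "h n" "1 / Suc n"])
      (auto intro: continuous_on_subset[OF h(1)])
  then obtain p where p: "\<And>n. real_polynomial_function (p n)"
    "\<And>n x. x \<in> {-N..N} \<Longrightarrow> \<bar>h n x - p n x\<bar> < 1 / Suc n" by metis
  show ?thesis
  proof (rule that[of "\<lambda>n x. p n x * bump N x"])
    fix n show "test_function (\<lambda>x. p n x * bump N x)"
      using N p by (intro test_function_mult_smooth test_function_bump smooth_polynomial) auto
  next
    fix n x
    show "\<bar>p n x * bump N x\<bar> \<le> C + 1"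
    proof (cases "x \<in> {-N..N}")
      case True
      have "\<bar>p n x\<bar> \<le> C + 1 / Suc n" using p(2)[OF True, of n] h(2)[of n x] by linarith
      also have "\<dots> \<le> C + 1" by simp
      finally have "\<bar>p n x\<bar> * bump N x \<le> (C + 1) * 1"
        using N by (intro mult_mono bump_le_1 bump_nonneg) auto
      then show ?thesis by (simp add: abs_mult bump_nonneg)
    next
      case False
      then show ?thesis using N bump_eq_0[of N x] s(2)[of 0] by (auto simp: abs_le_iff)
    qed
  next
    fix n x assume "\<bar>x\<bar> \<ge> N" then show "p n x * bump N x = 0" using N bump_eq_0 by simp
  next
    have "(\<lambda>n. p n x * bump N x) \<longlonglongrightarrow> bump N x * s x" if x: "x \<notin> Z" for x
    proof (cases "x \<in> {-N..N}")
      case True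
      have "(\<lambda>n. h n x - p n x) \<longlonglongrightarrow> 0"
        by (rule Lim_null_comparison[OF _ LIMSEQ_Suc[OF lim_1_over_n]])
          (use p(2)[OF True] in \<open>auto intro!: always_eventually less_imp_le\<close>)
      from tendsto_diff[OF hl[OF x] this] have "(\<lambda>n. p n x) \<longlonglongrightarrow> s x" by simp
      from tendsto_mult_left[OF this, of "bump N x"] show ?thesis by (simp add: mult.commute)
    next
      case False
      then show ?thesis using N bump_eq_0[of N x] by auto
    qed
    moreover have "AE x in lebesgue. x \<notin> Z"
      using Z by (simp add: AE_not_in negligible_iff_null_sets)
    ultimately show "AE x in lebesgue. (\<lambda>n. p n x * bump N x) \<longlonglongrightarrow> bump N x * s x"
      by (auto elim: AE_mp)
  qed
qed

section \<open>Square-integrable functions\<close>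

lemma borel_measurable_lebesgue_continuous:
  fixes f :: "real \<Rightarrow> real"
  shows "continuous_on UNIV f \<Longrightarrow> f \<in> borel_measurable lebesgue"
  using borel_measurable_continuous_onI measurable_completion by (metis measurable_lborel1 measurable_lborel2)

lemma measurable_lebesgue_indicator:
  "(indicator {a..b::real} :: real \<Rightarrow> real) \<in> borel_measurable lebesgue"
  by (rule measurable_completion) simp

lemma in_L2_measurable: "in_L2 f \<Longrightarrow> f \<in> borel_measurable lebesgue"
  and in_L2_integrable_sq: "in_L2 f \<Longrightarrow> integrable lebesgue (\<lambda>r. (f r)\<^sup>2)"
  by (auto simp: in_L2_def)

lemma L2_norm_nonneg: "0 \<le> L2_norm_fun f"
  by (simp add: L2_norm_fun_def)

lemma L2_norm_sq: "(L2_norm_fun f)\<^sup>2 = (LINT r|lebesgue. (f r)\<^sup>2)"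
  by (simp add: L2_norm_fun_def)

lemma L2_norm_le_iff: "C \<ge> 0 \<Longrightarrow> L2_norm_fun f \<le> C \<longleftrightarrow> (LINT r|lebesgue. (f r)\<^sup>2) \<le> C\<^sup>2"
  by (metis L2_norm_nonneg L2_norm_sq abs_le_square_iff abs_of_nonneg)

lemma in_L2_dominated:
  assumes "in_L2 g" "f \<in> borel_measurable lebesgue" "AE r in lebesgue. \<bar>f r\<bar> \<le> \<bar>g r\<bar>"
  shows "in_L2 f" "L2_norm_fun f \<le> L2_norm_fun g"
proof -
  have le: "AE r in lebesgue. (f r)\<^sup>2 \<le> (g r)\<^sup>2"
    using assms(3) by eventually_elim (simp add: abs_le_square_iff)
  have int: "integrable lebesgue (\<lambda>r. (f r)\<^sup>2)"
    by (rule Bochner_Integration.integrable_bound[OF in_L2_integrable_sq[OF assms(1)]])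
      (use assms(2) le in auto)
  then show "in_L2 f" using assms(2) by (simp add: in_L2_def)
  show "L2_norm_fun f \<le> L2_norm_fun g"
    unfolding L2_norm_fun_def
    by (intro real_sqrt_le_mono integral_mono_AE int in_L2_integrable_sq assms le)
qed

lemma L2_norm_cong_AE:
  assumes "f \<in> borel_measurable lebesgue" "g \<in> borel_measurable lebesgue"
    "AE r in lebesgue. f r = g r"
  shows "L2_norm_fun f = L2_norm_fun g"
proof -
  have "(LINT r|lebesgue. (f r)\<^sup>2) = (LINT r|lebesgue. (g r)\<^sup>2)"
    using assms by (intro integral_cong_AE) auto
  then show ?thesis by (simp add: L2_norm_fun_def)
qed

lemma in_L2_cong_AE:
  assumes "f \<in> borel_measurable lebesgue" "in_L2 g" "AE r in lebesgue. f r = g r"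
  shows "in_L2 f"
  by (rule in_L2_dominated[OF assms(2,1)]) (use assms(3) in auto)

lemma L2_mult_integrable:
  assumes "in_L2 f" "in_L2 g"
  shows "integrable lebesgue (\<lambda>r. f r * g r)"
proof (rule Bochner_Integration.integrable_bound)
  show "integrable lebesgue (\<lambda>r. (f r)\<^sup>2 + (g r)\<^sup>2)"
    using assms by (auto intro: in_L2_integrable_sq)
  show "(\<lambda>r. f r * g r) \<in> borel_measurable lebesgue"
    using assms[THEN in_L2_measurable] by measurable
  show "AE r in lebesgue. norm (f r * g r) \<le> norm ((f r)\<^sup>2 + (g r)\<^sup>2)"
  proof (rule AE_I2)
    fix r
    have "2 * \<bar>f r\<bar> * \<bar>g r\<bar> \<le> (f r)\<^sup>2 + (g r)\<^sup>2"
      using sum_squares_bound[of "\<bar>f r\<bar>" "\<bar>g r\<bar>"] by simp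
    moreover have "0 \<le> \<bar>f r\<bar> * \<bar>g r\<bar>" by simp
    ultimately have "\<bar>f r\<bar> * \<bar>g r\<bar> \<le> (f r)\<^sup>2 + (g r)\<^sup>2" by linarith
    then show "norm (f r * g r) \<le> norm ((f r)\<^sup>2 + (g r)\<^sup>2)" by (simp add: abs_mult)
  qed
qed

lemma in_L2_cmult: "in_L2 f \<Longrightarrow> in_L2 (\<lambda>r. c * f r)"
  by (auto simp: in_L2_def power_mult_distrib)

lemma L2_norm_cmult: "L2_norm_fun (\<lambda>r. c * f r) = \<bar>c\<bar> * L2_norm_fun f"
  by (simp add: L2_norm_fun_def power_mult_distrib real_sqrt_mult)

lemma in_L2_add:
  assumes "in_L2 f" "in_L2 g" shows "in_L2 (\<lambda>r. f r + g r)"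
proof -
  have "integrable lebesgue (\<lambda>r. (f r)\<^sup>2 + (g r)\<^sup>2 + 2 * (f r * g r))"
    using assms by (auto intro!: Bochner_Integration.integrable_add integrable_mult_right
        in_L2_integrable_sq L2_mult_integrable)
  then show ?thesis using assms[THEN in_L2_measurable]
    by (auto simp: in_L2_def power2_sum mult_ac)
qed

lemma in_L2_diff: "in_L2 f \<Longrightarrow> in_L2 g \<Longrightarrow> in_L2 (\<lambda>r. f r - g r)"
  using in_L2_add[of f "\<lambda>r. (-1) * g r"] in_L2_cmult[of g "-1"] by simp

lemma in_L2_bounded_mult:
  assumes "in_L2 f" "k \<in> borel_measurable lebesgue" "\<And>r. \<bar>k r\<bar> \<le> C"
  shows "in_L2 (\<lambda>r. k r * f r)" "L2_norm_fun (\<lambda>r. k r * f r) \<le> C * L2_norm_fun f"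
proof -
  have C: "0 \<le> C" using assms(3)[of 0] by simp
  have "\<bar>k r * f r\<bar> \<le> \<bar>C * f r\<bar>" for r
    using mult_right_mono[OF assms(3)[of r], of "\<bar>f r\<bar>"] C by (simp add: abs_mult)
  then have "AE r in lebesgue. \<bar>k r * f r\<bar> \<le> \<bar>C * f r\<bar>" by simp
  from in_L2_dominated[OF in_L2_cmult[OF assms(1), of C] _ this]
  show "in_L2 (\<lambda>r. k r * f r)" "L2_norm_fun (\<lambda>r. k r * f r) \<le> C * L2_norm_fun f"
    using in_L2_measurable[OF assms(1)] assms(2) C by (auto simp: L2_norm_cmult)
qed

text \<open>Nonnegativity of the quadratic polynomial x -> int (x f + g)^2, with the degenerate
  leading coefficient treated apart.\<close>

lemma L2_Cauchy_Schwarz: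
  assumes f: "in_L2 f" and g: "in_L2 g"
  shows "\<bar>LINT r|lebesgue. f r * g r\<bar> \<le> L2_norm_fun f * L2_norm_fun g"
proof -
  define F G P where "F = (LINT r|lebesgue. (f r)\<^sup>2)" and "G = (LINT r|lebesgue. (g r)\<^sup>2)"
    and "P = (LINT r|lebesgue. f r * g r)"
  have q: "0 \<le> x\<^sup>2 * F + 2 * x * P + G" for x
  proof -
    have "0 \<le> (LINT r|lebesgue. (x * f r + g r)\<^sup>2)" by simp
    also have "(\<lambda>r. (x * f r + g r)\<^sup>2) = (\<lambda>r. x\<^sup>2 * (f r)\<^sup>2 + 2 * x * (f r * g r) + (g r)\<^sup>2)"
      by (auto simp: power2_sum power_mult_distrib algebra_simps)
    also have "(LINT r|lebesgue. x\<^sup>2 * (f r)\<^sup>2 + 2 * x * (f r * g r) + (g r)\<^sup>2) = x\<^sup>2 * F + 2 * x * P + G"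
      using f g by (simp add: F_def G_def P_def in_L2_integrable_sq L2_mult_integrable)
    finally show ?thesis .
  qed
  have "P\<^sup>2 \<le> F * G"
  proof (cases "F = 0")
    case True
    have "P = 0"
    proof (rule ccontr)
      assume "P \<noteq> 0"
      \<comment> \<open>With F = 0 the polynomial is affine in x; at this point it equals
        -1.\<close>
      then show False using q[of "- (G + 1) / (2 * P)"] True by (simp add: field_simps)
    qed
    then show ?thesis using True by simp
  next
    case False
    then have F: "F > 0" by (simp add: F_def less_le)
    have "0 \<le> (P\<^sup>2 / F - 2 * P\<^sup>2 / F + G) * F"
      \<comment> \<open>The minimiser of the quadratic polynomial.\<close>
      using q[of "- P / F"] F by (intro mult_nonneg_nonneg) (auto simp: power2_eq_square field_simps)
    then show ?thesis using F by (simp add: field_simps)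
  qed
  then have "sqrt (P\<^sup>2) \<le> sqrt (F * G)" by (rule real_sqrt_le_mono)
  then show ?thesis by (simp add: real_sqrt_mult L2_norm_fun_def F_def G_def P_def)
qed

lemma L2_norm_triangle:
  assumes f: "in_L2 f" and g: "in_L2 g"
  shows "L2_norm_fun (\<lambda>r. f r + g r) \<le> L2_norm_fun f + L2_norm_fun g"
proof -
  have "(LINT r|lebesgue. (f r + g r)\<^sup>2) = (LINT r|lebesgue. (f r)\<^sup>2 + (g r)\<^sup>2 + 2 * (f r * g r))"
    by (simp add: power2_sum mult_ac)
  also have "\<dots> = (L2_norm_fun f)\<^sup>2 + (L2_norm_fun g)\<^sup>2 + 2 * (LINT r|lebesgue. f r * g r)"
    using f g by (simp add: L2_norm_sq in_L2_integrable_sq L2_mult_integrable)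
  also have "\<dots> \<le> (L2_norm_fun f + L2_norm_fun g)\<^sup>2"
    using L2_Cauchy_Schwarz[OF f g] by (simp add: power2_sum)
  finally show ?thesis
    by (simp add: L2_norm_le_iff L2_norm_nonneg)
qed

lemma L2_norm_diff_commute: "L2_norm_fun (\<lambda>r. f r - g r) = L2_norm_fun (\<lambda>r. g r - f r)"
  by (simp add: L2_norm_fun_def power2_commute)

lemma L2_norm_triangle_diff:
  assumes f: "in_L2 f" and g: "in_L2 g" and h: "in_L2 h"
  shows "L2_norm_fun (\<lambda>r. f r - h r) \<le> L2_norm_fun (\<lambda>r. f r - g r) + L2_norm_fun (\<lambda>r. g r - h r)"
  using L2_norm_triangle[OF in_L2_diff[OF f g] in_L2_diff[OF g h]] by simp

lemma L2_norm_abs_diff: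
  assumes f: "in_L2 f" and g: "in_L2 g"
  shows "\<bar>L2_norm_fun f - L2_norm_fun g\<bar> \<le> L2_norm_fun (\<lambda>r. f r - g r)"
  using L2_norm_triangle[OF in_L2_diff[OF f g] g] L2_norm_triangle[OF in_L2_diff[OF g f] f]
    L2_norm_diff_commute[of f g] by simp

section \<open>Translations and compactly supported functions\<close>

lemma measurable_shift_lebesgue:
  fixes f :: "real \<Rightarrow> real"
  assumes "f \<in> borel_measurable lebesgue" shows "(\<lambda>r. f (r + c)) \<in> borel_measurable lebesgue"
  using borel_measurable_affine[OF assms, of 1 c] by (simp add: add.commute)

lemma integral_shift_lebesgue:
  fixes f :: "real \<Rightarrow> real"
  shows "(LINT r|lebesgue. f (r + c)) = (LINT r|lebesgue. f r)"
  using lebesgue_integral_real_affine[of 1 f c] by (simp add: add.commute)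

lemma integrable_shift_lebesgue:
  fixes f :: "real \<Rightarrow> real"
  shows "integrable lebesgue f \<Longrightarrow> integrable lebesgue (\<lambda>r. f (r + c))"
  using lebesgue_integrable_real_affine[of f 1 c] by (simp add: add.commute)

lemma in_L2_shift: "in_L2 f \<Longrightarrow> in_L2 (\<lambda>r. f (r + c))"
  using integrable_shift_lebesgue[of "\<lambda>r. (f r)\<^sup>2" c]
  by (auto simp: in_L2_def measurable_shift_lebesgue)

lemma L2_norm_shift: "L2_norm_fun (\<lambda>r. f (r + c)) = L2_norm_fun f"
  using integral_shift_lebesgue[of "\<lambda>r. (f r)\<^sup>2" c] by (simp add: L2_norm_fun_def)

lemma integrable_bounded_support:
  fixes f :: "real \<Rightarrow> real"
  assumes "f \<in> borel_measurable lebesgue" "\<And>r. \<bar>f r\<bar> \<le> C" "\<And>r. \<bar>r\<bar> > M \<Longrightarrow> f r = 0"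
  shows "integrable lebesgue f"
proof (rule Bochner_Integration.integrable_bound)
  show "integrable lebesgue (\<lambda>r. C * indicator {-M..M} r)" 
    by (intro integrable_mult_right) (simp add: lmeasurable_iff_integrable[symmetric])
  have "\<bar>f r\<bar> \<le> C * indicator {-M..M} r" for r
    using assms(2,3)[of r] by (cases "\<bar>r\<bar> \<le> M") (auto simp: indicator_def abs_le_iff)
  then show "AE r in lebesgue. norm (f r) \<le> norm (C * indicator {-M..M} r)"
    by (intro AE_I2) (metis abs_ge_self order_trans real_norm_def)
qed fact

lemma in_L2_bounded_support:
  assumes "f \<in> borel_measurable lebesgue" "\<And>r. \<bar>f r\<bar> \<le> C" "\<And>r. \<bar>r\<bar> > M \<Longrightarrow> f r = 0"
  shows "in_L2 f"
proof -
  have "C \<ge> 0" using assms(2)[of 0] by simp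
  then have "\<bar>(f r)\<^sup>2\<bar> \<le> C\<^sup>2" for r using power_mono[OF assms(2)[of r], of 2] by simp
  then have "integrable lebesgue (\<lambda>r. (f r)\<^sup>2)"
    using assms by (intro integrable_bounded_support[where C = "C\<^sup>2" and M = M]) auto
  with assms(1) show ?thesis by (simp add: in_L2_def)
qed

lemma measurable_test_function: "test_function \<phi> \<Longrightarrow> \<phi> \<in> borel_measurable lebesgue"
  by (intro borel_measurable_lebesgue_continuous smooth_continuous test_function_smooth)

lemma in_L2_test_function: assumes "test_function \<phi>" shows "in_L2 \<phi>"
proof -
  obtain M where "\<And>r. \<bar>r\<bar> > M \<Longrightarrow> \<phi> r = 0" using test_function_support[OF assms] by blast
  moreover obtain B where "\<And>r. \<bar>\<phi> r\<bar> \<le> B" using test_function_bounded[OF assms] by blast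
  ultimately show ?thesis
    using in_L2_bounded_support[OF measurable_test_function[OF assms]] by blast
qed

section \<open>Local square integrability and local integrability\<close>

text \<open>The setting for w1 itself, which can grow at infinity: it pairs with test functions
  although it need not be square-integrable.\<close>

definition locally_L2 :: "(real \<Rightarrow> real) \<Rightarrow> bool" where
  "locally_L2 f \<longleftrightarrow> f \<in> borel_measurable lebesgue \<and> (\<forall>M. in_L2 (\<lambda>r. indicator {-M..M} r * f r))"

lemma locally_L2_measurable: "locally_L2 f \<Longrightarrow> f \<in> borel_measurable lebesgue"
  by (simp add: locally_L2_def)

lemma in_L2_imp_locally: "in_L2 f \<Longrightarrow> locally_L2 f"
  by (auto simp: locally_L2_def in_L2_measurable measurable_lebesgue_indicator
      intro!: in_L2_bounded_mult(1)[where C = 1])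

lemma locally_L2_lin:
  assumes "locally_L2 f" "locally_L2 g" shows "locally_L2 (\<lambda>r. f r - c * g r)"
proof -
  have "in_L2 (\<lambda>r. indicator {-M..M} r * f r - c * (indicator {-M..M} r * g r))" for M
    using assms by (intro in_L2_diff in_L2_cmult) (auto simp: locally_L2_def)
  then show ?thesis using assms by (auto simp: locally_L2_def algebra_simps)
qed

lemma locally_L2_diff: "locally_L2 f \<Longrightarrow> locally_L2 g \<Longrightarrow> locally_L2 (\<lambda>r. f r - g r)"
  using locally_L2_lin[of f g 1] by simp

lemma locally_L2_integrable_test:
  assumes f: "locally_L2 f" and \<phi>: "test_function \<phi>"
  shows "integrable lebesgue (\<lambda>r. f r * \<phi> r)"
proof -
  obtain M where M: "\<And>r. \<bar>r\<bar> > M \<Longrightarrow> \<phi> r = 0" using test_function_support[OF \<phi>] by blast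
  have "integrable lebesgue (\<lambda>r. (indicator {-M..M} r * f r) * \<phi> r)"
    using f by (intro L2_mult_integrable in_L2_test_function[OF \<phi>]) (auto simp: locally_L2_def)
  moreover have "(indicator {-M..M} r * f r) * \<phi> r = f r * \<phi> r" for r
    using M[of r] by (cases "\<bar>r\<bar> \<le> M") (auto simp: indicator_def abs_le_iff)
  ultimately show ?thesis by simp
qed

lemma locally_integrable_indicator:
  "locally_integrable f \<Longrightarrow> integrable lebesgue (\<lambda>r. indicator {-M..M} r * f r)"
  by (auto simp: locally_integrable_def set_integrable_def)

lemma indicator_one_integrable: "integrable lebesgue (indicator {-M..M::real} :: real \<Rightarrow> real)"
  by (simp add: lmeasurable_iff_integrable[symmetric])

lemma in_L2_indicator: "in_L2 (indicator {-M..M::real})"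
  by (rule in_L2_bounded_support[where C = 1 and M = M, OF measurable_lebesgue_indicator]) (auto simp: indicator_def)

lemma locally_L2_locally_integrable:
  assumes "locally_L2 f" shows "locally_integrable f"
  unfolding locally_integrable_def set_integrable_def
proof (intro allI)
  fix a b :: real
  define M where "M = max \<bar>a\<bar> \<bar>b\<bar>"
  have "integrable lebesgue (\<lambda>r. indicator {-M..M} r * f r * indicator {-M..M} r)"
    using assms by (intro L2_mult_integrable in_L2_indicator) (auto simp: locally_L2_def)
  then show "integrable lebesgue (\<lambda>x. indicat_real {a..b} x *\<^sub>R f x)"
  proof (rule Bochner_Integration.integrable_bound)
    show "(\<lambda>x. indicat_real {a..b} x *\<^sub>R f x) \<in> borel_measurable lebesgue"
      unfolding real_scaleR_def
      by (intro borel_measurable_times measurable_lebesgue_indicator locally_L2_measurable assms)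
  qed (auto simp: indicator_def M_def)
qed

lemma locally_integrable_integrable_test:
  assumes f: "locally_integrable f" and \<phi>: "test_function \<phi>"
  shows "integrable lebesgue (\<lambda>r. f r * \<phi> r)"
proof -
  obtain M where M: "\<And>r. \<bar>r\<bar> > M \<Longrightarrow> \<phi> r = 0" using test_function_support[OF \<phi>] by blast
  obtain B where B: "B > 0" "\<And>r. \<bar>\<phi> r\<bar> \<le> B" using test_function_bounded[OF \<phi>] by blast
  have int: "integrable lebesgue (\<lambda>r. B * (indicator {-M..M} r * f r))"
    by (intro integrable_mult_right locally_integrable_indicator f)
  have eq: "f r * \<phi> r = (indicator {-M..M} r * f r) * \<phi> r" for r
    using M[of r] by (cases "\<bar>r\<bar> \<le> M") (auto simp: indicator_def abs_le_iff)
  show ?thesis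
  proof (rule Bochner_Integration.integrable_bound[OF int])
    show "(\<lambda>r. f r * \<phi> r) \<in> borel_measurable lebesgue"
      unfolding eq by (intro borel_measurable_times measurable_test_function[OF \<phi>]
          borel_measurable_integrable locally_integrable_indicator f)
    have "\<bar>f r * \<phi> r\<bar> \<le> \<bar>B * (indicator {-M..M} r * f r)\<bar>" for r
      unfolding eq using mult_left_mono[OF B(2)[of r], of "\<bar>indicator {-M..M} r * f r\<bar>"] B(1)
      by (simp add: abs_mult mult_ac)
    then show "AE r in lebesgue. norm (f r * \<phi> r) \<le> norm (B * (indicator {-M..M} r * f r))"
      by simp
  qed
qed

section \<open>Duality with test functions\<close>

definition clip :: "real \<Rightarrow> real \<Rightarrow> real" where
  "clip n y = max (- n) (min n y)"

lemma clip_bound: "n \<ge> 0 \<Longrightarrow> \<bar>clip n y\<bar> \<le> n"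
  by (auto simp: clip_def)

lemma clip_mult_self:
  assumes "n \<ge> 0" shows "(clip n y)\<^sup>2 \<le> y * clip n y"
proof -
  consider "y > n" | "y < - n" | "\<bar>y\<bar> \<le> n" by linarith
  then show ?thesis
  proof cases
    case 1
    then show ?thesis using assms by (simp add: clip_def power2_eq_square mult_right_mono)
  next
    case 2
    then show ?thesis using assms mult_right_mono[of n "- y" n]
      by (simp add: clip_def power2_eq_square)
  next
    case 3
    then have "clip n y = y" by (auto simp: clip_def)
    then show ?thesis by (simp add: power2_eq_square)
  qed
qed

lemma clip_abs_le: "n \<ge> 0 \<Longrightarrow> \<bar>clip n y\<bar> \<le> \<bar>y\<bar>"
  by (auto simp: clip_def)

lemma measurable_clip: "f \<in> borel_measurable M \<Longrightarrow> (\<lambda>r. clip n (f r)) \<in> borel_measurable M"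
  unfolding clip_def by (intro borel_measurable_max borel_measurable_min borel_measurable_const)

lemma clip_tendsto: "(\<lambda>n. clip (real (Suc n)) y) \<longlonglongrightarrow> y"
proof (rule tendsto_eventually)
  obtain m :: nat where "\<bar>y\<bar> \<le> m" using real_arch_simple by blast
  then have "clip (real (Suc n)) y = y" if "n \<ge> m" for n
    using that by (auto simp: clip_def)
  then show "\<forall>\<^sub>F n in sequentially. clip (real (Suc n)) y = y"
    by (auto simp: eventually_sequentially)
qed

text \<open>Bounded and compactly supported, hence a limit of test functions; at the same time it is
  \<open>h\<close> multiplied by a factor in [0, 1], so that pairing it with \<open>h\<close>
  dominates its own square. Both properties together turn it into the ideal test object for
  \<open>h\<close>.\<close>

definition cutoff :: "(real \<Rightarrow> real) \<Rightarrow> nat \<Rightarrow> real \<Rightarrow> real" where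
  "cutoff h n r = bump (real (Suc n)) r * clip (real (Suc n)) (h r)"

lemma measurable_cutoff: 
  "h \<in> borel_measurable lebesgue \<Longrightarrow> cutoff h n \<in> borel_measurable lebesgue"
  unfolding cutoff_def[abs_def]
  by (rule borel_measurable_times[OF measurable_test_function[OF test_function_bump] measurable_clip]) auto

lemma cutoff_tendsto: "(\<lambda>n. cutoff h n r) \<longlonglongrightarrow> h r"
  unfolding cutoff_def using tendsto_mult[OF bump_tendsto_1 clip_tendsto, of r "h r"] by simp

lemma cutoff_abs_le: "\<bar>cutoff h n r\<bar> \<le> \<bar>h r\<bar>"
proof -
  have "\<bar>cutoff h n r\<bar> \<le> 1 * \<bar>h r\<bar>"
    unfolding cutoff_def abs_mult by (intro mult_mono clip_abs_le)
      (use bump_nonneg[of "real (Suc n)" r] bump_le_1[of "real (Suc n)" r] in auto)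
  then show ?thesis by simp
qed

lemma cutoff_mult_self: "(cutoff h n r)\<^sup>2 \<le> h r * cutoff h n r"
proof -
  have b: "0 \<le> bump (real (Suc n)) r" "bump (real (Suc n)) r \<le> 1"
    using bump_nonneg[of "real (Suc n)" r] bump_le_1[of "real (Suc n)" r] by auto
  have c: "(clip (real (Suc n)) (h r))\<^sup>2 \<le> h r * clip (real (Suc n)) (h r)"
    by (rule clip_mult_self) simp
  have "(cutoff h n r)\<^sup>2 = (bump (real (Suc n)) r)\<^sup>2 * (clip (real (Suc n)) (h r))\<^sup>2"
    by (simp add: cutoff_def power_mult_distrib)
  also have "\<dots> \<le> bump (real (Suc n)) r * (h r * clip (real (Suc n)) (h r))"
    by (intro mult_mono c) (use b in \<open>auto simp: power2_eq_square intro: mult_left_le\<close>)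
  finally show ?thesis by (simp add: cutoff_def mult_ac)
qed

text \<open>The convergence is given in two forms: in L^2, for norms, and almost everywhere with a
  fixed compactly supported majorant, for pairings with functions that are only locally integrable.
  The bound is the truncation height \<open>n + 1\<close> plus the error 1 of
  \<open>test_approx\<close>.\<close>

lemma cutoff_approx:
  assumes h: "h \<in> borel_measurable lebesgue"
  obtains \<phi> where "\<And>k. test_function (\<phi> k)" 
    "\<And>k r. \<bar>\<phi> k r\<bar> \<le> (real n + 2) * indicator {-real (Suc n)..real (Suc n)} r"
    "AE r in lebesgue. (\<lambda>k. \<phi> k r) \<longlonglongrightarrow> cutoff h n r"
    "in_L2 (cutoff h n)"
    "(\<lambda>k. L2_norm_fun (\<lambda>r. cutoff h n r - \<phi> k r)) \<longlonglongrightarrow> 0"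
proof -
  let ?N = "real (Suc n)"
  have 1: "(\<lambda>r. clip ?N (h r)) \<in> borel_measurable lebesgue" by (rule measurable_clip[OF h])
  have 2: "\<bar>clip ?N (h r)\<bar> \<le> ?N" for r by (rule clip_bound) simp
  have 3: "0 < ?N" by simp
  obtain \<phi> where t: "\<And>k. test_function (\<phi> k)" and b: "\<And>k r. \<bar>\<phi> k r\<bar> \<le> ?N + 1"
    and z: "\<And>k r. \<bar>r\<bar> \<ge> ?N \<Longrightarrow> \<phi> k r = 0"
    and l: "AE r in lebesgue. (\<lambda>k. \<phi> k r) \<longlonglongrightarrow> cutoff h n r"
    using test_approx[OF 1 2 3] unfolding cutoff_def by blast
  have b': "\<bar>\<phi> k r\<bar> \<le> (real n + 2) * indicator {-?N..?N} r" for k r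
  proof (cases "\<bar>r\<bar> \<le> ?N")
    case True
    then have "r \<in> {-?N..?N}" by auto
    then show ?thesis using b[of k r] by simp
  qed (use z[of r k] in auto)
  have c: "\<bar>cutoff h n r\<bar> \<le> (real n + 2) * indicator {-?N..?N} r" for r
  proof (cases "\<bar>r\<bar> \<le> ?N")
    case True
    then have i: "r \<in> {-?N..?N}" by auto
    have "\<bar>cutoff h n r\<bar> \<le> 1 * ?N"
      unfolding abs_mult cutoff_def
      by (intro mult_mono 2) (use bump_nonneg[of ?N r] bump_le_1[OF 3, of r] in auto)
    then show ?thesis using i by simp
  qed (use bump_eq_0[OF 3, of r] in \<open>auto simp: cutoff_def\<close>)
  have sq: "(x - y)\<^sup>2 \<le> (2 * (real n + 2))\<^sup>2 * indicator {-?N..?N} r"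
    if "\<bar>x\<bar> \<le> (real n + 2) * indicator {-?N..?N} r" "\<bar>y\<bar> \<le> (real n + 2) * indicator {-?N..?N} r" for x y r :: real
  proof (cases "r \<in> {-?N..?N}")
    case True
    then have "\<bar>x - y\<bar> \<le> 2 * (real n + 2)" using that by simp
    then have "\<bar>x - y\<bar>\<^sup>2 \<le> (2 * (real n + 2))\<^sup>2" by (intro power_mono) auto
    then show ?thesis using True by simp
  qed (use that in auto)
  have int: "integrable lebesgue (\<lambda>r. (2 * (real n + 2))\<^sup>2 * indicator {-?N..?N} r)"
    by (intro integrable_mult_right indicator_one_integrable)
  note mh = measurable_cutoff[OF h, of n] and mt = measurable_test_function[OF t]
  have cL: "in_L2 (cutoff h n)"
  proof (rule in_L2_bounded_support[OF mh, of "real n + 2" ?N])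
    have "(real n + 2) * indicator {-?N..?N} r \<le> real n + 2" for r by (auto simp: indicator_def)
    then show "\<bar>cutoff h n r\<bar> \<le> real n + 2" for r
      using c[of r] order_trans by blast
    show "cutoff h n r = 0" if "\<bar>r\<bar> > ?N" for r
      using bump_eq_0[OF 3, of r] that by (simp add: cutoff_def)
  qed
  have "(\<lambda>k. LINT r|lebesgue. (cutoff h n r - \<phi> k r)\<^sup>2) \<longlonglongrightarrow> (LINT r|(lebesgue :: real measure). 0)"
  proof (rule integral_dominated_convergence[OF _ _ int])
    show "AE r in lebesgue. (\<lambda>k. (cutoff h n r - \<phi> k r)\<^sup>2) \<longlonglongrightarrow> 0"
      using l by eventually_elim (auto intro!: tendsto_eq_intros)
    show "\<And>k. AE r in lebesgue. norm ((cutoff h n r - \<phi> k r)\<^sup>2)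
        \<le> (2 * (real n + 2))\<^sup>2 * indicator {-?N..?N} r"
      by (intro AE_I2) (use sq[OF c b'] in simp)
  qed (use mh mt in measurable)
  then have "(\<lambda>k. LINT r|lebesgue. (cutoff h n r - \<phi> k r)\<^sup>2) \<longlonglongrightarrow> 0" by simp
  from tendsto_real_sqrt[OF this]
  have lim: "(\<lambda>k. L2_norm_fun (\<lambda>r. cutoff h n r - \<phi> k r)) \<longlonglongrightarrow> 0"
    unfolding L2_norm_fun_def by simp
  then show ?thesis using that[OF t b' l cL lim] by blast
qed

lemma L2_norm_tendsto:
  assumes "in_L2 f" "\<And>k. in_L2 (g k)" "((\<lambda>k. L2_norm_fun (\<lambda>r. f r - g k r)) \<longlongrightarrow> 0) F"
  shows "((\<lambda>k. L2_norm_fun (g k)) \<longlongrightarrow> L2_norm_fun f) F"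
proof -
  have "((\<lambda>k. L2_norm_fun (g k) - L2_norm_fun f) \<longlongrightarrow> 0) F"
    by (rule Lim_null_comparison[OF always_eventually assms(3)])
      (use L2_norm_abs_diff[OF assms(1,2)] in \<open>simp add: abs_minus_commute\<close>)
  then show ?thesis by (simp add: LIM_zero_iff)
qed

lemma integral_mult_cutoff:
  assumes h: "locally_integrable h" and hm: "h \<in> borel_measurable lebesgue"
    and t: "\<And>k. test_function (\<phi> k)"
    and b: "\<And>k r. \<bar>\<phi> k r\<bar> \<le> (real n + 2) * indicator {-real (Suc n)..real (Suc n)} r"
    and l: "AE r in lebesgue. (\<lambda>k. \<phi> k r) \<longlonglongrightarrow> cutoff h n r"
  shows "integrable lebesgue (\<lambda>r. h r * cutoff h n r)"
    "(\<lambda>k. LINT r|lebesgue. h r * \<phi> k r) \<longlonglongrightarrow> (LINT r|lebesgue. h r * cutoff h n r)"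
proof -
  let ?I = "indicator {-real (Suc n)..real (Suc n)} :: real \<Rightarrow> real"
  have int: "integrable lebesgue (\<lambda>r. \<bar>(real n + 2) * (?I r * h r)\<bar>)"
    using locally_integrable_indicator[OF h] by (intro integrable_abs integrable_mult_right)
  have b': "AE r in lebesgue. norm (h r * \<phi> k r) \<le> \<bar>(real n + 2) * (?I r * h r)\<bar>" for k
  proof (rule AE_I2)
    fix r
    show "norm (h r * \<phi> k r) \<le> \<bar>(real n + 2) * (?I r * h r)\<bar>"
      using mult_left_mono[OF b[of k r], of "\<bar>h r\<bar>"] by (simp add: abs_mult mult_ac)
  qed
  have l': "AE r in lebesgue. (\<lambda>k. h r * \<phi> k r) \<longlonglongrightarrow> h r * cutoff h n r"
    using l by eventually_elim (auto intro!: tendsto_intros)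
  have m1: "(\<lambda>r. h r * cutoff h n r) \<in> borel_measurable lebesgue"
    by (intro borel_measurable_times[OF hm] measurable_cutoff[OF hm])
  have m2: "(\<lambda>r. h r * \<phi> k r) \<in> borel_measurable lebesgue" for k
    by (intro borel_measurable_times[OF hm] measurable_test_function[OF t])
  show "integrable lebesgue (\<lambda>r. h r * cutoff h n r)"
    by (rule integrable_dominated_convergence[OF m1 m2 int l' b'])
  show "(\<lambda>k. LINT r|lebesgue. h r * \<phi> k r) \<longlonglongrightarrow> (LINT r|lebesgue. h r * cutoff h n r)"
    by (rule integral_dominated_convergence[OF m1 m2 int l' b'])
qed

text \<open>A functional on test functions that is bounded in the L^2 norm and given by a locally
  square-integrable function comes from an element of L^2. Testing \<open>h\<close> against its
  truncation h_n gives ||h_n||^2 <= int h h_n <= K ||h_n||, hence ||h_n|| <= K, and Fatou's lemma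
  passes to \<open>h\<close>.\<close>

lemma L2_duality:
  assumes h: "locally_L2 h" and K: "K \<ge> 0"
    and le: "\<And>\<phi>. test_function \<phi> \<Longrightarrow> \<bar>LINT r|lebesgue. h r * \<phi> r\<bar> \<le> K * L2_norm_fun \<phi>"
  shows "in_L2 h" "L2_norm_fun h \<le> K"
proof -
  note hm = locally_L2_measurable[OF h]
  have B: "(LINT r|lebesgue. (cutoff h n r)\<^sup>2) \<le> K\<^sup>2 \<and> in_L2 (cutoff h n)" for n
  proof -
    obtain \<phi> where t: "\<And>k. test_function (\<phi> k)"
      and b: "\<And>k r. \<bar>\<phi> k r\<bar> \<le> (real n + 2) * indicator {-real (Suc n)..real (Suc n)} r"
      and l: "AE r in lebesgue. (\<lambda>k. \<phi> k r) \<longlonglongrightarrow> cutoff h n r"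
      and cL: "in_L2 (cutoff h n)"
      and dl: "(\<lambda>k. L2_norm_fun (\<lambda>r. cutoff h n r - \<phi> k r)) \<longlonglongrightarrow> 0"
      using cutoff_approx[OF hm, of n] by blast
    have nl: "(\<lambda>k. L2_norm_fun (\<phi> k)) \<longlonglongrightarrow> L2_norm_fun (cutoff h n)"
      by (rule L2_norm_tendsto[OF cL in_L2_test_function[OF t] dl])
    note lim = integral_mult_cutoff[OF locally_L2_locally_integrable[OF h] hm t b l]
    \<comment> \<open>The truncation is not a test function, so the hypothesis is carried over to it
      along the approximating sequence.\<close>
    have "\<bar>LINT r|lebesgue. h r * cutoff h n r\<bar> \<le> K * L2_norm_fun (cutoff h n)"
      by (rule LIMSEQ_le[OF tendsto_rabs[OF lim(2)] tendsto_mult_left[OF nl]]) (use le[OF t] in blast)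
    moreover have "(L2_norm_fun (cutoff h n))\<^sup>2 \<le> (LINT r|lebesgue. h r * cutoff h n r)"
      unfolding L2_norm_sq
      by (intro integral_mono in_L2_integrable_sq cL lim(1) cutoff_mult_self)
    ultimately have "L2_norm_fun (cutoff h n) * L2_norm_fun (cutoff h n) \<le> K * L2_norm_fun (cutoff h n)"
      unfolding power2_eq_square by linarith
    then have "L2_norm_fun (cutoff h n) \<le> K"
      using L2_norm_nonneg[of "cutoff h n"] K by (auto simp: mult_le_cancel_right)
    then show ?thesis using cL K by (simp add: L2_norm_le_iff)
  qed
  \<comment> \<open>Integrability of the square of \<open>h\<close> is still unknown here, so the
    passage to the limit takes place with extended values.\<close>
  have "(\<integral>\<^sup>+r. ennreal ((h r)\<^sup>2) \<partial>lebesgue) = (\<integral>\<^sup>+r. liminf (\<lambda>n. ennreal ((cutoff h n r)\<^sup>2)) \<partial>lebesgue)"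
  proof (rule nn_integral_cong)
    fix r
    have "(\<lambda>n. ennreal ((cutoff h n r)\<^sup>2)) \<longlonglongrightarrow> ennreal ((h r)\<^sup>2)"
      by (intro tendsto_ennrealI tendsto_power cutoff_tendsto)
    from lim_imp_Liminf[OF _ this] show "ennreal ((h r)\<^sup>2) = liminf (\<lambda>n. ennreal ((cutoff h n r)\<^sup>2))"
      by simp
  qed
  also have "\<dots> \<le> liminf (\<lambda>n. \<integral>\<^sup>+r. ennreal ((cutoff h n r)\<^sup>2) \<partial>lebesgue)"
    by (intro nn_integral_liminf measurable_compose[OF _ measurable_ennreal] borel_measurable_power measurable_cutoff[OF hm])
  also have "\<dots> \<le> liminf (\<lambda>n::nat. ennreal (K\<^sup>2))"
  proof (intro Liminf_mono always_eventually allI)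
    fix n
    have "(\<integral>\<^sup>+r. ennreal ((cutoff h n r)\<^sup>2) \<partial>lebesgue) = ennreal (LINT r|lebesgue. (cutoff h n r)\<^sup>2)"
      using B[of n] by (intro nn_integral_eq_integral in_L2_integrable_sq) auto
    then show "(\<integral>\<^sup>+r. ennreal ((cutoff h n r)\<^sup>2) \<partial>lebesgue) \<le> ennreal (K\<^sup>2)"
      using B[of n] by (simp add: ennreal_leI)
  qed
  finally have nn: "(\<integral>\<^sup>+r. ennreal ((h r)\<^sup>2) \<partial>lebesgue) \<le> ennreal (K\<^sup>2)"
    by (simp add: Liminf_const)
  then have nn': "(\<integral>\<^sup>+r. ennreal (norm ((h r)\<^sup>2)) \<partial>lebesgue) < \<infinity>"
    using le_less_trans[OF _ ennreal_less_top] by simp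
  have "integrable lebesgue (\<lambda>r. (h r)\<^sup>2)"
    by (rule integrableI_bounded[OF borel_measurable_power[OF hm] nn'])
  then show h2: "in_L2 h" using hm by (simp add: in_L2_def)
  have "ennreal (LINT r|lebesgue. (h r)\<^sup>2) \<le> ennreal (K\<^sup>2)"
    using nn nn_integral_eq_integral[OF in_L2_integrable_sq[OF h2]] by simp
  then show "L2_norm_fun h \<le> K" using K by (simp add: L2_norm_le_iff)
qed

lemma eventually_less_obtain:
  assumes "(X :: nat \<Rightarrow> real) \<longlonglongrightarrow> 0" "e > 0" obtains n where "X n < e"
proof -
  have "\<forall>\<^sub>F n in sequentially. X n < e" by (rule order_tendstoD(2)[OF assms])
  then show ?thesis using that by (auto simp: eventually_sequentially)
qed

lemma L2_density:
  assumes f: "in_L2 f" and e: "e > 0"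
  obtains \<phi> where "test_function \<phi>" "L2_norm_fun (\<lambda>r. f r - \<phi> r) < e"
proof -
  note fm = in_L2_measurable[OF f]
  have "(\<lambda>n. LINT r|lebesgue. (f r - cutoff f n r)\<^sup>2) \<longlonglongrightarrow> (LINT r|(lebesgue :: real measure). 0)"
  proof (rule integral_dominated_convergence)
    show "integrable lebesgue (\<lambda>r. (2 * f r)\<^sup>2)" using in_L2_integrable_sq[OF in_L2_cmult[OF f]] .
    show "AE r in lebesgue. (\<lambda>n. (f r - cutoff f n r)\<^sup>2) \<longlonglongrightarrow> 0"
    proof (rule AE_I2)
      fix r
      from tendsto_power[OF tendsto_diff[OF tendsto_const cutoff_tendsto[of f r]], of "f r" 2]
      show "(\<lambda>n. (f r - cutoff f n r)\<^sup>2) \<longlonglongrightarrow> 0" by simp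
    qed
    show "AE r in lebesgue. norm ((f r - cutoff f n r)\<^sup>2) \<le> (2 * f r)\<^sup>2" for n
    proof (rule AE_I2)
      fix r
      have "\<bar>f r - cutoff f n r\<bar> \<le> \<bar>2 * f r\<bar>" using cutoff_abs_le[of f n r] by linarith
      then show "norm ((f r - cutoff f n r)\<^sup>2) \<le> (2 * f r)\<^sup>2" by (simp add: abs_le_square_iff)
    qed
  qed (use fm measurable_cutoff[OF fm] in measurable)
  then have "(\<lambda>n. LINT r|lebesgue. (f r - cutoff f n r)\<^sup>2) \<longlonglongrightarrow> 0" by simp
  from tendsto_real_sqrt[OF this] have "(\<lambda>n. L2_norm_fun (\<lambda>r. f r - cutoff f n r)) \<longlonglongrightarrow> 0"
    unfolding L2_norm_fun_def by simp
  from eventually_less_obtain[OF this, of "e / 2"] e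
  obtain n where n: "L2_norm_fun (\<lambda>r. f r - cutoff f n r) < e / 2" by auto
  obtain \<phi> where t: "\<And>k. test_function (\<phi> k)"
    and "\<And>k r. \<bar>\<phi> k r\<bar> \<le> (real n + 2) * indicator {-real (Suc n)..real (Suc n)} r"
    and "AE r in lebesgue. (\<lambda>k. \<phi> k r) \<longlonglongrightarrow> cutoff f n r"
    and cL: "in_L2 (cutoff f n)"
    and lim: "(\<lambda>k. L2_norm_fun (\<lambda>r. cutoff f n r - \<phi> k r)) \<longlonglongrightarrow> 0"
    using cutoff_approx[OF fm, of n] by blast
  from eventually_less_obtain[OF lim, of "e / 2"] e
  obtain k where k: "L2_norm_fun (\<lambda>r. cutoff f n r - \<phi> k r) < e / 2" by auto
  have "L2_norm_fun (\<lambda>r. f r - \<phi> k r) < e"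
    using L2_norm_triangle_diff[OF f cL in_L2_test_function[OF t[of k]]] n k by linarith
  with t show ?thesis using that by blast
qed

lemma locally_integrable_measurable:
  assumes h: "locally_integrable h" shows "h \<in> borel_measurable lebesgue"
proof (rule borel_measurable_LIMSEQ_real)
  show "(\<lambda>r. indicator {-real n..real n} r * h r) \<in> borel_measurable lebesgue" for n
    using locally_integrable_indicator[OF h] by (rule borel_measurable_integrable)
  fix r :: real
  obtain m :: nat where "\<bar>r\<bar> \<le> m" using real_arch_simple by blast
  then have "indicator {-real n..real n} r * h r = h r" if "n \<ge> m" for n
    using that by (auto simp: indicator_def)
  then show "(\<lambda>n. indicator {-real n..real n} r * h r) \<longlonglongrightarrow> h r"
    by (intro tendsto_eventually) (auto simp: eventually_sequentially)
qed

text \<open>The fundamental lemma of the calculus of variations. Tested against its own truncations,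
  \<open>h\<close> gives a nonnegative integrand with vanishing integral.\<close>

lemma locally_integrable_eq_0_AE:
  assumes h: "locally_integrable h"
    and z: "\<And>\<phi>. test_function \<phi> \<Longrightarrow> (LINT r|lebesgue. h r * \<phi> r) = 0"
  shows "AE r in lebesgue. h r = 0"
proof -
  note hm = locally_integrable_measurable[OF h]
  have "AE r in lebesgue. h r * cutoff h n r = 0" for n
  proof -
    obtain \<phi> where t: "\<And>k. test_function (\<phi> k)"
      and b: "\<And>k r. \<bar>\<phi> k r\<bar> \<le> (real n + 2) * indicator {-real (Suc n)..real (Suc n)} r"
      and l: "AE r in lebesgue. (\<lambda>k. \<phi> k r) \<longlonglongrightarrow> cutoff h n r"
      and "in_L2 (cutoff h n)"
      and "(\<lambda>k. L2_norm_fun (\<lambda>r. cutoff h n r - \<phi> k r)) \<longlonglongrightarrow> 0"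
      using cutoff_approx[OF hm, of n] by blast
    note lim = integral_mult_cutoff[OF h hm t b l]
    have "(LINT r|lebesgue. h r * cutoff h n r) = 0"
      using lim(2) z[OF t] by (simp add: LIMSEQ_const_iff)
    moreover have "0 \<le> h r * cutoff h n r" for r
      using cutoff_mult_self[of h n r] by (meson order_trans zero_le_power2)
    ultimately show ?thesis
      using integral_nonneg_eq_0_iff_AE[OF lim(1)] by simp
  qed
  then have "AE r in lebesgue. \<forall>n. h r * cutoff h n r = 0" unfolding AE_all_countable by blast
  then show ?thesis
  proof eventually_elim
    case (elim r)
    from tendsto_mult_left[OF cutoff_tendsto[of h r], of "h r"] elim
    show ?case by (simp add: LIMSEQ_const_iff)
  qed
qed

section \<open>Strong differentiability in \<open>L\<^sup>2\<close>\<close>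

text \<open>The little-o form of differentiability, in which the estimates below arrive; it also
  covers the one-sided derivative at t = 0.\<close>

lemma has_real_derivative_within_eps:
  fixes F :: "real \<Rightarrow> real"
  assumes e: "(e \<longlongrightarrow> 0) (at t within S)"
    and le: "\<forall>\<^sub>F s in at t within S. \<bar>F s - F t - (s - t) * D\<bar> \<le> e s * \<bar>s - t\<bar>"
  shows "(F has_real_derivative D) (at t within S)"
  unfolding has_field_derivative_iff
proof (rule LIM_zero_cancel, rule Lim_null_comparison[OF _ e])
  have ne: "\<forall>\<^sub>F s in at t within S. s \<noteq> t" by (simp add: eventually_at_filter)
  show "\<forall>\<^sub>F s in at t within S. norm ((F s - F t) / (s - t) - D) \<le> e s"
    using le ne
  proof eventually_elim
    case (elim s)
    then have "(F s - F t) / (s - t) - D = (F s - F t - (s - t) * D) / (s - t)"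
      by (simp add: field_simps)
    with elim show ?case by (simp add: abs_divide divide_le_eq)
  qed
qed

lemma L2_norm_bounded_support:
  assumes f: "f \<in> borel_measurable lebesgue" and C: "\<And>r. \<bar>f r\<bar> \<le> C"
    and z: "\<And>r. \<bar>r\<bar> > M \<Longrightarrow> f r = 0" and M: "M \<ge> 0"
  shows "L2_norm_fun f \<le> C * sqrt (2 * M)"
proof -
  have C0: "C \<ge> 0" using C[of 0] by simp
  have "(LINT r|lebesgue. (f r)\<^sup>2) \<le> (LINT r|lebesgue. C\<^sup>2 * indicator {-M..M} r)"
  proof (rule integral_mono)
    show "integrable lebesgue (\<lambda>r. (f r)\<^sup>2)"
      using in_L2_bounded_support[OF f C z] by (rule in_L2_integrable_sq)
    show "integrable lebesgue (\<lambda>r. C\<^sup>2 * indicator {-M..M} r)"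
      by (intro integrable_mult_right indicator_one_integrable)
    fix r
    show "(f r)\<^sup>2 \<le> C\<^sup>2 * indicator {-M..M} r"
    proof (cases "\<bar>r\<bar> \<le> M")
      case True
      then have "r \<in> {-M..M}" by auto
      then show ?thesis using power_mono[OF C[of r], of 2] by simp
    qed (use z in simp)
  qed
  also have "\<dots> = C\<^sup>2 * (2 * M)"
    using M by simp
  also have "\<dots> = (C * sqrt (2 * M))\<^sup>2" using M by (simp add: power_mult_distrib)
  finally show ?thesis using C0 M by (simp add: L2_norm_le_iff)
qed

section \<open>Continuity and differentiability of translations in L^2\<close>

lemma test_function_lipschitz:
  assumes "test_function \<phi>" obtains B where "B > 0" "\<And>x h. \<bar>\<phi> (x + h) - \<phi> x\<bar> \<le> B * \<bar>h\<bar>"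
proof -
  obtain B where B: "B > 0" "\<And>r. \<bar>deriv \<phi> r\<bar> \<le> B"
    using test_function_bounded[OF test_function_deriv[OF assms]] by blast
  have "norm (\<phi> (x + h) - \<phi> x) \<le> B * norm (x + h - x)" for x h
    by (rule field_differentiable_bound[where S = UNIV and f' = "deriv \<phi>"])
      (use B smooth_has_deriv[OF test_function_smooth[OF assms]] in auto)
  with B(1) show ?thesis by (intro that[of B]) auto
qed

text \<open>The mean value inequality for y -> f y - y f'(x) on the segment from x to x + h, where
  its derivative is at most B |h|.\<close>

lemma quadratic_remainder:
  fixes f :: "real \<Rightarrow> real"
  assumes "\<And>x. (f has_real_derivative f' x) (at x)" "\<And>x h. \<bar>f' (x + h) - f' x\<bar> \<le> B * \<bar>h\<bar>"
  shows "\<bar>f (x + h) - f x - h * f' x\<bar> \<le> B * h\<^sup>2"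
proof -
  have "norm ((\<lambda>y. f y - y * f' x) (x + h) - (\<lambda>y. f y - y * f' x) x) \<le> (B * \<bar>h\<bar>) * norm (x + h - x)"
  proof (rule field_differentiable_bound[where S = "closed_segment x (x + h)" and f' = "\<lambda>y. f' y - f' x"])
    fix z assume z: "z \<in> closed_segment x (x + h)"
    show "((\<lambda>y. f y - y * f' x) has_field_derivative f' z - f' x) (at z within closed_segment x (x + h))"
      by (auto intro!: derivative_eq_intros DERIV_subset[OF assms(1)])
    have "\<bar>f' (x + (z - x)) - f' x\<bar> \<le> B * \<bar>z - x\<bar>" by (rule assms(2))
    moreover have "\<bar>z - x\<bar> \<le> \<bar>h\<bar>"
      using z by (auto simp: closed_segment_eq_real_ivl split: if_splits)
    moreover have "0 \<le> B" using assms(2)[of 0 1] by simp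
    ultimately show "norm (f' z - f' x) \<le> B * \<bar>h\<bar>"
      using mult_left_mono by fastforce
  qed auto
  then show ?thesis by (simp add: algebra_simps power2_eq_square)
qed

lemma L2_shift_test:
  assumes \<phi>: "test_function \<phi>"
  obtains K where "K \<ge> 0" "\<And>h. \<bar>h\<bar> \<le> 1 \<Longrightarrow> L2_norm_fun (\<lambda>r. \<phi> (r + h) - \<phi> r) \<le> K * \<bar>h\<bar>"
    "\<And>h. \<bar>h\<bar> \<le> 1 \<Longrightarrow> L2_norm_fun (\<lambda>r. \<phi> (r + h) - \<phi> r - h * deriv \<phi> r) \<le> K * h\<^sup>2"
proof -
  obtain M where M: "M > 0" "\<And>r. \<bar>r\<bar> > M \<Longrightarrow> \<phi> r = 0" using test_function_support[OF \<phi>] by blast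
  obtain M' where M': "M' > 0" "\<And>r. \<bar>r\<bar> > M' \<Longrightarrow> deriv \<phi> r = 0"
    using test_function_support[OF test_function_deriv[OF \<phi>]] by blast
  obtain B where B: "B > 0" "\<And>x h. \<bar>\<phi> (x + h) - \<phi> x\<bar> \<le> B * \<bar>h\<bar>"
    using test_function_lipschitz[OF \<phi>] by blast
  obtain B' where B': "B' > 0" "\<And>x h. \<bar>deriv \<phi> (x + h) - deriv \<phi> x\<bar> \<le> B' * \<bar>h\<bar>"
    using test_function_lipschitz[OF test_function_deriv[OF \<phi>]] by blast
  have Q: "\<bar>\<phi> (x + h) - \<phi> x - h * deriv \<phi> x\<bar> \<le> B' * h\<^sup>2" for x h
    by (rule quadratic_remainder[OF smooth_has_deriv[OF test_function_smooth[OF \<phi>]] B'(2)])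
  \<comment> \<open>The extra 1 keeps the support of every translate with |h| <= 1 inside one fixed
    interval, so uniform bounds become L^2 bounds.\<close>
  define N where "N = max (M + 1) M'"
  have N: "N \<ge> M + 1" "N \<ge> M'" "N \<ge> 0" using M(1) by (auto simp: N_def)
  define K where "K = (B + B') * sqrt (2 * N)"
  have m1: "(\<lambda>r. \<phi> (r + h) - \<phi> r) \<in> borel_measurable lebesgue" for h
    using measurable_test_function[OF \<phi>] measurable_test_function[OF test_function_shift[OF \<phi>, of h]]
    by measurable
  have m2: "(\<lambda>r. \<phi> (r + h) - \<phi> r - h * deriv \<phi> r) \<in> borel_measurable lebesgue" for h
    using m1[of h] measurable_test_function[OF test_function_deriv[OF \<phi>]] by measurable
  have "L2_norm_fun (\<lambda>r. \<phi> (r + h) - \<phi> r) \<le> K * \<bar>h\<bar>" if h: "\<bar>h\<bar> \<le> 1" for h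
  proof -
    have "L2_norm_fun (\<lambda>r. \<phi> (r + h) - \<phi> r) \<le> (B * \<bar>h\<bar>) * sqrt (2 * N)"
      by (rule L2_norm_bounded_support[OF m1 B(2) _ N(3)]) (use M(2) N h in auto)
    also have "\<dots> \<le> K * \<bar>h\<bar>"
      using B' N by (simp add: K_def algebra_simps)
    finally show ?thesis .
  qed
  moreover have "L2_norm_fun (\<lambda>r. \<phi> (r + h) - \<phi> r - h * deriv \<phi> r) \<le> K * h\<^sup>2" if h: "\<bar>h\<bar> \<le> 1" for h
  proof -
    have "L2_norm_fun (\<lambda>r. \<phi> (r + h) - \<phi> r - h * deriv \<phi> r) \<le> (B' * h\<^sup>2) * sqrt (2 * N)"
      by (rule L2_norm_bounded_support[OF m2 Q _ N(3)]) (use M(2) M'(2) N h in auto)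
    also have "\<dots> \<le> K * h\<^sup>2"
      using B N by (simp add: K_def algebra_simps)
    finally show ?thesis .
  qed
  moreover have "K \<ge> 0" using B B' N by (simp add: K_def)
  ultimately show ?thesis using that by blast
qed

text \<open>The three-epsilon argument: translation preserves the norm and is Lipschitz on a test
  function close to \<open>f\<close>.\<close>

lemma L2_shift_continuous:
  assumes f: "in_L2 f" shows "isCont (\<lambda>c. L2_norm_fun (\<lambda>r. f (r + c) - f r)) 0"
proof -
  have "((\<lambda>c. L2_norm_fun (\<lambda>r. f (r + c) - f r)) \<longlongrightarrow> 0) (at 0)"
  proof (rule tendstoI)
    fix e :: real assume e: "e > 0"
    obtain \<phi> where \<phi>: "test_function \<phi>" "L2_norm_fun (\<lambda>r. f r - \<phi> r) < e / 3"
      using L2_density[OF f, of "e / 3"] e by auto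
    obtain K where K: "K \<ge> 0" "\<And>h. \<bar>h\<bar> \<le> 1 \<Longrightarrow> L2_norm_fun (\<lambda>r. \<phi> (r + h) - \<phi> r) \<le> K * \<bar>h\<bar>"
      "\<And>h. \<bar>h\<bar> \<le> 1 \<Longrightarrow> L2_norm_fun (\<lambda>r. \<phi> (r + h) - \<phi> r - h * deriv \<phi> r) \<le> K * h\<^sup>2"
      using L2_shift_test[OF \<phi>(1)] by blast
    define d where "d = min 1 (e / (3 * (K + 1)))"
    have d: "d > 0" using e K by (simp add: d_def)
    have "L2_norm_fun (\<lambda>r. f (r + c) - f r) < e" if c: "\<bar>c\<bar> < d" for c
    proof -
      note p2 = in_L2_test_function[OF \<phi>(1)]
      have "L2_norm_fun (\<lambda>r. f (r + c) - f r)
          \<le> L2_norm_fun (\<lambda>r. f (r + c) - \<phi> (r + c)) + L2_norm_fun (\<lambda>r. \<phi> (r + c) - f r)"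
        by (intro L2_norm_triangle_diff in_L2_shift f p2)
      also have "L2_norm_fun (\<lambda>r. \<phi> (r + c) - f r)
          \<le> L2_norm_fun (\<lambda>r. \<phi> (r + c) - \<phi> r) + L2_norm_fun (\<lambda>r. \<phi> r - f r)"
        by (intro L2_norm_triangle_diff in_L2_shift f p2)
      also have "L2_norm_fun (\<lambda>r. f (r + c) - \<phi> (r + c)) = L2_norm_fun (\<lambda>r. f r - \<phi> r)"
        using L2_norm_shift[of "\<lambda>r. f r - \<phi> r" c] .
      also have "L2_norm_fun (\<lambda>r. \<phi> r - f r) = L2_norm_fun (\<lambda>r. f r - \<phi> r)"
        by (rule L2_norm_diff_commute)
      also have "L2_norm_fun (\<lambda>r. \<phi> (r + c) - \<phi> r) \<le> K * \<bar>c\<bar>"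
        using K(2) c by (simp add: d_def)
      also have "K * \<bar>c\<bar> \<le> (K + 1) * (e / (3 * (K + 1)))"
        using c K(1) by (intro mult_mono) (auto simp: d_def)
      also have "\<dots> = e / 3" using K(1) by (simp add: field_simps)
      finally show ?thesis using \<phi>(2) by linarith
    qed
    then show "\<forall>\<^sub>F c in at 0. dist (L2_norm_fun (\<lambda>r. f (r + c) - f r)) 0 < e"
      using d unfolding eventually_at by (intro exI[of _ d]) (auto simp: L2_norm_nonneg)
  qed
  moreover have "L2_norm_fun (\<lambda>r. f (r + 0) - f r) = 0" by (simp add: L2_norm_fun_def)
  ultimately show ?thesis unfolding isCont_def by metis
qed

section \<open>From weak to strong time derivatives\<close>

definition L2_continuous :: "(real \<Rightarrow> real \<Rightarrow> real) \<Rightarrow> bool" where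
  "L2_continuous u \<longleftrightarrow> (\<forall>t\<ge>0. in_L2 (u t)) \<and>
     (\<forall>t\<ge>0. ((\<lambda>s. L2_norm_fun (\<lambda>r. u s r - u t r)) \<longlongrightarrow> 0) (at t within {0..}))"

lemma L2_continuous_in: "L2_continuous u \<Longrightarrow> t \<ge> 0 \<Longrightarrow> in_L2 (u t)"
  and L2_continuous_tendsto: "L2_continuous u \<Longrightarrow> t \<ge> 0 \<Longrightarrow>
    ((\<lambda>s. L2_norm_fun (\<lambda>r. u s r - u t r)) \<longlongrightarrow> 0) (at t within {0..})"
  by (auto simp: L2_continuous_def)

text \<open>A weak derivative that is continuous into L^2 is a strong one. For each test function
  the mean value inequality bounds the remainder with a constant that depends only on its L^2 norm,
  and duality removes the test function. Only local square integrability of \<open>a\<close> is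
  assumed: that the increments lie in L^2 is part of the conclusion, which is what makes the result
  applicable to w1.\<close>

lemma strong_derivative:
  assumes a: "\<And>t. t \<ge> 0 \<Longrightarrow> locally_L2 (a t)" and b: "L2_continuous b"
    and deriv: "\<And>\<phi> t. test_function \<phi> \<Longrightarrow> t \<ge> 0 \<Longrightarrow>
      ((\<lambda>s. LINT r|lebesgue. a s r * \<phi> r) has_real_derivative (LINT r|lebesgue. b t r * \<phi> r))
        (at t within {0..})"
    and t: "t \<ge> 0" and e: "e > 0"
  shows "\<forall>\<^sub>F s in at t within {0..}. in_L2 (\<lambda>r. a s r - a t r - (s - t) * b t r) \<and>
    L2_norm_fun (\<lambda>r. a s r - a t r - (s - t) * b t r) \<le> e * \<bar>s - t\<bar>"
proof -
  have "\<forall>\<^sub>F s in at t within {0..}. L2_norm_fun (\<lambda>r. b s r - b t r) < e"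
    by (rule order_tendstoD(2)[OF L2_continuous_tendsto[OF b t] e])
  then obtain d where d: "d > 0"
    "\<And>s. s \<ge> 0 \<Longrightarrow> s \<noteq> t \<Longrightarrow> \<bar>s - t\<bar> < d \<Longrightarrow> L2_norm_fun (\<lambda>r. b s r - b t r) < e"
    by (auto simp: eventually_at dist_real_def)
  have near: "L2_norm_fun (\<lambda>r. b s r - b t r) \<le> e" if "s \<ge> 0" "\<bar>s - t\<bar> < d" for s
    using d(2)[OF that(1) _ that(2)] e by (cases "s = t") (auto simp: L2_norm_fun_def)
  have main: "in_L2 (\<lambda>r. a s r - a t r - (s - t) * b t r) \<and>
    L2_norm_fun (\<lambda>r. a s r - a t r - (s - t) * b t r) \<le> e * \<bar>s - t\<bar>" if s: "s \<ge> 0" "\<bar>s - t\<bar> < d" for s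
  proof -
    let ?h = "\<lambda>r. a s r - a t r - (s - t) * b t r"
    have bt: "in_L2 (b t)" by (rule L2_continuous_in[OF b t])
    have h: "locally_L2 ?h"
      by (intro locally_L2_lin locally_L2_diff a s t in_L2_imp_locally bt)
    have "\<bar>LINT r|lebesgue. ?h r * \<phi> r\<bar> \<le> (e * \<bar>s - t\<bar>) * L2_norm_fun \<phi>" if \<phi>: "test_function \<phi>" for \<phi>
    proof -
      \<comment> \<open>Subtracting the linear part leaves the derivative int (b(\<tau>) - b(t))
        \<phi>, which is small between t and s by continuity of \<open>b\<close>.\<close>
      define F where "F \<tau> = (LINT r|lebesgue. a \<tau> r * \<phi> r) - \<tau> * (LINT r|lebesgue. b t r * \<phi> r)" for \<tau>
      have "norm (F s - F t) \<le> (e * L2_norm_fun \<phi>) * norm (s - t)"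
      proof (rule field_differentiable_bound[where S = "closed_segment t s" and f = F and
            f' = "\<lambda>\<tau>. (LINT r|lebesgue. b \<tau> r * \<phi> r) - (LINT r|lebesgue. b t r * \<phi> r)"])
        fix \<tau> assume \<tau>: "\<tau> \<in> closed_segment t s"
        then have \<tau>0: "\<tau> \<ge> 0" "\<bar>\<tau> - t\<bar> < d"
          using s t by (auto simp: closed_segment_eq_real_ivl split: if_splits)
        have "closed_segment t s \<subseteq> {0..}"
          using s t by (auto simp: closed_segment_eq_real_ivl split: if_splits)
        then show "(F has_field_derivative (LINT r|lebesgue. b \<tau> r * \<phi> r) - (LINT r|lebesgue. b t r * \<phi> r))
            (at \<tau> within closed_segment t s)"
          unfolding F_def
          by (auto intro!: derivative_eq_intros DERIV_subset[OF deriv[OF \<phi> \<tau>0(1)]])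
        note b\<tau> = L2_continuous_in[OF b \<tau>0(1)]
        have "(LINT r|lebesgue. b \<tau> r * \<phi> r) - (LINT r|lebesgue. b t r * \<phi> r)
            = (LINT r|lebesgue. (b \<tau> r - b t r) * \<phi> r)"
          using L2_mult_integrable[OF b\<tau> in_L2_test_function[OF \<phi>]]
            L2_mult_integrable[OF bt in_L2_test_function[OF \<phi>]]
          by (simp add: left_diff_distrib)
        also have "\<bar>\<dots>\<bar> \<le> L2_norm_fun (\<lambda>r. b \<tau> r - b t r) * L2_norm_fun \<phi>"
          by (intro L2_Cauchy_Schwarz in_L2_diff b\<tau> bt in_L2_test_function \<phi>)
        also have "\<dots> \<le> e * L2_norm_fun \<phi>"
          by (intro mult_right_mono near \<tau>0 L2_norm_nonneg)
        finally show "norm ((LINT r|lebesgue. b \<tau> r * \<phi> r) - (LINT r|lebesgue. b t r * \<phi> r))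
            \<le> e * L2_norm_fun \<phi>" by simp
      qed auto
      moreover have "F s - F t = (LINT r|lebesgue. ?h r * \<phi> r)"
      proof -
        note i = locally_L2_integrable_test[OF a[OF s(1)] \<phi>] locally_L2_integrable_test[OF a[OF t] \<phi>]
          locally_L2_integrable_test[OF in_L2_imp_locally[OF bt] \<phi>]
        have "(LINT r|lebesgue. ?h r * \<phi> r)
            = (LINT r|lebesgue. a s r * \<phi> r - a t r * \<phi> r - (s - t) * (b t r * \<phi> r))"
          by (simp add: algebra_simps)
        also have "\<dots> = F s - F t"
          using i by (simp add: F_def algebra_simps)
        finally show ?thesis by simp
      qed
      ultimately show ?thesis by (simp add: mult_ac)
    qed
    then show ?thesis using L2_duality[OF h, of "e * \<bar>s - t\<bar>"] e by auto
  qed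
  show ?thesis
    unfolding eventually_at using d(1) main by (intro exI[of _ d]) (auto simp: dist_real_def)
qed

section \<open>Calculus for curves in L^2\<close>

definition L2_deriv :: "(real \<Rightarrow> real \<Rightarrow> real) \<Rightarrow> (real \<Rightarrow> real) \<Rightarrow> real \<Rightarrow> bool" where
  "L2_deriv a a' t \<longleftrightarrow> t \<ge> 0 \<and> (\<forall>s\<ge>0. in_L2 (a s)) \<and> in_L2 a' \<and>
     ((\<lambda>s. L2_norm_fun (\<lambda>r. a s r - a t r - (s - t) * a' r) / \<bar>s - t\<bar>) \<longlongrightarrow> 0) (at t within {0..})"

lemma L2_derivI:
  assumes "t \<ge> 0" "\<And>s. s \<ge> 0 \<Longrightarrow> in_L2 (a s)" "in_L2 a'"
    and "(e \<longlongrightarrow> 0) (at t within {0..})"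
    and le: "\<And>s. s \<ge> 0 \<Longrightarrow> s \<noteq> t \<Longrightarrow> L2_norm_fun (\<lambda>r. a s r - a t r - (s - t) * a' r) \<le> e s * \<bar>s - t\<bar>"
  shows "L2_deriv a a' t"
proof -
  have "\<forall>\<^sub>F s in at t within {0..}. s \<ge> 0 \<and> s \<noteq> t" by (simp add: eventually_at_filter)
  then have "\<forall>\<^sub>F s in at t within {0..}. norm (L2_norm_fun (\<lambda>r. a s r - a t r - (s - t) * a' r) / \<bar>s - t\<bar>) \<le> e s"
    by eventually_elim (use le in \<open>simp add: L2_norm_nonneg divide_le_eq\<close>)
  with assms show ?thesis unfolding L2_deriv_def by (auto intro: Lim_null_comparison)
qed

lemma L2_derivE:
  assumes "L2_deriv a a' t"
  obtains e where "(e \<longlongrightarrow> 0) (at t within {0..})" "\<And>s. 0 \<le> e s"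
    "\<And>s. s \<ge> 0 \<Longrightarrow> L2_norm_fun (\<lambda>r. a s r - a t r - (s - t) * a' r) \<le> e s * \<bar>s - t\<bar>"
    "\<And>s. s \<ge> 0 \<Longrightarrow> L2_norm_fun (\<lambda>r. a s r - a t r) \<le> (e s + L2_norm_fun a') * \<bar>s - t\<bar>"
proof -
  define e where "e s = L2_norm_fun (\<lambda>r. a s r - a t r - (s - t) * a' r) / \<bar>s - t\<bar>" for s
  have l: "(e \<longlongrightarrow> 0) (at t within {0..})" using assms unfolding L2_deriv_def e_def by blast
  have p: "0 \<le> e s" for s by (simp add: e_def L2_norm_nonneg)
  \<comment> \<open>At s = t the quotient has the value 0 by convention, and the remainder vanishes
    as well.\<close>
  have w: "L2_norm_fun (\<lambda>r. a s r - a t r - (s - t) * a' r) \<le> e s * \<bar>s - t\<bar>" for s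
    by (cases "s = t") (auto simp: e_def L2_norm_fun_def)
  have d: "L2_norm_fun (\<lambda>r. a s r - a t r) \<le> (e s + L2_norm_fun a') * \<bar>s - t\<bar>" if s: "s \<ge> 0" for s
  proof -
    have i: "in_L2 (a s)" "in_L2 (a t)" "in_L2 a'" using assms s by (auto simp: L2_deriv_def)
    have "L2_norm_fun (\<lambda>r. (a s r - a t r - (s - t) * a' r) + (s - t) * a' r)
        \<le> L2_norm_fun (\<lambda>r. a s r - a t r - (s - t) * a' r) + L2_norm_fun (\<lambda>r. (s - t) * a' r)"
      by (intro L2_norm_triangle in_L2_diff in_L2_cmult i)
    then have "L2_norm_fun (\<lambda>r. a s r - a t r) \<le> e s * \<bar>s - t\<bar> + \<bar>s - t\<bar> * L2_norm_fun a'"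
      using w[of s] L2_norm_cmult[of "s - t" a'] by simp
    also have "\<dots> = (e s + L2_norm_fun a') * \<bar>s - t\<bar>" by (simp add: distrib_right)
    finally show ?thesis .
  qed
  show ?thesis by (rule that[OF l p w d])
qed

lemma L2_deriv_inner:
  assumes a: "L2_deriv a a' t" and b: "L2_deriv b b' t"
  shows "((\<lambda>s. LINT r|lebesgue. a s r * b s r) has_real_derivative
    (LINT r|lebesgue. a' r * b t r) + (LINT r|lebesgue. a t r * b' r)) (at t within {0..})"
proof -
  obtain e where e: "(e \<longlongrightarrow> 0) (at t within {0..})" "\<And>s. 0 \<le> e s"
    "\<And>s. s \<ge> 0 \<Longrightarrow> L2_norm_fun (\<lambda>r. a s r - a t r - (s - t) * a' r) \<le> e s * \<bar>s - t\<bar>"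
    "\<And>s. s \<ge> 0 \<Longrightarrow> L2_norm_fun (\<lambda>r. a s r - a t r) \<le> (e s + L2_norm_fun a') * \<bar>s - t\<bar>"
    using L2_derivE[OF a] by blast
  obtain f where f: "(f \<longlongrightarrow> 0) (at t within {0..})" "\<And>s. 0 \<le> f s"
    "\<And>s. s \<ge> 0 \<Longrightarrow> L2_norm_fun (\<lambda>r. b s r - b t r - (s - t) * b' r) \<le> f s * \<bar>s - t\<bar>"
    "\<And>s. s \<ge> 0 \<Longrightarrow> L2_norm_fun (\<lambda>r. b s r - b t r) \<le> (f s + L2_norm_fun b') * \<bar>s - t\<bar>"
    using L2_derivE[OF b] by blast
  let ?e = "\<lambda>s. e s * L2_norm_fun (b t) + L2_norm_fun (a t) * f s
    + (e s + L2_norm_fun a') * (f s + L2_norm_fun b') * \<bar>s - t\<bar>"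
  have le: "\<bar>(LINT r|lebesgue. a s r * b s r) - (LINT r|lebesgue. a t r * b t r)
      - (s - t) * ((LINT r|lebesgue. a' r * b t r) + (LINT r|lebesgue. a t r * b' r))\<bar> \<le> ?e s * \<bar>s - t\<bar>"
    if s: "s \<ge> 0" for s
  proof -
    have ai: "in_L2 (a s)" "in_L2 (a t)" "in_L2 a'" using a s by (auto simp: L2_deriv_def)
    have bi: "in_L2 (b s)" "in_L2 (b t)" "in_L2 b'" using b s by (auto simp: L2_deriv_def)
    let ?wa = "\<lambda>r. a s r - a t r - (s - t) * a' r" and ?wb = "\<lambda>r. b s r - b t r - (s - t) * b' r"
    let ?da = "\<lambda>r. a s r - a t r" and ?db = "\<lambda>r. b s r - b t r"
    have wi: "in_L2 ?wa" "in_L2 ?wb" "in_L2 ?da" "in_L2 ?db"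
      by (intro in_L2_diff in_L2_cmult ai bi)+
    have "(LINT r|lebesgue. a s r * b s r) - (LINT r|lebesgue. a t r * b t r)
      - (s - t) * ((LINT r|lebesgue. a' r * b t r) + (LINT r|lebesgue. a t r * b' r))
      = (LINT r|lebesgue. a s r * b s r - a t r * b t r - ((s - t) * (a' r * b t r) + (s - t) * (a t r * b' r)))"
      using ai bi by (simp add: L2_mult_integrable distrib_left)
    \<comment> \<open>The remainder of the product consists of the two linear remainders, paired
      with the fixed values, and of the product of the increments, which is quadratic in s -
      t.\<close>
    also have "\<dots> = (LINT r|lebesgue. ?wa r * b t r + a t r * ?wb r + ?da r * ?db r)"
      by (intro Bochner_Integration.integral_cong refl) (simp add: algebra_simps)
    also have "\<dots> = (LINT r|lebesgue. ?wa r * b t r) + (LINT r|lebesgue. a t r * ?wb r) + (LINT r|lebesgue. ?da r * ?db r)"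
      by (simp add: L2_mult_integrable wi ai bi)
    finally have "\<bar>(LINT r|lebesgue. a s r * b s r) - (LINT r|lebesgue. a t r * b t r)
      - (s - t) * ((LINT r|lebesgue. a' r * b t r) + (LINT r|lebesgue. a t r * b' r))\<bar>
      \<le> L2_norm_fun ?wa * L2_norm_fun (b t) + L2_norm_fun (a t) * L2_norm_fun ?wb + L2_norm_fun ?da * L2_norm_fun ?db"
      using L2_Cauchy_Schwarz[OF wi(1) bi(2)] L2_Cauchy_Schwarz[OF ai(2) wi(2)] L2_Cauchy_Schwarz[OF wi(3,4)]
      by linarith
    also have "\<dots> \<le> (e s * \<bar>s - t\<bar>) * L2_norm_fun (b t) + L2_norm_fun (a t) * (f s * \<bar>s - t\<bar>)
        + ((e s + L2_norm_fun a') * \<bar>s - t\<bar>) * ((f s + L2_norm_fun b') * \<bar>s - t\<bar>)"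
      by (intro add_mono mult_mono e f s mult_nonneg_nonneg add_nonneg_nonneg L2_norm_nonneg order_refl) simp_all
    also have "\<dots> = ?e s * \<bar>s - t\<bar>" by (simp add: algebra_simps)
    finally show ?thesis .
  qed
  have lim: "(?e \<longlongrightarrow> 0) (at t within {0..})"
    by (rule tendsto_eq_intros e(1) f(1) refl)+ simp
  show ?thesis
    by (rule has_real_derivative_within_eps[OF lim]) (simp add: eventually_at_filter always_eventually le)
qed

text \<open>The multiplier may move with time; uniform first-order and second-order bounds let it
  act on L^2 differentiably. It is used for a fixed weight seen in characteristic
  coordinates.\<close>

lemma L2_deriv_mult:
  assumes a: "L2_deriv a a' t"
    and km: "\<And>s. k s \<in> borel_measurable lebesgue" "k' \<in> borel_measurable lebesgue"
    and kb: "\<And>s r. \<bar>k s r\<bar> \<le> C" "\<And>r. \<bar>k' r\<bar> \<le> C"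
    and kd: "\<And>s r. \<bar>k s r - k t r\<bar> \<le> C * \<bar>s - t\<bar>"
      "\<And>s r. \<bar>k s r - k t r - (s - t) * k' r\<bar> \<le> C * (s - t)\<^sup>2"
  shows "L2_deriv (\<lambda>s r. k s r * a s r) (\<lambda>r. k' r * a t r + k t r * a' r) t"
proof -
  have C: "C \<ge> 0" using kb(2)[of 0] by simp
  have t: "t \<ge> 0" using a by (simp add: L2_deriv_def)
  obtain e where e: "(e \<longlongrightarrow> 0) (at t within {0..})" "\<And>s. 0 \<le> e s"
    "\<And>s. s \<ge> 0 \<Longrightarrow> L2_norm_fun (\<lambda>r. a s r - a t r - (s - t) * a' r) \<le> e s * \<bar>s - t\<bar>"
    "\<And>s. s \<ge> 0 \<Longrightarrow> L2_norm_fun (\<lambda>r. a s r - a t r) \<le> (e s + L2_norm_fun a') * \<bar>s - t\<bar>"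
    using L2_derivE[OF a] by blast
  have ai: "in_L2 (a s)" if "s \<ge> 0" for s using a that by (auto simp: L2_deriv_def)
  have a'i: "in_L2 a'" using a by (auto simp: L2_deriv_def)
  let ?e = "\<lambda>s. C * \<bar>s - t\<bar> * L2_norm_fun (a t) + C * e s + C * ((e s + L2_norm_fun a') * \<bar>s - t\<bar>)"
  show ?thesis
  proof (rule L2_derivI[OF t])
    show "in_L2 (\<lambda>r. k s r * a s r)" if "s \<ge> 0" for s
      by (rule in_L2_bounded_mult(1)[OF ai[OF that] km(1) kb(1)])
    show "in_L2 (\<lambda>r. k' r * a t r + k t r * a' r)"
      by (intro in_L2_add in_L2_bounded_mult(1)[OF ai[OF t] km(2) kb(2)]
          in_L2_bounded_mult(1)[OF a'i km(1) kb(1)])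
    show "(?e \<longlongrightarrow> 0) (at t within {0..})"
      by (rule tendsto_eq_intros e(1) refl)+ simp
    fix s :: real assume s: "s \<ge> 0"
    let ?w = "\<lambda>r. a s r - a t r - (s - t) * a' r" and ?d = "\<lambda>r. a s r - a t r"
    have wi: "in_L2 ?w" "in_L2 ?d" by (intro in_L2_diff in_L2_cmult ai a'i s t)+
    have m: "(\<lambda>r. k s r - k t r - (s - t) * k' r) \<in> borel_measurable lebesgue"
      "(\<lambda>r. k s r - k t r) \<in> borel_measurable lebesgue" using km by measurable
    note i1 = in_L2_bounded_mult[OF ai[OF t] m(1) kd(2)]
    note i2 = in_L2_bounded_mult[OF wi(1) km(1) kb(1), of t]
    note i3 = in_L2_bounded_mult[OF wi(2) m(2) kd(1)]
    have "L2_norm_fun (\<lambda>r. k s r * a s r - k t r * a t r - (s - t) * (k' r * a t r + k t r * a' r))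
      = L2_norm_fun (\<lambda>r. (k s r - k t r - (s - t) * k' r) * a t r + (k t r * ?w r + (k s r - k t r) * ?d r))"
      by (simp add: algebra_simps)
    also have "\<dots> \<le> L2_norm_fun (\<lambda>r. (k s r - k t r - (s - t) * k' r) * a t r) + L2_norm_fun (\<lambda>r. k t r * ?w r + (k s r - k t r) * ?d r)"
      by (intro L2_norm_triangle in_L2_add i1 i2 i3)
    also have "L2_norm_fun (\<lambda>r. k t r * ?w r + (k s r - k t r) * ?d r)
        \<le> L2_norm_fun (\<lambda>r. k t r * ?w r) + L2_norm_fun (\<lambda>r. (k s r - k t r) * ?d r)"
      by (intro L2_norm_triangle i2 i3)
    also have "L2_norm_fun (\<lambda>r. (k s r - k t r - (s - t) * k' r) * a t r) \<le> C * (s - t)\<^sup>2 * L2_norm_fun (a t)"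
      by (rule i1(2))
    also have "L2_norm_fun (\<lambda>r. k t r * ?w r) \<le> C * L2_norm_fun ?w" by (rule i2(2))
    also have "L2_norm_fun ?w \<le> e s * \<bar>s - t\<bar>" by (rule e(3)[OF s])
    also have "L2_norm_fun (\<lambda>r. (k s r - k t r) * ?d r) \<le> C * \<bar>s - t\<bar> * L2_norm_fun ?d" by (rule i3(2))
    also have "L2_norm_fun ?d \<le> (e s + L2_norm_fun a') * \<bar>s - t\<bar>" by (rule e(4)[OF s])
    finally have "L2_norm_fun (\<lambda>r. k s r * a s r - k t r * a t r - (s - t) * (k' r * a t r + k t r * a' r))
      \<le> C * (s - t)\<^sup>2 * L2_norm_fun (a t) + (C * (e s * \<bar>s - t\<bar>) + C * \<bar>s - t\<bar> * ((e s + L2_norm_fun a') * \<bar>s - t\<bar>))"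
      using C by (simp add: mult_left_mono)
    also have "(s - t)\<^sup>2 = \<bar>s - t\<bar> * \<bar>s - t\<bar>" by (simp add: power2_eq_square)
    finally show "L2_norm_fun (\<lambda>r. k s r * a s r - k t r * a t r - (s - t) * (k' r * a t r + k t r * a' r)) \<le> ?e s * \<bar>s - t\<bar>"
      by (simp add: algebra_simps)
  qed
qed

section \<open>Transport equations along characteristics\<close>

text \<open>The hypothesis is the weak form of u_t = c u_r - f. Since u_r is only a distribution,
  the translation is moved to the test function; its time derivative then cancels the transport term
  exactly, and only the source, which lies in L^2, remains.\<close>

lemma weak_transport_shift:
  assumes u: "L2_continuous u" and f: "L2_continuous f"
    and weak: "\<And>\<phi> t. test_function \<phi> \<Longrightarrow> t \<ge> 0 \<Longrightarrow>
      ((\<lambda>s. LINT r|lebesgue. u s r * \<phi> r) has_real_derivative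
        - c * (LINT r|lebesgue. u t r * deriv \<phi> r) - (LINT r|lebesgue. f t r * \<phi> r)) (at t within {0..})"
    and \<phi>: "test_function \<phi>" and t: "t \<ge> 0"
  shows "((\<lambda>s. LINT r|lebesgue. u s (r - c * s) * \<phi> r) has_real_derivative
      (LINT r|lebesgue. - f t (r - c * t) * \<phi> r)) (at t within {0..})"
proof -
  have shift: "(LINT r|lebesgue. w (r - c * s) * \<phi> r) = (LINT r|lebesgue. w r * \<phi> (r + c * s))" for w s
    using integral_shift_lebesgue[of "\<lambda>r. w (r - c * s) * \<phi> r" "c * s"] by simp
  define p where "p = (\<lambda>r. \<phi> (r + c * t))"
  have p: "test_function p" unfolding p_def by (rule test_function_shift[OF \<phi>])
  have p': "test_function (deriv p)" by (rule test_function_deriv[OF p])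
  note pL = in_L2_test_function[OF p] in_L2_test_function[OF p']
  obtain K where K: "K \<ge> 0" "\<And>h. \<bar>h\<bar> \<le> 1 \<Longrightarrow> L2_norm_fun (\<lambda>r. p (r + h) - p r) \<le> K * \<bar>h\<bar>"
    "\<And>h. \<bar>h\<bar> \<le> 1 \<Longrightarrow> L2_norm_fun (\<lambda>r. p (r + h) - p r - h * deriv p r) \<le> K * h\<^sup>2"
    using L2_shift_test[OF p] by blast
  note ui = L2_continuous_in[OF u]
  have pi: "in_L2 (\<lambda>r. p (r + h))" for h by (rule in_L2_shift[OF pL(1)])
  \<comment> \<open>This isolates the motion of the test function from the evolution tested against
    the fixed p. It vanishes at s = t, and its derivative there needs only continuity of
    \<open>u\<close> in time.\<close>
  define B where "B s = (LINT r|lebesgue. u s r * (p (r + c * (s - t)) - p r))" for s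
  have "(B has_real_derivative c * (LINT r|lebesgue. u t r * deriv p r)) (at t within {0..})"
  proof (rule has_real_derivative_within_eps)
    let ?e = "\<lambda>s. (L2_norm_fun (u t) + L2_norm_fun (\<lambda>r. u s r - u t r)) * (K * c\<^sup>2 * \<bar>s - t\<bar>)
      + \<bar>c\<bar> * (L2_norm_fun (\<lambda>r. u s r - u t r) * L2_norm_fun (deriv p))"
    show "(?e \<longlongrightarrow> 0) (at t within {0..})"
      by (rule tendsto_eq_intros L2_continuous_tendsto[OF u t] refl)+ simp
    have "((\<lambda>s. \<bar>c * (s - t)\<bar>) \<longlongrightarrow> 0) (at t within {0..})"
      by (auto intro!: tendsto_eq_intros)
    then have "\<forall>\<^sub>F s in at t within {0..}. \<bar>c * (s - t)\<bar> < 1" by (rule order_tendstoD) simp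
    moreover have "\<forall>\<^sub>F s in at t within {0..}. s \<in> {0..}" by (simp add: eventually_at_filter)
    ultimately show "\<forall>\<^sub>F s in at t within {0..}. \<bar>B s - B t - (s - t) * (c * (LINT r|lebesgue. u t r * deriv p r))\<bar>
        \<le> ?e s * \<bar>s - t\<bar>"
    proof eventually_elim
      case (elim s)
      then have s: "s \<ge> 0" and h1: "\<bar>c * (s - t)\<bar> \<le> 1" by auto
      define h where "h = c * (s - t)"
      have Bt: "B t = 0" by (simp add: B_def)
      have i: "in_L2 (\<lambda>r. p (r + h) - p r - h * deriv p r)" "in_L2 (\<lambda>r. u s r - u t r)"
        by (intro in_L2_diff in_L2_cmult pi pL ui s t)+
      have "B s - h * (LINT r|lebesgue. u t r * deriv p r)
        = (LINT r|lebesgue. u s r * (p (r + h) - p r) - h * (u t r * deriv p r))"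
        unfolding B_def h_def[symmetric]
        by (simp add: L2_mult_integrable in_L2_diff ui s t pi pL)
      also have "\<dots> = (LINT r|lebesgue. u s r * (p (r + h) - p r - h * deriv p r) + h * ((u s r - u t r) * deriv p r))"
        by (intro Bochner_Integration.integral_cong refl) (simp add: algebra_simps)
      also have "\<dots> = (LINT r|lebesgue. u s r * (p (r + h) - p r - h * deriv p r)) + h * (LINT r|lebesgue. (u s r - u t r) * deriv p r)"
        by (simp add: L2_mult_integrable i ui s pL)
      finally have "\<bar>B s - h * (LINT r|lebesgue. u t r * deriv p r)\<bar>
          \<le> \<bar>LINT r|lebesgue. u s r * (p (r + h) - p r - h * deriv p r)\<bar> + \<bar>h\<bar> * \<bar>LINT r|lebesgue. (u s r - u t r) * deriv p r\<bar>"
        by (simp add: abs_mult[symmetric])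
      also have "\<bar>LINT r|lebesgue. u s r * (p (r + h) - p r - h * deriv p r)\<bar>
          \<le> L2_norm_fun (u s) * L2_norm_fun (\<lambda>r. p (r + h) - p r - h * deriv p r)"
        by (intro L2_Cauchy_Schwarz ui s i)
      also have "\<dots> \<le> (L2_norm_fun (u t) + L2_norm_fun (\<lambda>r. u s r - u t r)) * (K * h\<^sup>2)"
        using L2_norm_abs_diff[OF ui[OF s] ui[OF t]] h1
        by (intro mult_mono K(3) add_nonneg_nonneg L2_norm_nonneg) (auto simp: h_def)
      also have "\<bar>LINT r|lebesgue. (u s r - u t r) * deriv p r\<bar> \<le> L2_norm_fun (\<lambda>r. u s r - u t r) * L2_norm_fun (deriv p)"
        by (intro L2_Cauchy_Schwarz i pL)
      finally have "\<bar>B s - h * (LINT r|lebesgue. u t r * deriv p r)\<bar>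
        \<le> (L2_norm_fun (u t) + L2_norm_fun (\<lambda>r. u s r - u t r)) * (K * h\<^sup>2)
          + \<bar>h\<bar> * (L2_norm_fun (\<lambda>r. u s r - u t r) * L2_norm_fun (deriv p))"
        by (simp add: mult_left_mono)
      also have "h\<^sup>2 = c\<^sup>2 * (\<bar>s - t\<bar> * \<bar>s - t\<bar>)" by (simp add: h_def power2_eq_square)
      also have "\<bar>h\<bar> = \<bar>c\<bar> * \<bar>s - t\<bar>" by (simp add: h_def abs_mult)
      finally have X: "\<bar>B s - h * (LINT r|lebesgue. u t r * deriv p r)\<bar>
        \<le> (L2_norm_fun (u t) + L2_norm_fun (\<lambda>r. u s r - u t r)) * (K * (c\<^sup>2 * (\<bar>s - t\<bar> * \<bar>s - t\<bar>)))
          + \<bar>c\<bar> * \<bar>s - t\<bar> * (L2_norm_fun (\<lambda>r. u s r - u t r) * L2_norm_fun (deriv p))" .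
      have eq: "B s - B t - (s - t) * (c * (LINT r|lebesgue. u t r * deriv p r)) = B s - h * (LINT r|lebesgue. u t r * deriv p r)"
        by (simp add: Bt h_def)
      have id: "A * (K * (c\<^sup>2 * (d * d))) + \<bar>c\<bar> * d * Q = (A * (K * c\<^sup>2 * d) + \<bar>c\<bar> * Q) * d" for A d Q
        by (simp add: algebra_simps)
      show ?case unfolding eq using X unfolding id .
    qed
  qed
  moreover have "((\<lambda>s. LINT r|lebesgue. u s r * p r) has_real_derivative
        - c * (LINT r|lebesgue. u t r * deriv p r) - (LINT r|lebesgue. f t r * p r)) (at t within {0..})"
    by (rule weak[OF p t])
  ultimately have sum: "((\<lambda>s. (LINT r|lebesgue. u s r * p r) + B s) has_real_derivative
      - (LINT r|lebesgue. f t r * p r)) (at t within {0..})"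
    using DERIV_add by fastforce
  have eq: "(LINT r|lebesgue. u s r * p r) + B s = (LINT r|lebesgue. u s (r - c * s) * \<phi> r)" if s: "s \<ge> 0" for s
  proof -
    have "(LINT r|lebesgue. u s r * p r) + B s = (LINT r|lebesgue. u s r * p r + u s r * (p (r + c * (s - t)) - p r))"
      unfolding B_def by (simp add: L2_mult_integrable in_L2_diff ui s pi pL)
    also have "\<dots> = (LINT r|lebesgue. u s r * \<phi> (r + c * s))"
      by (simp add: p_def algebra_simps)
    finally show ?thesis by (simp add: shift)
  qed
  have "- (LINT r|lebesgue. f t r * p r) = (LINT r|lebesgue. - f t (r - c * t) * \<phi> r)"
    using shift[of "\<lambda>r. - f t r" t] by (simp add: p_def)
  with sum have "((\<lambda>s. (LINT r|lebesgue. u s r * p r) + B s) has_real_derivative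
      (LINT r|lebesgue. - f t (r - c * t) * \<phi> r)) (at t within {0..})" by simp
  then show ?thesis
    by (rule has_field_derivative_transform_within[where d = 1]) (use t eq in auto)
qed

text \<open>Two variations are separated: that of \<open>f\<close> in time, unaffected by
  translation, and that of the translation acting on the fixed function \<open>f t\<close>.\<close>

lemma L2_continuous_shift:
  assumes f: "L2_continuous f" shows "L2_continuous (\<lambda>s r. - f s (r - c * s))"
  unfolding L2_continuous_def
proof (intro conjI allI impI)
  note fi = L2_continuous_in[OF f]
  have fs: "in_L2 (\<lambda>r. f s (r - h))" if "s \<ge> 0" for s h
    using in_L2_shift[OF fi[OF that], of "- h"] by simp
  show "in_L2 (\<lambda>r. - f s (r - c * s))" if "s \<ge> 0" for s
    using in_L2_cmult[OF fs[OF that], of "-1"] by simp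
  fix t :: real assume t: "t \<ge> 0"
  have "((\<lambda>s. L2_norm_fun (\<lambda>r. f t (r + c * (t - s)) - f t r)) \<longlongrightarrow> L2_norm_fun (\<lambda>r. f t (r + 0) - f t r)) (at t within {0..})"
    by (rule isCont_tendsto_compose[OF L2_shift_continuous[OF fi[OF t]]]) (auto intro!: tendsto_eq_intros)
  then have "((\<lambda>s. L2_norm_fun (\<lambda>r. f t (r + c * (t - s)) - f t r)) \<longlongrightarrow> 0) (at t within {0..})"
    by (simp add: L2_norm_fun_def)
  from tendsto_add[OF L2_continuous_tendsto[OF f t] this]
  have lim: "((\<lambda>s. L2_norm_fun (\<lambda>r. f s r - f t r) + L2_norm_fun (\<lambda>r. f t (r + c * (t - s)) - f t r)) \<longlongrightarrow> 0) (at t within {0..})"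
    by simp
  show "((\<lambda>s. L2_norm_fun (\<lambda>r. - f s (r - c * s) - - f t (r - c * t))) \<longlongrightarrow> 0) (at t within {0..})"
  proof (rule Lim_null_comparison[OF _ lim])
    have "\<forall>\<^sub>F s in at t within {0..}. s \<ge> 0" by (simp add: eventually_at_filter)
    then show "\<forall>\<^sub>F s in at t within {0..}. norm (L2_norm_fun (\<lambda>r. - f s (r - c * s) - - f t (r - c * t)))
      \<le> L2_norm_fun (\<lambda>r. f s r - f t r) + L2_norm_fun (\<lambda>r. f t (r + c * (t - s)) - f t r)"
    proof eventually_elim
      case (elim s)
      have "L2_norm_fun (\<lambda>r. - f s (r - c * s) - - f t (r - c * t)) = L2_norm_fun (\<lambda>r. f s (r - c * s) - f t (r - c * t))"
        using L2_norm_diff_commute[of "\<lambda>r. f s (r - c * s)" "\<lambda>r. f t (r - c * t)"] by simp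
      also have "\<dots> \<le> L2_norm_fun (\<lambda>r. f s (r - c * s) - f t (r - c * s)) + L2_norm_fun (\<lambda>r. f t (r - c * s) - f t (r - c * t))"
        by (intro L2_norm_triangle_diff fs elim t)
      also have "L2_norm_fun (\<lambda>r. f s (r - c * s) - f t (r - c * s)) = L2_norm_fun (\<lambda>r. f s r - f t r)"
        using L2_norm_shift[of "\<lambda>r. f s r - f t r" "- (c * s)"] by simp
      also have "L2_norm_fun (\<lambda>r. f t (r - c * s) - f t (r - c * t)) = L2_norm_fun (\<lambda>r. f t (r + c * (t - s)) - f t r)"
        using L2_norm_shift[of "\<lambda>r. f t (r + c * (t - s)) - f t r" "- (c * t)"] by (simp add: algebra_simps)
      finally show ?case by (simp add: L2_norm_nonneg)
    qed
  qed
qed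

lemma L2_deriv_weak:
  assumes a: "\<And>s. s \<ge> 0 \<Longrightarrow> in_L2 (a s)" and b: "L2_continuous b"
    and deriv: "\<And>\<phi> t. test_function \<phi> \<Longrightarrow> t \<ge> 0 \<Longrightarrow>
      ((\<lambda>s. LINT r|lebesgue. a s r * \<phi> r) has_real_derivative (LINT r|lebesgue. b t r * \<phi> r))
        (at t within {0..})"
    and t: "t \<ge> 0"
  shows "L2_deriv a (b t) t"
  unfolding L2_deriv_def
proof (intro conjI t allI impI a L2_continuous_in[OF b t] tendstoI)
  fix e :: real assume e: "e > 0"
  have "\<forall>\<^sub>F s in at t within {0..}. in_L2 (\<lambda>r. a s r - a t r - (s - t) * b t r) \<and>
    L2_norm_fun (\<lambda>r. a s r - a t r - (s - t) * b t r) \<le> e / 2 * \<bar>s - t\<bar>"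
    by (rule strong_derivative[OF in_L2_imp_locally[OF a] b deriv t]) (use e in auto)
  moreover have "\<forall>\<^sub>F s in at t within {0..}. s \<noteq> t" by (simp add: eventually_at_filter)
  ultimately show "\<forall>\<^sub>F s in at t within {0..}.
      dist (L2_norm_fun (\<lambda>r. a s r - a t r - (s - t) * b t r) / \<bar>s - t\<bar>) 0 < e"
  proof eventually_elim
    case (elim s)
    then have "L2_norm_fun (\<lambda>r. a s r - a t r - (s - t) * b t r) < e * \<bar>s - t\<bar>"
      using e by (intro le_less_trans[OF conjunct2[OF elim(1)]] mult_strict_right_mono) auto
    with elim(2) show ?case by (simp add: L2_norm_nonneg divide_less_eq)
  qed
qed

lemma transport_energy:
  assumes u: "L2_continuous u" and f: "L2_continuous f"
    and weak: "\<And>\<phi> t. test_function \<phi> \<Longrightarrow> t \<ge> 0 \<Longrightarrow>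
      ((\<lambda>s. LINT r|lebesgue. u s r * \<phi> r) has_real_derivative
        - c * (LINT r|lebesgue. u t r * deriv \<phi> r) - (LINT r|lebesgue. f t r * \<phi> r)) (at t within {0..})"
    and c: "\<bar>c\<bar> \<le> 1"
    and k: "\<And>r. (k has_real_derivative k' r) (at r)" "continuous_on UNIV k'"
    and kb: "\<And>r. \<bar>k r\<bar> \<le> C" "\<And>r. \<bar>k' r\<bar> \<le> C" "\<And>r h. \<bar>k' (r + h) - k' r\<bar> \<le> C * \<bar>h\<bar>"
    and t: "t \<ge> 0"
  shows "((\<lambda>s. LINT r|lebesgue. k r * (u s r)\<^sup>2) has_real_derivative
      - c * (LINT r|lebesgue. k' r * (u t r)\<^sup>2) - 2 * (LINT r|lebesgue. k r * f t r * u t r)) (at t within {0..})"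
proof -
  have C: "C \<ge> 0" using kb(2)[of 0] by simp
  note ui = L2_continuous_in[OF u] and fi = L2_continuous_in[OF f]
  define v where "v s r = u s (r - c * s)" for s r
  define g where "g s r = - f s (r - c * s)" for s r
  have vi: "in_L2 (v s)" if "s \<ge> 0" for s
    using in_L2_shift[OF ui[OF that], of "- (c * s)"] by (simp add: v_def[abs_def])
  have v: "L2_deriv v (g t) t"
  proof (rule L2_deriv_weak[OF vi _ _ t])
    show "L2_continuous g" unfolding g_def[abs_def] by (rule L2_continuous_shift[OF f])
    show "((\<lambda>s. LINT r|lebesgue. v s r * \<phi> r) has_real_derivative (LINT r|lebesgue. g t r * \<phi> r)) (at t within {0..})"
      if "test_function \<phi>" "t \<ge> 0" for \<phi> t
      unfolding v_def g_def by (rule weak_transport_shift[OF u f weak that])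
  qed
  define ks where "ks s r = k (r - c * s)" for s r
  have kc: "continuous_on UNIV k" by (meson DERIV_isCont continuous_at_imp_continuous_on k(1))
  have km: "k \<in> borel_measurable lebesgue" "k' \<in> borel_measurable lebesgue"
    by (intro borel_measurable_lebesgue_continuous kc k(2))+
  have k1: "\<bar>k (x + h) - k x\<bar> \<le> C * \<bar>h\<bar>" for x h
    using field_differentiable_bound[of UNIV k k' C "x + h" x] k(1) kb(2) by simp
  have k2: "\<bar>k (x + h) - k x - h * k' x\<bar> \<le> C * h\<^sup>2" for x h
    by (rule quadratic_remainder[OF k(1) kb(3)])
  have cs: "\<bar>c\<bar> * \<bar>x\<bar> \<le> \<bar>x\<bar>" for x :: real using c mult_right_mono[of "\<bar>c\<bar>" 1 "\<bar>x\<bar>"] by simp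
  have kv: "L2_deriv (\<lambda>s r. ks s r * v s r) (\<lambda>r. (- c * k' (r - c * t)) * v t r + ks t r * g t r) t"
  proof (rule L2_deriv_mult[OF v, where C = C])
    show "ks s \<in> borel_measurable lebesgue" for s
      unfolding ks_def[abs_def] using measurable_shift_lebesgue[OF km(1), of "- (c * s)"] by simp
    show "(\<lambda>r. - c * k' (r - c * t)) \<in> borel_measurable lebesgue"
      using measurable_shift_lebesgue[OF km(2), of "- (c * t)"] by (intro borel_measurable_times) simp_all
    show "\<bar>ks s r\<bar> \<le> C" for s r unfolding ks_def by (rule kb(1))
    show "\<bar>- c * k' (r - c * t)\<bar> \<le> C" for r
      using mult_mono[OF c kb(2)[of "r - c * t"]] by (simp add: abs_mult)
    show "\<bar>ks s r - ks t r\<bar> \<le> C * \<bar>s - t\<bar>" for s r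
    proof -
      have "\<bar>k ((r - c * t) + c * (t - s)) - k (r - c * t)\<bar> \<le> C * \<bar>c * (t - s)\<bar>" by (rule k1)
      also have "\<dots> \<le> C * \<bar>s - t\<bar>"
        unfolding abs_mult using cs[of "t - s"] C by (intro mult_left_mono) auto
      finally show ?thesis by (simp add: ks_def algebra_simps)
    qed
    show "\<bar>ks s r - ks t r - (s - t) * (- c * k' (r - c * t))\<bar> \<le> C * (s - t)\<^sup>2" for s r
    proof -
      have "\<bar>k ((r - c * t) + c * (t - s)) - k (r - c * t) - (c * (t - s)) * k' (r - c * t)\<bar> \<le> C * (c * (t - s))\<^sup>2" by (rule k2)
      moreover have "(c * (t - s))\<^sup>2 \<le> (t - s)\<^sup>2"
        using cs[of "t - s"] by (simp add: abs_mult abs_le_square_iff[symmetric])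
      then have "C * (c * (t - s))\<^sup>2 \<le> C * (s - t)\<^sup>2"
        using C by (simp add: mult_left_mono power2_commute)
      moreover have "(r - c * t) + c * (t - s) = r - c * s"
        "(c * (t - s)) * k' (r - c * t) = (s - t) * (- c * k' (r - c * t))" by (simp_all add: algebra_simps)
      ultimately show ?thesis unfolding ks_def by (metis order_trans)
    qed
  qed
  have unshift: "(LINT r|lebesgue. w (r - c * s)) = (LINT r|lebesgue. w r)" for w :: "real \<Rightarrow> real" and s
    using integral_shift_lebesgue[of w "- (c * s)"] by simp
  note D = L2_deriv_inner[OF kv v]
  have "(LINT r|lebesgue. ks s r * v s r * v s r) = (LINT r|lebesgue. k r * (u s r)\<^sup>2)" for s
    using unshift[of "\<lambda>r. k r * (u s r)\<^sup>2" s] by (simp add: ks_def v_def power2_eq_square mult_ac)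
  moreover have "(LINT r|lebesgue. ((- c * k' (r - c * t)) * v t r + ks t r * g t r) * v t r)
      + (LINT r|lebesgue. ks t r * v t r * g t r)
    = - c * (LINT r|lebesgue. k' r * (u t r)\<^sup>2) - 2 * (LINT r|lebesgue. k r * f t r * u t r)"
  proof -
    have i1: "integrable lebesgue (\<lambda>r. k' r * u t r * u t r)"
      by (intro L2_mult_integrable in_L2_bounded_mult(1)[OF ui[OF t] km(2) kb(2)] ui t)
    have i2: "integrable lebesgue (\<lambda>r. k r * f t r * u t r)"
      by (intro L2_mult_integrable in_L2_bounded_mult(1)[OF fi[OF t] km(1) kb(1)] ui t)
    have "(LINT r|lebesgue. ((- c * k' (r - c * t)) * v t r + ks t r * g t r) * v t r)
      = (LINT r|lebesgue. ((- c * k' r) * u t r + k r * (- f t r)) * u t r)"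
      using unshift[of "\<lambda>r. ((- c * k' r) * u t r + k r * (- f t r)) * u t r" t] by (simp add: ks_def v_def g_def)
    also have "\<dots> = (LINT r|lebesgue. (- c) * (k' r * u t r * u t r) - k r * f t r * u t r)"
      by (intro Bochner_Integration.integral_cong refl) (simp add: algebra_simps)
    also have "\<dots> = - c * (LINT r|lebesgue. k' r * u t r * u t r) - (LINT r|lebesgue. k r * f t r * u t r)"
      by (subst Bochner_Integration.integral_diff) (use i1 i2 in simp_all)
    finally have e1: "(LINT r|lebesgue. ((- c * k' (r - c * t)) * v t r + ks t r * g t r) * v t r)
      = - c * (LINT r|lebesgue. k' r * u t r * u t r) - (LINT r|lebesgue. k r * f t r * u t r)" .
    have "(LINT r|lebesgue. ks t r * v t r * g t r) = (LINT r|lebesgue. k r * u t r * (- f t r))"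
      using unshift[of "\<lambda>r. k r * u t r * (- f t r)" t] by (simp add: ks_def v_def g_def)
    also have "\<dots> = - (LINT r|lebesgue. k r * f t r * u t r)"
      by (simp add: mult_ac)
    finally show ?thesis using e1 by (simp add: power2_eq_square mult.assoc)
  qed
  ultimately show ?thesis using D by simp
qed

section \<open>Absolutely continuous functions\<close>

lemma locally_integrable_on: "locally_integrable f \<Longrightarrow> f absolutely_integrable_on {a..b}"
  by (simp add: locally_integrable_def)

lemma locally_integrable_integrable_on: "locally_integrable f \<Longrightarrow> f integrable_on {a..b}"
  by (blast intro: set_lebesgue_integral_eq_integral(1) locally_integrable_on)

lemma locally_integrable_abs: "locally_integrable f \<Longrightarrow> locally_integrable (\<lambda>r. \<bar>f r\<bar>)"
  unfolding locally_integrable_def by (blast intro: set_integrable_abs)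

lemma locally_integrable_add:
  "locally_integrable f \<Longrightarrow> locally_integrable g \<Longrightarrow> locally_integrable (\<lambda>r. f r + g r)"
  unfolding locally_integrable_def by (blast intro: set_integral_add(1))

lemma locally_integrable_diff:
  "locally_integrable f \<Longrightarrow> locally_integrable g \<Longrightarrow> locally_integrable (\<lambda>r. f r - g r)"
  unfolding locally_integrable_def by (blast intro: set_integral_diff(1))

lemma locally_integrable_continuous: "continuous_on UNIV f \<Longrightarrow> locally_integrable f"
  unfolding locally_integrable_def
  by (meson absolutely_integrable_continuous_real continuous_on_subset subset_UNIV)

lemma locally_integrable_continuous_mult:
  assumes f: "continuous_on UNIV f" and g: "locally_integrable g"
  shows "locally_integrable (\<lambda>r. f r * g r)"
  unfolding locally_integrable_def
proof (intro allI)
  fix a b :: real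
  have c: "continuous_on {a..b} f" by (rule continuous_on_subset[OF f]) simp
  show "(\<lambda>r. f r * g r) absolutely_integrable_on {a..b}"
  proof (rule absolutely_integrable_bounded_measurable_product_real)
    show "f \<in> borel_measurable (lebesgue_on {a..b})"
      by (rule continuous_imp_measurable_on_sets_lebesgue[OF c]) simp
    show "bounded (f ` {a..b})"
      by (intro compact_imp_bounded compact_continuous_image c) simp
    show "g absolutely_integrable_on {a..b}" by (rule locally_integrable_on[OF g])
  qed simp
qed

section \<open>The product rule for absolutely continuous functions\<close>

text \<open>Absolute continuity in the form of the fundamental theorem with a locally integrable
  density. Pointwise derivatives of \<open>f\<close> never occur.\<close>

definition ac_deriv :: "(real \<Rightarrow> real) \<Rightarrow> (real \<Rightarrow> real) \<Rightarrow> bool" where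
  "ac_deriv f g \<longleftrightarrow> locally_integrable g \<and> (\<forall>a b. a \<le> b \<longrightarrow> (g has_integral (f b - f a)) {a..b})"

lemma ac_deriv_locally_integrable: "ac_deriv f g \<Longrightarrow> locally_integrable g"
  and ac_deriv_integral: "ac_deriv f g \<Longrightarrow> a \<le> b \<Longrightarrow> integral {a..b} g = f b - f a"
  and ac_deriv_has_integral: "ac_deriv f g \<Longrightarrow> a \<le> b \<Longrightarrow> (g has_integral (f b - f a)) {a..b}"
  by (auto simp: ac_deriv_def intro: integral_unique)

lemma ac_deriv_C1:
  assumes "\<And>x. (f has_real_derivative f' x) (at x)" "continuous_on UNIV f'"
  shows "ac_deriv f f'"
  unfolding ac_deriv_def
proof (intro conjI allI impI locally_integrable_continuous assms)
  fix a b :: real assume "a \<le> b"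
  then show "(f' has_integral (f b - f a)) {a..b}"
    by (intro fundamental_theorem_of_calculus)
      (auto simp: has_real_derivative_iff_has_vector_derivative[symmetric]
        intro: has_field_derivative_at_within assms(1))
qed

lemma ac_deriv_continuous:
  assumes "ac_deriv f g" shows "continuous_on S f"
proof (rule continuous_at_imp_continuous_on, rule ballI)
  fix x :: real
  define a where "a = x - 1"
  have "continuous_on {a..x + 1} (\<lambda>y. integral {a..y} g)"
    by (intro indefinite_integral_continuous_1 locally_integrable_integrable_on
        ac_deriv_locally_integrable[OF assms])
  then have "continuous_on {a..x + 1} (\<lambda>y. f a + integral {a..y} g)" by (intro continuous_intros)
  moreover have "f a + integral {a..y} g = f y" if "y \<in> {a..x + 1}" for y
    using ac_deriv_integral[OF assms, of a y] that by simp
  ultimately have "continuous_on {a..x + 1} f" by (rule continuous_on_eq)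
  then show "isCont f x"
    by (rule continuous_on_interior) (simp add: a_def)
qed

text \<open>On a fine partition the sum of the squared increments of \<open>A\<close> is at most the
  largest increment times the total one, hence arbitrarily small by uniform continuity.\<close>

lemma eq_of_increment_le_square:
  fixes F A :: "real \<Rightarrow> real"
  assumes ab: "a \<le> b" and A: "continuous_on {a..b} A"
    and mono: "\<And>x y. a \<le> x \<Longrightarrow> x \<le> y \<Longrightarrow> y \<le> b \<Longrightarrow> A x \<le> A y"
    and le: "\<And>x y. a \<le> x \<Longrightarrow> x \<le> y \<Longrightarrow> y \<le> b \<Longrightarrow> \<bar>F y - F x\<bar> \<le> (A y - A x)\<^sup>2"
  shows "F b = F a"
proof -
  have "\<bar>F b - F a\<bar> \<le> e * (A b - A a)" if e: "e > 0" for e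
  proof -
    have "uniformly_continuous_on {a..b} A" by (rule compact_uniformly_continuous[OF A]) simp
    then obtain d where d: "d > 0"
      "\<And>x y. x \<in> {a..b} \<Longrightarrow> y \<in> {a..b} \<Longrightarrow> dist y x < d \<Longrightarrow> dist (A y) (A x) < e"
      using e unfolding uniformly_continuous_on_def by metis
    obtain n :: nat where n: "(b - a) / d < n" using reals_Archimedean2 by blast
    have "0 \<le> (b - a) / d" using ab d by simp
    then have n0: "real n > 0" using n by linarith
    define x where "x i = a + i * ((b - a) / n)" for i :: nat
    have step: "x (Suc i) - x i = (b - a) / n" for i by (simp add: x_def algebra_simps add_divide_distrib[symmetric])
    have small: "(b - a) / n < d" using n d n0 by (simp add: field_simps)
    have x0: "x 0 = a" "x n = b" using n0 by (auto simp: x_def)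
    have xi: "a \<le> x i" "x i \<le> b" if "i \<le> n" for i
    proof -
      show "a \<le> x i" using ab n0 by (simp add: x_def)
      have "i * ((b - a) / n) \<le> n * ((b - a) / n)" using that ab n0 by (intro mult_right_mono) auto
      then show "x i \<le> b" using n0 by (simp add: x_def)
    qed
    have "\<bar>F b - F a\<bar> = \<bar>\<Sum>i<n. F (x (Suc i)) - F (x i)\<bar>"
      using sum_lessThan_telescope[of "\<lambda>i. F (x i)" n] x0 by simp
    also have "\<dots> \<le> (\<Sum>i<n. \<bar>F (x (Suc i)) - F (x i)\<bar>)" by (rule sum_abs)
    also have "\<dots> \<le> (\<Sum>i<n. e * (A (x (Suc i)) - A (x i)))"
    proof (rule sum_mono)
      fix i assume i: "i \<in> {..<n}"
      have xx: "x i \<le> x (Suc i)" using step[of i] ab n0 by (smt (verit) divide_nonneg_pos)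
      have "dist (A (x (Suc i))) (A (x i)) < e"
        by (rule d(2)) (use xi[of i] xi[of "Suc i"] i step[of i] small xx in \<open>auto simp: dist_real_def\<close>)
      then have "A (x (Suc i)) - A (x i) \<le> e" by (simp add: dist_real_def)
      moreover have "0 \<le> A (x (Suc i)) - A (x i)" using mono[of "x i" "x (Suc i)"] xx xi i by simp
      ultimately have "(A (x (Suc i)) - A (x i))\<^sup>2 \<le> e * (A (x (Suc i)) - A (x i))"
        unfolding power2_eq_square by (rule mult_right_mono)
      moreover have "\<bar>F (x (Suc i)) - F (x i)\<bar> \<le> (A (x (Suc i)) - A (x i))\<^sup>2"
        using le[of "x i" "x (Suc i)"] xx xi i by simp
      ultimately show "\<bar>F (x (Suc i)) - F (x i)\<bar> \<le> e * (A (x (Suc i)) - A (x i))" by linarith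
    qed
    also have "\<dots> = e * (A b - A a)"
      using sum_lessThan_telescope[of "\<lambda>i. A (x i)" n] x0 by (simp add: sum_distrib_left[symmetric])
    finally show ?thesis .
  qed
  note key = this
  have A0: "0 \<le> A b - A a" using mono[of a b] ab by simp
  show ?thesis
  proof (rule ccontr)
    assume "F b \<noteq> F a"
    then have p: "\<bar>F b - F a\<bar> > 0" by simp
    \<comment> \<open>Chosen so that the bound just proved makes the increment at most half of
      itself; the added 1 covers constant \<open>A\<close>.\<close>
    define e where "e = \<bar>F b - F a\<bar> / (2 * (A b - A a + 1))"
    have "e > 0" using p A0 by (simp add: e_def)
    from key[OF this] have "\<bar>F b - F a\<bar> \<le> e * (A b - A a)" .
    also have "\<dots> \<le> e * (A b - A a + 1)" using \<open>e > 0\<close> by simp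
    also have "\<dots> = \<bar>F b - F a\<bar> / 2" using A0 by (simp add: e_def field_simps)
    finally show False using p by simp
  qed
qed

text \<open>The difference between the product and the integral of its expected derivative has
  increments bounded by the square of the increment of A = int (|f'| + |g'|), so it is constant.
  Almost everywhere differentiation is not involved.\<close>

lemma ac_deriv_mult:
  assumes f: "ac_deriv f f'" and g: "ac_deriv g g'"
  shows "ac_deriv (\<lambda>x. f x * g x) (\<lambda>x. f' x * g x + g' x * f x)"
proof -
  note fl = ac_deriv_locally_integrable[OF f] and gl = ac_deriv_locally_integrable[OF g]
  have hl: "locally_integrable (\<lambda>x. f' x * g x + g' x * f x)"
    using locally_integrable_continuous_mult[OF ac_deriv_continuous[OF g] fl]
      locally_integrable_continuous_mult[OF ac_deriv_continuous[OF f] gl]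
    by (intro locally_integrable_add) (simp_all add: mult.commute)
  note int = locally_integrable_integrable_on
  have "integral {a..b} (\<lambda>x. f' x * g x + g' x * f x) = f b * g b - f a * g a" if ab: "a \<le> b" for a b
  proof -
    let ?h = "\<lambda>x. f' x * g x + g' x * f x" and ?k = "\<lambda>x. \<bar>f' x\<bar> + \<bar>g' x\<bar>"
    define A where "A x = integral {a..x} ?k" for x
    define F where "F x = f x * g x - integral {a..x} ?h" for x
    have kl: "locally_integrable ?k" by (intro locally_integrable_add locally_integrable_abs fl gl)
    have Adiff: "A y - A x = integral {x..y} ?k" if "a \<le> x" "x \<le> y" for x y
      using Henstock_Kurzweil_Integration.integral_combine[OF that int[OF kl]] by (simp add: A_def)
    have fd: "\<bar>f y - f x\<bar> \<le> integral {x..y} ?k" and gd: "\<bar>g y - g x\<bar> \<le> integral {x..y} ?k" if "x \<le> y" for x y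
    proof -
      have "norm (integral {x..y} f') \<le> integral {x..y} ?k"
        by (rule Henstock_Kurzweil_Integration.integral_norm_bound_integral[OF int[OF fl] int[OF kl]]) simp
      then show "\<bar>f y - f x\<bar> \<le> integral {x..y} ?k" using ac_deriv_integral[OF f that] by simp
      have "norm (integral {x..y} g') \<le> integral {x..y} ?k"
        by (rule Henstock_Kurzweil_Integration.integral_norm_bound_integral[OF int[OF gl] int[OF kl]]) simp
      then show "\<bar>g y - g x\<bar> \<le> integral {x..y} ?k" using ac_deriv_integral[OF g that] by simp
    qed
    have sub: "integral {x'..y'} ?k \<le> integral {x..y} ?k" if "x \<le> x'" "y' \<le> y" for x x' y y'
      by (rule integral_subset_le) (use that in \<open>auto intro: int[OF kl]\<close>)
    have "F b = F a"
    proof (rule eq_of_increment_le_square[OF ab, where A = A])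
      show "continuous_on {a..b} A"
        unfolding A_def by (intro indefinite_integral_continuous_1 int[OF kl])
      show "A x \<le> A y" if "a \<le> x" "x \<le> y" "y \<le> b" for x y
        unfolding A_def by (rule sub) (use that in auto)
      fix x y assume xy: "a \<le> x" "x \<le> y" "y \<le> b"
      define D where "D = integral {x..y} ?k"
      let ?d = "\<lambda>s. f' s * (g y - g s) + g' s * (f x - f s)"
      have "((\<lambda>s. (g y * f' s + f x * g' s) - ?h s) has_integral
          (g y * (f y - f x) + f x * (g y - g x)) - integral {x..y} ?h) {x..y}"
        by (intro has_integral_diff has_integral_add has_integral_mult_right
            ac_deriv_has_integral[OF f xy(2)] ac_deriv_has_integral[OF g xy(2)] integrable_integral int[OF hl])
      moreover have "(g y * f' s + f x * g' s) - ?h s = ?d s" for s by (simp add: algebra_simps)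
      moreover have "(g y * (f y - f x) + f x * (g y - g x)) - integral {x..y} ?h = F y - F x"
        using Henstock_Kurzweil_Integration.integral_combine[OF xy(1,2) int[OF hl]]
        by (simp add: F_def algebra_simps)
      ultimately have d: "(?d has_integral (F y - F x)) {x..y}" by simp
      have kD: "((\<lambda>s. D * ?k s) has_integral D * D) {x..y}"
        unfolding D_def by (intro has_integral_mult_right integrable_integral int[OF kl])
      have "norm (integral {x..y} ?d) \<le> integral {x..y} (\<lambda>s. D * ?k s)"
      proof (rule Henstock_Kurzweil_Integration.integral_norm_bound_integral)
        show "?d integrable_on {x..y}" "(\<lambda>s. D * ?k s) integrable_on {x..y}" using d kD by blast+
        fix s assume s: "s \<in> {x..y}"
        have "\<bar>g y - g s\<bar> \<le> D" using gd[of s y] sub[of x s y y] s by (simp add: D_def)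
        moreover have "\<bar>f x - f s\<bar> \<le> D" using fd[of x s] sub[of x x s y] s by (simp add: D_def)
        ultimately have "\<bar>f' s\<bar> * \<bar>g y - g s\<bar> + \<bar>g' s\<bar> * \<bar>f x - f s\<bar> \<le> \<bar>f' s\<bar> * D + \<bar>g' s\<bar> * D"
          by (intro add_mono mult_left_mono) auto
        then have "\<bar>f' s\<bar> * \<bar>g y - g s\<bar> + \<bar>g' s\<bar> * \<bar>f x - f s\<bar> \<le> D * ?k s" by (simp add: algebra_simps)
        moreover have "norm (?d s) \<le> \<bar>f' s\<bar> * \<bar>g y - g s\<bar> + \<bar>g' s\<bar> * \<bar>f x - f s\<bar>"
          using abs_triangle_ineq[of "f' s * (g y - g s)" "g' s * (f x - f s)"] by (simp add: abs_mult)
        ultimately show "norm (?d s) \<le> D * ?k s" by linarith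
      qed
      then show "\<bar>F y - F x\<bar> \<le> (A y - A x)\<^sup>2"
        using d kD Adiff[OF xy(1,2)] by (simp add: integral_unique power2_eq_square D_def)
    qed
    then show ?thesis by (simp add: F_def)
  qed
  then show ?thesis
    using hl int[OF hl] by (auto simp: ac_deriv_def has_integral_iff)
qed

lemma ac_deriv_add: "ac_deriv f f' \<Longrightarrow> ac_deriv g g' \<Longrightarrow> ac_deriv (\<lambda>x. f x + g x) (\<lambda>x. f' x + g' x)"
  unfolding ac_deriv_def
proof (intro conjI allI impI locally_integrable_add; (elim conjE)?)
  fix a b :: real
  assume "\<forall>a b. a \<le> b \<longrightarrow> (f' has_integral f b - f a) {a..b}"
    "\<forall>a b. a \<le> b \<longrightarrow> (g' has_integral g b - g a) {a..b}" "a \<le> b"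
  then have "((\<lambda>x. f' x + g' x) has_integral (f b - f a) + (g b - g a)) {a..b}"
    by (intro has_integral_add) auto
  then show "((\<lambda>x. f' x + g' x) has_integral f b + g b - (f a + g a)) {a..b}"
    by (simp add: algebra_simps)
qed

lemma ac_deriv_power:
  assumes "ac_deriv f f'"
  shows "ac_deriv (\<lambda>x. f x ^ Suc n) (\<lambda>x. real (Suc n) * f x ^ n * f' x)"
proof (induction n)
  case 0 then show ?case using assms by simp
next
  case (Suc n)
  have "ac_deriv (\<lambda>x. f x * f x ^ Suc n) (\<lambda>x. f' x * f x ^ Suc n + real (Suc n) * f x ^ n * f' x * f x)"
    by (rule ac_deriv_mult[OF assms Suc])
  moreover have "f' x * f x ^ Suc n + real (Suc n) * f x ^ n * f' x * f x
      = real (Suc (Suc n)) * f x ^ Suc n * f' x" for x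
    by (simp add: algebra_simps)
  ultimately show ?case by simp
qed

text \<open>The link between the Lebesgue integral over the line, used for the energy identities,
  and gauge integrals over intervals, used for absolutely continuous functions.\<close>

lemma integrable_limit_intervals:
  fixes p :: "real \<Rightarrow> real"
  assumes p: "integrable lebesgue p" 
  shows "(\<lambda>n. integral {-real n..real n} p) \<longlonglongrightarrow> (LINT r|lebesgue. p r)"
proof -
  have si: "set_integrable lebesgue {-real n..real n} p" for n
    unfolding set_integrable_def by (rule integrable_mult_indicator[OF _ p]) simp
  have "(\<lambda>n. LINT r|lebesgue. indicator {-real n..real n} r *\<^sub>R p r) \<longlonglongrightarrow> (LINT r|lebesgue. p r)"
  proof (rule integral_dominated_convergence)
    show "integrable lebesgue (\<lambda>r. \<bar>p r\<bar>)" using p by simp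
    show "AE r in lebesgue. (\<lambda>n. indicator {-real n..real n} r *\<^sub>R p r) \<longlonglongrightarrow> p r"
    proof (rule AE_I2)
      fix r :: real
      obtain m :: nat where "\<bar>r\<bar> \<le> m" using real_arch_simple by blast
      then have "indicator {-real n..real n} r *\<^sub>R p r = p r" if "n \<ge> m" for n
        using that by (auto simp: indicator_def)
      then show "(\<lambda>n. indicator {-real n..real n} r *\<^sub>R p r) \<longlonglongrightarrow> p r"
        by (intro tendsto_eventually) (auto simp: eventually_sequentially)
    qed
    show "(\<lambda>r. indicator {-real n..real n} r *\<^sub>R p r) \<in> borel_measurable lebesgue" for n
      using si[of n] unfolding set_integrable_def by (rule borel_measurable_integrable)
  qed (use p in \<open>auto simp: indicator_def\<close>)
  moreover have "(LINT r|lebesgue. indicator {-real n..real n} r *\<^sub>R p r) = integral {-real n..real n} p" for n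
    using set_lebesgue_integral_eq_integral(2)[OF si[of n]] by (simp add: set_lebesgue_integral_def)
  ultimately show ?thesis by simp
qed

lemma ac_deriv_integral_eq_0:
  assumes f: "ac_deriv f f'" and i: "integrable lebesgue f'"
    and l: "(\<lambda>n. f (real n)) \<longlonglongrightarrow> 0" "(\<lambda>n. f (- real n)) \<longlonglongrightarrow> 0"
  shows "(LINT r|lebesgue. f' r) = 0"
proof -
  have "(\<lambda>n. f (real n) - f (- real n)) \<longlonglongrightarrow> (LINT r|lebesgue. f' r)"
    using integrable_limit_intervals[OF i] ac_deriv_integral[OF f, of "- real _" "real _"] by simp
  moreover have "(\<lambda>n. f (real n) - f (- real n)) \<longlonglongrightarrow> 0" using tendsto_diff[OF l] by simp
  ultimately show ?thesis using LIMSEQ_unique by blast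
qed

section \<open>Primitives normalised at the origin\<close>

text \<open>For odd w1 with weak derivative \<open>g\<close> this is the continuous representative
  of w1. Oddness survives only as the vanishing at 0.\<close>

definition primitive :: "(real \<Rightarrow> real) \<Rightarrow> real \<Rightarrow> real" where
  "primitive g x = (if x \<ge> 0 then integral {0..x} g else - integral {x..0} g)"

lemma primitive_0: "primitive g 0 = 0"
  by (simp add: primitive_def)

lemma ac_deriv_primitive:
  assumes g: "locally_integrable g" shows "ac_deriv (primitive g) g"
  unfolding ac_deriv_def
proof (intro conjI g allI impI)
  fix a b :: real assume ab: "a \<le> b"
  note int = locally_integrable_integrable_on[OF g]
  note comb = Henstock_Kurzweil_Integration.integral_combine[OF _ _ int]
  consider "0 \<le> a" | "a < 0" "0 \<le> b" | "b < 0" by linarith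
  then have "integral {a..b} g = primitive g b - primitive g a"
  proof cases
    case 1 then show ?thesis using ab comb[of 0 a b] by (simp add: primitive_def)
  next
    case 2 then show ?thesis using comb[of a 0 b] by (simp add: primitive_def)
  next
    case 3 then show ?thesis using ab comb[of a b 0] by (simp add: primitive_def)
  qed
  then show "(g has_integral (primitive g b - primitive g a)) {a..b}"
    using int by (simp add: has_integral_iff)
qed

lemma primitive_continuous_deriv:
  assumes c: "continuous_on UNIV g" shows "(primitive g has_real_derivative g x) (at x)"
proof -
  note ac = ac_deriv_primitive[OF locally_integrable_continuous[OF c]]
  have "((\<lambda>y. integral {x - 1..y} g) has_real_derivative g x) (at x within {x - 1..x + 1})"
    by (rule integral_has_real_derivative) (auto intro: continuous_on_subset[OF c])
  then have D: "((\<lambda>y. primitive g (x - 1) + integral {x - 1..y} g) has_real_derivative g x) (at x within {x - 1..x + 1})"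
    by (auto intro!: derivative_eq_intros)
  have E: "primitive g (x - 1) + integral {x - 1..y} g = primitive g y" if "y \<in> {x - 1..x + 1}" for y
    using ac_deriv_integral[OF ac, of "x - 1" y] that by simp
  have "(primitive g has_real_derivative g x) (at x within {x - 1..x + 1})"
    by (rule has_field_derivative_transform_within[OF D zero_less_one]) (simp_all add: E)
  moreover have "x \<in> interior {x - 1..x + 1}" by simp
  ultimately show ?thesis by (metis at_within_interior)
qed

lemma smooth_primitive:
  assumes "smooth g" shows "smooth (primitive g)"
proof (rule smooth_coinduct[of _ "insert (primitive g) {f. smooth f}"])
  fix f assume "f \<in> insert (primitive g) {f. smooth f}"
  then show "\<exists>f'\<in>insert (primitive g) {f. smooth f}. \<forall>x. (f has_real_derivative f' x) (at x)"
    using primitive_continuous_deriv[OF smooth_continuous[OF assms]] assms smooth_has_deriv[of f] smooth_deriv[of f]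
    by blast
qed simp

lemma test_function_antiderivative:
  assumes p: "test_function p" and z: "(LINT r|lebesgue. p r) = 0"
  obtains q where "test_function q" "deriv q = p"
proof -
  obtain M where M: "M > 0" "\<And>r. \<bar>r\<bar> > M \<Longrightarrow> p r = 0" using test_function_support[OF p] by blast
  note s = test_function_smooth[OF p]
  note ac = ac_deriv_primitive[OF locally_integrable_continuous[OF smooth_continuous[OF s]]]
  have d: "(primitive p has_real_derivative p x) (at x)" for x
    by (rule primitive_continuous_deriv[OF smooth_continuous[OF s]])
  have const: "primitive p b = primitive p a" if "a \<le> b" "\<And>x. a < x \<Longrightarrow> x < b \<Longrightarrow> p x = 0" for a b
  proof -
    have "integral {a..b} p = integral {a..b} (\<lambda>x. 0)"
      by (rule integral_spike[of "{a, b}"]) (use that in \<open>auto simp: less_le\<close>)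
    then show ?thesis using ac_deriv_integral[OF ac that(1)] by simp
  qed
  have i: "integrable lebesgue p"
    using locally_integrable_integrable_test[OF locally_integrable_continuous[of "\<lambda>_. 1"] p] by simp
  have "primitive p M - primitive p (- M) = 0"
  proof -
    obtain m :: nat where m: "M \<le> m" using real_arch_simple by blast
    have "integral {-real n..real n} p = primitive p M - primitive p (- M)" if "n \<ge> m" for n
      using const[of M "real n"] const[of "- real n" "- M"] M m that
        ac_deriv_integral[OF ac, of "- real n" "real n"] by simp
    then have "(\<lambda>n. integral {-real n..real n} p) \<longlonglongrightarrow> primitive p M - primitive p (- M)"
      by (intro tendsto_eventually) (auto simp: eventually_sequentially)
    then show ?thesis using integrable_limit_intervals[OF i] z LIMSEQ_unique by metis
  qed
  then have eq: "primitive p M = primitive p (- M)" by simp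
  \<comment> \<open>The constant makes q vanish to the left of the support; the vanishing mean makes
    it vanish to the right.\<close>
  define q where "q x = primitive p x + (- primitive p (- M))" for x
  have "(q has_real_derivative p x) (at x)" for x
    unfolding q_def by (auto intro!: derivative_eq_intros d)
  then have "deriv q = p" by (auto intro: DERIV_imp_deriv)
  moreover have "test_function q"
  proof (rule test_functionI[of _ M])
    show "smooth q" unfolding q_def by (intro smooth_add smooth_primitive[OF s] smooth_const)
    show "q r = 0" if "\<bar>r\<bar> > M" for r
    proof (cases "r > 0")
      case True
      then show ?thesis using const[of M r] M(2) that eq by (simp add: q_def)
    next
      case False
      then show ?thesis using const[of r "- M"] M(2) that by (simp add: q_def)
    qed
  qed
  ultimately show ?thesis using that by blast
qed

section \<open>Weak derivatives and Hardy inequalities\<close>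

lemma in_L2_locally_integrable: "in_L2 g \<Longrightarrow> locally_integrable g"
  by (intro locally_L2_locally_integrable in_L2_imp_locally)

lemma ac_weak_deriv:
  assumes f: "ac_deriv f g" shows "has_weak_deriv f g"
  unfolding has_weak_deriv_def
proof (intro conjI allI impI)
  note gl = ac_deriv_locally_integrable[OF f]
  have fl: "locally_integrable f" by (rule locally_integrable_continuous[OF ac_deriv_continuous[OF f]])
  show "locally_integrable f" "locally_integrable g" by fact+
  fix \<phi> assume \<phi>: "test_function \<phi>"
  obtain M where M: "M > 0" "\<And>r. \<bar>r\<bar> > M \<Longrightarrow> \<phi> r = 0" using test_function_support[OF \<phi>] by blast
  note s = test_function_smooth[OF \<phi>]
  have "ac_deriv \<phi> (deriv \<phi>)"
    by (rule ac_deriv_C1[OF smooth_has_deriv[OF s] smooth_continuous[OF smooth_deriv[OF s]]])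
  note ac = ac_deriv_mult[OF f this]
  have i1: "integrable lebesgue (\<lambda>r. g r * \<phi> r)" by (rule locally_integrable_integrable_test[OF gl \<phi>])
  have i2: "integrable lebesgue (\<lambda>r. f r * deriv \<phi> r)"
    by (rule locally_integrable_integrable_test[OF fl test_function_deriv[OF \<phi>]])
  have "(LINT r|lebesgue. g r * \<phi> r + deriv \<phi> r * f r) = 0"
  proof (rule ac_deriv_integral_eq_0[OF ac])
    show "integrable lebesgue (\<lambda>r. g r * \<phi> r + deriv \<phi> r * f r)"
      using i1 i2 by (simp add: mult.commute)
    obtain m :: nat where m: "M < m" using reals_Archimedean2 by blast
    have z: "f (real n) * \<phi> (real n) = 0" "f (- real n) * \<phi> (- real n) = 0" if "n \<ge> m" for n
      using M(2)[of "real n"] M(2)[of "- real n"] m that by auto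
    show "(\<lambda>n. f (real n) * \<phi> (real n)) \<longlonglongrightarrow> 0"
      by (rule tendsto_eventually) (use z(1) in \<open>unfold eventually_sequentially, blast\<close>)
    show "(\<lambda>n. f (- real n) * \<phi> (- real n)) \<longlonglongrightarrow> 0"
      by (rule tendsto_eventually) (use z(2) in \<open>unfold eventually_sequentially, blast\<close>)
  qed
  then show "(LINT r|lebesgue. f r * deriv \<phi> r) = - (LINT r|lebesgue. g r * \<phi> r)"
    using i1 i2 by (simp add: mult.commute)
qed

lemma has_weak_deriv_unique:
  assumes "has_weak_deriv f g" "has_weak_deriv f h" shows "AE r in lebesgue. g r = h r"
proof -
  have l: "locally_integrable g" "locally_integrable h" using assms by (auto simp: has_weak_deriv_def)
  have "AE r in lebesgue. g r - h r = 0"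
  proof (rule locally_integrable_eq_0_AE[OF locally_integrable_diff[OF l]])
    fix \<phi> assume \<phi>: "test_function \<phi>"
    have "(LINT r|lebesgue. (g r - h r) * \<phi> r) = (LINT r|lebesgue. g r * \<phi> r) - (LINT r|lebesgue. h r * \<phi> r)"
      using l[THEN locally_integrable_integrable_test[OF _ \<phi>]] by (simp add: left_diff_distrib)
    also have "\<dots> = 0" using assms \<phi> unfolding has_weak_deriv_def by auto
    finally show "(LINT r|lebesgue. (g r - h r) * \<phi> r) = 0" .
  qed
  then show ?thesis by eventually_elim simp
qed

lemma has_weak_deriv_diff:
  assumes "has_weak_deriv f f'" "has_weak_deriv g g'"
  shows "has_weak_deriv (\<lambda>r. f r - g r) (\<lambda>r. f' r - g' r)"
proof -
  have l: "locally_integrable f" "locally_integrable f'" "locally_integrable g" "locally_integrable g'"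
    using assms by (auto simp: has_weak_deriv_def)
  show ?thesis
    unfolding has_weak_deriv_def
  proof (intro conjI allI impI locally_integrable_diff l)
    fix \<phi> assume \<phi>: "test_function \<phi>"
    show "(LINT r|lebesgue. (f r - g r) * deriv \<phi> r) = - (LINT r|lebesgue. (f' r - g' r) * \<phi> r)"
      using assms \<phi> l[THEN locally_integrable_integrable_test[OF _ \<phi>]]
        l[THEN locally_integrable_integrable_test[OF _ test_function_deriv[OF \<phi>]]]
      by (simp add: left_diff_distrib has_weak_deriv_def)
  qed
qed

lemma weak_deriv_has: "has_weak_deriv f g \<Longrightarrow> has_weak_deriv f (weak_deriv f)"
  using someI_ex[of "has_weak_deriv f"] by (auto simp: weak_deriv_def)

text \<open>The argument of du Bois-Reymond: the hypothesis tests \<open>h\<close> against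
  derivatives of test functions, that is against test functions of mean zero, and any test function
  becomes one after subtraction of a multiple of a fixed bump.\<close>

lemma weak_deriv_0_const:
  assumes "has_weak_deriv h (\<lambda>r. 0)" obtains C where "AE r in lebesgue. h r = C"
proof -
  have hl: "locally_integrable h" using assms by (simp add: has_weak_deriv_def)
  have z: "(LINT r|lebesgue. h r * deriv q r) = 0" if "test_function q" for q
    using assms that by (simp add: has_weak_deriv_def)
  have b: "test_function (bump 1)" by (rule test_function_bump) simp
  define I where "I = (LINT r|lebesgue. bump 1 r)"
  have ti: "integrable lebesgue \<phi>" if "test_function \<phi>" for \<phi>
    using locally_integrable_integrable_test[OF locally_integrable_continuous[of "\<lambda>_. 1"] that] by simp
  have "I \<noteq> 0"
  proof
    assume "I = 0"
    then have "AE r in lebesgue. bump 1 r = 0"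
      using integral_nonneg_eq_0_iff_AE[OF ti[OF b]] by (simp add: I_def bump_nonneg)
    moreover have "closed {r. bump 1 r = 0}"
      by (intro closed_Collect_eq smooth_continuous smooth_bump continuous_intros)
    ultimately have "0 \<in> {r. bump 1 r = 0}" by (intro mem_closed_if_AE_lebesgue) auto
    then show False using bump_pos[of 1 0] by simp
  qed
  define C where "C = (LINT r|lebesgue. h r * bump 1 r) / I"
  have "AE r in lebesgue. h r - C = 0"
  proof (rule locally_integrable_eq_0_AE)
    show "locally_integrable (\<lambda>r. h r - C)"
      by (intro locally_integrable_diff hl locally_integrable_continuous continuous_on_const)
    fix \<phi> assume \<phi>: "test_function \<phi>"
    define J where "J = (LINT r|lebesgue. \<phi> r)"
    define p where "p r = (- (J / I)) * bump 1 r + 1 * \<phi> r" for r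
    have p: "test_function p"
    proof -
      obtain M where M: "M > 0" "\<And>r. \<bar>r\<bar> > M \<Longrightarrow> \<phi> r = 0" using test_function_support[OF \<phi>] by blast
      have "smooth p"
        unfolding p_def[abs_def]
        by (rule smooth_add[OF smooth_mult[OF smooth_const smooth_bump]
              smooth_mult[OF smooth_const test_function_smooth[OF \<phi>]]])
      then show ?thesis
        by (rule test_functionI[of _ "max 1 M"]) (simp add: p_def bump_eq_0 M)
    qed
    have "(LINT r|lebesgue. p r) = 0"
      using ti[OF b] ti[OF \<phi>] \<open>I \<noteq> 0\<close> by (simp add: p_def I_def[symmetric] J_def[symmetric])
    then obtain q where q: "test_function q" "deriv q = p" using test_function_antiderivative[OF p] by blast
    have i: "integrable lebesgue (\<lambda>r. h r * bump 1 r)" "integrable lebesgue (\<lambda>r. h r * \<phi> r)"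
      by (intro locally_integrable_integrable_test hl b \<phi>)+
    have "0 = (LINT r|lebesgue. h r * p r)" using z[OF q(1)] q(2) by simp
    also have "\<dots> = (LINT r|lebesgue. (- (J / I)) * (h r * bump 1 r) + h r * \<phi> r)"
      by (simp add: p_def algebra_simps)
    also have "\<dots> = (- (J / I)) * (LINT r|lebesgue. h r * bump 1 r) + (LINT r|lebesgue. h r * \<phi> r)"
      by (subst Bochner_Integration.integral_add) (use i in simp_all)
    finally have "(LINT r|lebesgue. h r * \<phi> r) = C * J" by (simp add: C_def)
    then show "(LINT r|lebesgue. (h r - C) * \<phi> r) = 0"
      using i ti[OF \<phi>] by (simp add: left_diff_distrib J_def)
  qed
  then show ?thesis using that[of C] by (auto elim: eventually_mono)
qed

text \<open>The two sides differ by a constant almost everywhere. Adding the relation at r and at -r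
  turns oddness into an identity between continuous functions, valid everywhere, and at r = 0 it
  forces the constant to vanish.\<close>

lemma weak_deriv_primitive:
  assumes f: "has_weak_deriv f g" and o: "odd_ae f"
  shows "AE r in lebesgue. f r = primitive g r"
proof -
  have g: "locally_integrable g" using f by (simp add: has_weak_deriv_def)
  note ac = ac_deriv_primitive[OF g]
  have "has_weak_deriv (\<lambda>r. f r - primitive g r) (\<lambda>r. 0)"
    using has_weak_deriv_diff[OF f ac_weak_deriv[OF ac]] by simp
  then obtain C where C: "AE r in lebesgue. f r - primitive g r = C" using weak_deriv_0_const by blast
  \<comment> \<open>The exceptional set is enlarged to a Borel null set before it is
    reflected.\<close>
  have "AE r in lborel. f (0 + (- 1) * r) - primitive g (0 + (- 1) * r) = C"
  proof -
    obtain N where N: "N \<in> null_sets lebesgue" "{r. f r - primitive g r \<noteq> C} \<subseteq> N"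
      using C by (auto simp: eventually_ae_filter)
    obtain N' where N': "N' \<in> null_sets lborel" "N \<subseteq> N'"
      using N(1) by (auto simp: null_sets_completion_iff2)
    then have "AE r in lborel. r \<notin> N'" by (simp add: AE_not_in)
    moreover have "{x. x \<notin> N'} \<in> sets borel"
      using N'(1) by (auto simp: null_sets_def Collect_neg_eq[symmetric])
    ultimately have "AE r in lborel. 0 + (- 1) * r \<notin> N'"
      by (intro AE_borel_affine) (auto simp: pred_def)
    then show ?thesis by eventually_elim (use N N' in auto)
  qed
  then have C': "AE r in lebesgue. f (- r) - primitive g (- r) = C" by (simp add: AE_completion_iff)
  have "AE r in lebesgue. r \<in> {r. - primitive g r - primitive g (- r) = 2 * C}"
    using C C' o[unfolded odd_ae_def] by eventually_elim simp
  moreover have "closed {r. - primitive g r - primitive g (- r) = 2 * C}"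
    by (intro closed_Collect_eq continuous_intros ac_deriv_continuous[OF ac]
        continuous_on_compose2[OF ac_deriv_continuous[OF ac, of UNIV]]) auto
  ultimately have "0 \<in> {r. - primitive g r - primitive g (- r) = 2 * C}"
    by (intro mem_closed_if_AE_lebesgue)
  then have "C = 0" by (simp add: primitive_0)
  from C show ?thesis by eventually_elim (use \<open>C = 0\<close> in simp)
qed

section \<open>Pointwise growth of primitives of square-integrable functions\<close>

lemma L2_norm_indicator: "a \<le> b \<Longrightarrow> L2_norm_fun (indicator {a..b}) = sqrt (b - a)"
proof -
  have "(indicator {a..b} r :: real)\<^sup>2 = indicator {a..b} r" for r by (simp add: indicator_def)
  then show "a \<le> b \<Longrightarrow> L2_norm_fun (indicator {a..b}) = sqrt (b - a)" by (simp add: L2_norm_fun_def)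
qed

lemma in_L2_indicator_interval: "in_L2 (indicator {a..b::real})"
  by (rule in_L2_bounded_support[of _ 1 "max \<bar>a\<bar> \<bar>b\<bar>", OF measurable_lebesgue_indicator])
    (auto simp: indicator_def)

lemma integral_L2_bound:
  assumes g: "in_L2 g" and ab: "a \<le> b"
  shows "\<bar>integral {a..b} g\<bar> \<le> sqrt (b - a) * L2_norm_fun (\<lambda>r. indicator {a..b} r * g r)"
proof -
  let ?i = "indicator {a..b} :: real \<Rightarrow> real"
  have ig: "in_L2 (\<lambda>r. ?i r * g r)"
    by (rule in_L2_bounded_mult(1)[OF g measurable_lebesgue_indicator, where C = 1]) (auto simp: indicator_def)
  have "integral {a..b} g = (LINT r:{a..b}|lebesgue. g r)"
    using set_lebesgue_integral_eq_integral(2)[of "{a..b}" g] locally_integrable_on[OF in_L2_locally_integrable[OF g]]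
    by simp
  also have "\<dots> = (LINT r|lebesgue. ?i r * (?i r * g r))"
    unfolding set_lebesgue_integral_def by (rule Bochner_Integration.integral_cong) (auto simp: indicator_def)
  also have "\<bar>\<dots>\<bar> \<le> L2_norm_fun ?i * L2_norm_fun (\<lambda>r. ?i r * g r)"
    by (rule L2_Cauchy_Schwarz[OF in_L2_indicator_interval ig])
  finally show ?thesis by (simp add: L2_norm_indicator[OF ab])
qed

text \<open>Cauchy-Schwarz between 0 and r. Keeping the norm local matters twice: it tends to 0 with
  \<open>R\<close>, which removes boundary terms at the origin, and it transfers local decay from
  the derivative to the function.\<close>

lemma primitive_bound_local:
  assumes g: "in_L2 g" and r: "\<bar>r\<bar> \<le> R"
  shows "\<bar>primitive g r\<bar> \<le> sqrt \<bar>r\<bar> * L2_norm_fun (\<lambda>x. indicator {-R..R} x * g x)"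
proof -
  have ii: "in_L2 (\<lambda>x. indicator {a..b} x * g x)" for a b :: real
    by (rule in_L2_bounded_mult(1)[OF g measurable_lebesgue_indicator, where C = 1]) (auto simp: indicator_def)
  have mono: "L2_norm_fun (\<lambda>x. indicator {a..b} x * g x) \<le> L2_norm_fun (\<lambda>x. indicator {-R..R} x * g x)"
    if "- R \<le> a" "b \<le> R" for a b
    by (rule in_L2_dominated(2)[OF ii in_L2_measurable[OF ii]]) (use that in \<open>auto simp: indicator_def\<close>)
  show ?thesis
  proof (cases "r \<ge> 0")
    case True
    have "\<bar>primitive g r\<bar> \<le> sqrt \<bar>r\<bar> * L2_norm_fun (\<lambda>x. indicator {0..r} x * g x)"
      using integral_L2_bound[OF g True] True by (simp add: primitive_def)
    also have "\<dots> \<le> sqrt \<bar>r\<bar> * L2_norm_fun (\<lambda>x. indicator {-R..R} x * g x)"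
      by (intro mult_left_mono mono) (use r in auto)
    finally show ?thesis .
  next
    case False
    then have "\<bar>primitive g r\<bar> \<le> sqrt \<bar>r\<bar> * L2_norm_fun (\<lambda>x. indicator {r..0} x * g x)"
      using integral_L2_bound[OF g, of r 0] by (simp add: primitive_def)
    also have "\<dots> \<le> sqrt \<bar>r\<bar> * L2_norm_fun (\<lambda>x. indicator {-R..R} x * g x)"
      by (intro mult_left_mono mono) (use r False in auto)
    finally show ?thesis .
  qed
qed

lemma primitive_bound:
  assumes g: "in_L2 g" shows "\<bar>primitive g r\<bar> \<le> sqrt \<bar>r\<bar> * L2_norm_fun g"
proof -
  have "L2_norm_fun (\<lambda>x. indicator {-\<bar>r\<bar>..\<bar>r\<bar>} x * g x) \<le> 1 * L2_norm_fun g"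
    by (rule in_L2_bounded_mult(2)[OF g measurable_lebesgue_indicator]) (auto simp: indicator_def)
  then have "sqrt \<bar>r\<bar> * L2_norm_fun (\<lambda>x. indicator {-\<bar>r\<bar>..\<bar>r\<bar>} x * g x) \<le> sqrt \<bar>r\<bar> * L2_norm_fun g"
    by (intro mult_left_mono) auto
  then show ?thesis using primitive_bound_local[OF g, of r "\<bar>r\<bar>"] by simp
qed

text \<open>Weights such as \<open>1 / r\<close> live on an interval only; clamping the argument makes them absolutely
  continuous on the whole line.\<close>

lemma ac_deriv_clamp:
  assumes ab: "a \<le> b" and p: "\<And>x. x \<in> {a..b} \<Longrightarrow> (p has_real_derivative p' x) (at x)"
    and c: "continuous_on {a..b} p'"
  shows "ac_deriv (\<lambda>x. p (max a (min b x))) (\<lambda>x. if x \<in> {a..b} then p' x else 0)"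
  unfolding ac_deriv_def
proof (intro conjI allI impI)
  have "integrable lebesgue (\<lambda>x. indicator {a..b} x *\<^sub>R p' x)"
    using absolutely_integrable_continuous_real[OF c] by (simp add: set_integrable_def)
  moreover have "indicator {a..b} x *\<^sub>R p' x = (if x \<in> {a..b} then p' x else 0)" for x by simp
  ultimately have "integrable lebesgue (\<lambda>x. if x \<in> {a..b} then p' x else 0)" by simp
  then show "locally_integrable (\<lambda>x. if x \<in> {a..b} then p' x else 0)"
    unfolding locally_integrable_def set_integrable_def
    by (intro allI integrable_mult_indicator) auto
  fix x y :: real assume xy: "x \<le> y"
  have int: "{a..b} \<inter> {x..y} = {max a x..min b y}" by auto
  show "((\<lambda>x. if x \<in> {a..b} then p' x else 0) has_integral p (max a (min b y)) - p (max a (min b x))) {x..y}"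
    unfolding has_integral_restrict_Int int
  proof (cases "max a x \<le> min b y")
    case True
    then have "max a (min b y) = min b y" "max a (min b x) = max a x" by auto
    moreover have "(p' has_integral p (min b y) - p (max a x)) {max a x..min b y}"
      by (rule fundamental_theorem_of_calculus[OF True])
        (auto simp: has_real_derivative_iff_has_vector_derivative[symmetric] intro!: has_field_derivative_at_within p)
    ultimately show "(p' has_integral p (max a (min b y)) - p (max a (min b x))) {max a x..min b y}" by simp
  next
    case False
    then have "max a (min b y) = max a (min b x)" using ab xy by (auto simp: max_def min_def)
    with False show "(p' has_integral p (max a (min b y)) - p (max a (min b x))) {max a x..min b y}" by simp
  qed
qed

section \<open>Hardy inequalities from Riccati expressions\<close>

text \<open>Expanding k (g - p w / k)^2 >= 0 bounds the integrand from below by p' w^2 + 2 p w g,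
  which is the derivative of p w^2.\<close>

lemma riccati_interval:
  assumes ab: "a \<le> b" and p: "\<And>x. x \<in> {a..b} \<Longrightarrow> (p has_real_derivative p' x) (at x)"
    and c: "continuous_on {a..b} p'" and k: "\<And>x. x \<in> {a..b} \<Longrightarrow> k x > 0"
    and w: "ac_deriv w g"
    and int: "(\<lambda>x. k x * (g x)\<^sup>2 + (p' x + (p x)\<^sup>2 / k x) * (w x)\<^sup>2) integrable_on {a..b}"
  shows "p b * (w b)\<^sup>2 - p a * (w a)\<^sup>2 \<le> integral {a..b} (\<lambda>x. k x * (g x)\<^sup>2 + (p' x + (p x)\<^sup>2 / k x) * (w x)\<^sup>2)"
proof -
  have w2: "ac_deriv (\<lambda>x. w x * w x) (\<lambda>x. g x * w x + g x * w x)" by (rule ac_deriv_mult[OF w w])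
  let ?p = "\<lambda>x. p (max a (min b x))" and ?p' = "\<lambda>x. if x \<in> {a..b} then p' x else 0"
  from ac_deriv_has_integral[OF ac_deriv_mult[OF ac_deriv_clamp[OF ab p c] w2] ab]
  have I: "((\<lambda>x. ?p' x * (w x * w x) + (g x * w x + g x * w x) * ?p x) has_integral
      p b * (w b)\<^sup>2 - p a * (w a)\<^sup>2) {a..b}"
    using ab by (simp add: power2_eq_square)
  show ?thesis
  proof (rule has_integral_le[OF I integrable_integral[OF int]])
    fix x assume x: "x \<in> {a..b}"
    have "0 \<le> k x * (g x - p x * w x / k x)\<^sup>2" using k[OF x] by simp
    also have "\<dots> = k x * (g x)\<^sup>2 + (p x)\<^sup>2 / k x * (w x)\<^sup>2 - 2 * g x * w x * p x"
      using k[OF x] by (simp add: power2_eq_square field_simps)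
    finally show "?p' x * (w x * w x) + (g x * w x + g x * w x) * ?p x
        \<le> k x * (g x)\<^sup>2 + (p' x + (p x)\<^sup>2 / k x) * (w x)\<^sup>2"
      using x by (simp add: power2_eq_square algebra_simps)
  qed
qed

text \<open>The interval version is applied on both sides of the pole of \<open>p\<close>, away from
  0 and infinity. The growth condition on \<open>p\<close> is made for the boundary terms p w^2:
  near 0 it allows a pole of order 1, balanced by w^2 <= |x| o(1), and at infinity it demands decay
  of order 2, balanced by w^2 <= |x| ||g||^2.\<close>

lemma weighted_hardy:
  assumes g: "in_L2 g"
    and p: "\<And>x. x \<noteq> 0 \<Longrightarrow> (p has_real_derivative p' x) (at x)" "continuous_on (- {0}) p'"
    and pb: "\<And>x. x \<noteq> 0 \<Longrightarrow> \<bar>p x\<bar> * \<bar>x\<bar> * (1 + \<bar>x\<bar>) \<le> C"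
    and k: "\<And>x. k x > 0"
    and q: "\<And>x. x \<noteq> 0 \<Longrightarrow> q x = p' x + (p x)\<^sup>2 / k x"
    and int: "integrable lebesgue (\<lambda>x. k x * (g x)\<^sup>2 + q x * (primitive g x)\<^sup>2)"
  shows "0 \<le> (LINT x|lebesgue. k x * (g x)\<^sup>2 + q x * (primitive g x)\<^sup>2)"
proof -
  let ?w = "primitive g"
  let ?h = "\<lambda>x. k x * (g x)\<^sup>2 + q x * (?w x)\<^sup>2"
  note gl = in_L2_locally_integrable[OF g]
  note ac = ac_deriv_primitive[OF gl]
  have sint: "set_integrable lebesgue {a..b} ?h" for a b
    unfolding set_integrable_def by (rule integrable_mult_indicator[OF _ int]) simp
  have hk: "?h integrable_on {a..b}" "(LINT x:{a..b}|lebesgue. ?h x) = integral {a..b} ?h" for a b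
    using set_lebesgue_integral_eq_integral[OF sint] by blast+
  have part: "p b * (?w b)\<^sup>2 - p a * (?w a)\<^sup>2 \<le> integral {a..b} ?h" if ab: "a \<le> b" "0 \<notin> {a..b}" for a b
  proof -
    have nz: "x \<noteq> 0" if "x \<in> {a..b}" for x using that ab(2) by auto
    have eq: "k x * (g x)\<^sup>2 + (p' x + (p x)\<^sup>2 / k x) * (?w x)\<^sup>2 = ?h x" if "x \<in> {a..b}" for x
      using q[OF nz[OF that]] by simp
    have i: "(\<lambda>x. k x * (g x)\<^sup>2 + (p' x + (p x)\<^sup>2 / k x) * (?w x)\<^sup>2) integrable_on {a..b}"
      using hk(1) by (rule integrable_eq) (simp only: eq)
    have c: "continuous_on {a..b} p'" by (rule continuous_on_subset[OF p(2)]) (use ab(2) in auto)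
    have "integral {a..b} (\<lambda>x. k x * (g x)\<^sup>2 + (p' x + (p x)\<^sup>2 / k x) * (?w x)\<^sup>2) = integral {a..b} ?h"
      by (rule Henstock_Kurzweil_Integration.integral_cong) (simp only: eq)
    with riccati_interval[OF ab(1) p(1)[OF nz] c k ac i] show ?thesis by simp
  qed
  define a where "a n = 1 / real (Suc n)" for n
  define b where "b n = real (Suc n)" for n
  have ab: "0 < a n" "a n \<le> b n" for n by (simp_all add: a_def b_def field_simps)
  define T where "T n = p (b n) * (?w (b n))\<^sup>2 - p (a n) * (?w (a n))\<^sup>2
      + (p (- a n) * (?w (- a n))\<^sup>2 - p (- b n) * (?w (- b n))\<^sup>2)" for n
  have T: "T n \<le> integral {a n..b n} ?h + integral {- b n..- a n} ?h" for n
    unfolding T_def using part[of "a n" "b n"] part[of "- b n" "- a n"] ab[of n] by simp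
  define I where "I n = (\<lambda>x. indicator {a n..b n} x + indicator {- b n..- a n} x :: real)" for n
  have lim: "(\<lambda>n. LINT x|lebesgue. I n x * ?h x) \<longlonglongrightarrow> (LINT x|lebesgue. ?h x)"
  proof (rule integral_dominated_convergence)
    show "integrable lebesgue (\<lambda>x. 2 * \<bar>?h x\<bar>)" by (intro integrable_mult_right integrable_abs int)
    show hm: "?h \<in> borel_measurable lebesgue" using int by (rule borel_measurable_integrable)
    show "(\<lambda>x. I n x * ?h x) \<in> borel_measurable lebesgue" for n
      unfolding I_def
      by (rule borel_measurable_times[OF borel_measurable_add[OF measurable_lebesgue_indicator measurable_lebesgue_indicator] hm])
    show "AE x in lebesgue. norm (I n x * ?h x) \<le> 2 * \<bar>?h x\<bar>" for n
    proof (rule AE_I2)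
      fix x
      have "\<bar>I n x\<bar> \<le> 2" by (simp add: I_def indicator_def)
      then show "norm (I n x * ?h x) \<le> 2 * \<bar>?h x\<bar>" using mult_right_mono[of "\<bar>I n x\<bar>" 2 "\<bar>?h x\<bar>"]
        by (simp add: abs_mult)
    qed
    have "AE x in lebesgue. x \<notin> {0::real}"
      by (intro AE_not_in) (simp add: negligible_iff_null_sets[symmetric])
    then show "AE x in lebesgue. (\<lambda>n. I n x * ?h x) \<longlonglongrightarrow> ?h x"
    proof eventually_elim
      case (elim x)
      then have x: "\<bar>x\<bar> > 0" by simp
      obtain m :: nat where m: "max \<bar>x\<bar> (1 / \<bar>x\<bar>) < m" using reals_Archimedean2 by blast
      have "I n x * ?h x = ?h x" if "n \<ge> m" for n
      proof -
        have "\<bar>x\<bar> \<le> b n" using m that by (simp add: b_def)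
        moreover have "1 / \<bar>x\<bar> \<le> real (Suc n)" using m that by simp
        then have "a n \<le> \<bar>x\<bar>" using x by (simp add: a_def field_simps)
        ultimately have "I n x = 1" using ab[of n] x by (cases "x > 0") (auto simp: I_def indicator_def)
        then show ?thesis by simp
      qed
      then show ?case by (intro tendsto_eventually) (auto simp: eventually_sequentially)
    qed
  qed
  have Ieq: "(LINT x|lebesgue. I n x * ?h x) = integral {a n..b n} ?h + integral {- b n..- a n} ?h" for n
  proof -
    have "(LINT x|lebesgue. I n x * ?h x)
        = (LINT x|lebesgue. indicator {a n..b n} x *\<^sub>R ?h x + indicator {- b n..- a n} x *\<^sub>R ?h x)"
      by (simp add: I_def algebra_simps)
    also have "\<dots> = (LINT x:{a n..b n}|lebesgue. ?h x) + (LINT x:{- b n..- a n}|lebesgue. ?h x)"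
      unfolding set_lebesgue_integral_def
      by (rule Bochner_Integration.integral_add) (use sint in \<open>simp_all only: set_integrable_def\<close>)
    finally show ?thesis by (simp only: hk(2))
  qed
  \<comment> \<open>At the origin p w^2 is merely bounded by the full norm of g; it is the mass of g
    near 0 that tends to 0.\<close>
  define m where "m n = L2_norm_fun (\<lambda>x. indicator {- a n..a n} x * g x)" for n
  have m0: "(\<lambda>n. (m n)\<^sup>2) \<longlonglongrightarrow> 0"
  proof -
    have "(\<lambda>n. LINT x|lebesgue. (indicator {- a n..a n} x * g x)\<^sup>2) \<longlonglongrightarrow> (LINT x|(lebesgue::real measure). 0)"
    proof (rule integral_dominated_convergence)
      show "integrable lebesgue (\<lambda>x. (g x)\<^sup>2)" by (rule in_L2_integrable_sq[OF g])
      show "(\<lambda>x. (indicator {- a n..a n} x * g x)\<^sup>2) \<in> borel_measurable lebesgue" for n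
        by (intro borel_measurable_power borel_measurable_times measurable_lebesgue_indicator in_L2_measurable[OF g])
      show "AE x in lebesgue. norm ((indicator {- a n..a n} x * g x)\<^sup>2) \<le> (g x)\<^sup>2" for n
        by (rule AE_I2) (simp add: indicator_def)
      have "AE x in lebesgue. x \<notin> {0::real}"
        by (intro AE_not_in) (simp add: negligible_iff_null_sets[symmetric])
      then show "AE x in lebesgue. (\<lambda>n. (indicator {- a n..a n} x * g x)\<^sup>2) \<longlonglongrightarrow> 0"
      proof eventually_elim
        case (elim x)
        then have x: "\<bar>x\<bar> > 0" by simp
        obtain m :: nat where m: "1 / \<bar>x\<bar> < m" using reals_Archimedean2 by blast
        have "(indicator {- a n..a n} x * g x)\<^sup>2 = 0" if "n \<ge> m" for n
        proof -
          have "1 / \<bar>x\<bar> < real (Suc n)" using m that by simp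
          then have "a n < \<bar>x\<bar>" using x by (simp add: a_def field_simps)
          then show ?thesis by (auto simp: indicator_def)
        qed
        then show ?case by (intro tendsto_eventually) (auto simp: eventually_sequentially)
      qed
    qed simp_all
    then show ?thesis by (simp add: m_def L2_norm_sq)
  qed
  define e where "e n = 2 * C * (m n)\<^sup>2 + 2 * C * (L2_norm_fun g)\<^sup>2 * (1 / real (Suc n))" for n
  have e0: "e \<longlonglongrightarrow> 0"
    unfolding e_def
    by (rule tendsto_eq_intros m0 LIMSEQ_Suc[OF lim_1_over_n] refl)+ simp
  have near: "\<bar>p x * (?w x)\<^sup>2\<bar> \<le> C * (m n)\<^sup>2" if "\<bar>x\<bar> = a n" for x n
  proof -
    have x: "x \<noteq> 0" using that ab[of n] by auto
    have "\<bar>?w x\<bar> \<le> sqrt \<bar>x\<bar> * m n"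
      unfolding m_def by (rule primitive_bound_local[OF g]) (simp add: that)
    then have "\<bar>?w x\<bar>\<^sup>2 \<le> (sqrt \<bar>x\<bar> * m n)\<^sup>2" by (intro power_mono) auto
    then have "(?w x)\<^sup>2 \<le> \<bar>x\<bar> * (m n)\<^sup>2" by (simp add: power_mult_distrib)
    then have "\<bar>p x\<bar> * (?w x)\<^sup>2 \<le> \<bar>p x\<bar> * (\<bar>x\<bar> * (m n)\<^sup>2)" by (intro mult_left_mono) auto
    also have "\<dots> = (\<bar>p x\<bar> * \<bar>x\<bar>) * (m n)\<^sup>2" by simp
    also have "\<dots> \<le> C * (m n)\<^sup>2"
    proof (intro mult_right_mono)
      have "\<bar>p x\<bar> * \<bar>x\<bar> * 1 \<le> \<bar>p x\<bar> * \<bar>x\<bar> * (1 + \<bar>x\<bar>)" by (intro mult_left_mono) auto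
      then show "\<bar>p x\<bar> * \<bar>x\<bar> \<le> C" using pb[OF x] by simp
    qed simp
    finally show ?thesis by (simp add: abs_mult)
  qed
  have far: "\<bar>p x * (?w x)\<^sup>2\<bar> \<le> C * (L2_norm_fun g)\<^sup>2 * (1 / real (Suc n))" if "\<bar>x\<bar> = b n" for x n
  proof -
    have x: "x \<noteq> 0" using that by (auto simp: b_def)
    have "\<bar>?w x\<bar>\<^sup>2 \<le> (sqrt \<bar>x\<bar> * L2_norm_fun g)\<^sup>2" by (intro power_mono primitive_bound[OF g]) auto
    then have "(?w x)\<^sup>2 \<le> \<bar>x\<bar> * (L2_norm_fun g)\<^sup>2" by (simp add: power_mult_distrib)
    then have "\<bar>p x\<bar> * (?w x)\<^sup>2 \<le> \<bar>p x\<bar> * (\<bar>x\<bar> * (L2_norm_fun g)\<^sup>2)" by (intro mult_left_mono) auto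
    also have "\<dots> = (\<bar>p x\<bar> * \<bar>x\<bar>) * (L2_norm_fun g)\<^sup>2" by simp
    also have "\<dots> \<le> (C * (1 / real (Suc n))) * (L2_norm_fun g)\<^sup>2"
    proof (intro mult_right_mono)
      have "\<bar>p x\<bar> * \<bar>x\<bar> * real (Suc n) \<le> \<bar>p x\<bar> * \<bar>x\<bar> * (1 + \<bar>x\<bar>)" using that by (intro mult_left_mono) (auto simp: b_def)
      then have "\<bar>p x\<bar> * \<bar>x\<bar> * real (Suc n) \<le> C" using pb[OF x] by linarith
      then show "\<bar>p x\<bar> * \<bar>x\<bar> \<le> C * (1 / real (Suc n))" by (simp add: field_simps)
    qed simp
    finally show ?thesis by (simp add: abs_mult)
  qed
  have "\<bar>T n\<bar> \<le> e n" for n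
    unfolding T_def e_def
    using near[of "a n" n] near[of "- a n" n] far[of "b n" n] far[of "- b n" n] ab[of n] by (simp add: abs_le_iff)
  then have "T \<longlonglongrightarrow> 0" by (intro Lim_null_comparison[OF _ e0]) auto
  then show ?thesis
    by (rule LIMSEQ_le[OF _ lim]) (use T Ieq in auto)
qed

section \<open>The nonlinearity and the static inequalities\<close>

text \<open>With \<open>\<sigma> = (1 + r\<^sup>2)\<^bsup>1/4\<^esup>\<close> all weights become rational in \<open>r\<close> and \<open>\<sigma>\<close>, subject to \<open>\<sigma>\<^sup>4 = 1 + r\<^sup>2\<close>.\<close>

definition sig :: "real \<Rightarrow> real" where
  "sig r = (1 + r\<^sup>2) powr (1 / 4)"

lemma one_add_sq_pos: "0 < 1 + (r::real)\<^sup>2"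
  by (smt (verit) zero_le_power2)

lemma sig_pos: "0 < sig r"
  unfolding sig_def using one_add_sq_pos[of r] by (simp add: less_le)

lemma sig_ge_1: "1 \<le> sig r"
  unfolding sig_def by (rule ge_one_powr_ge_zero) auto

lemma sig_power: "sig r ^ n = (1 + r\<^sup>2) powr (real n / 4)"
  unfolding sig_def using one_add_sq_pos[of r] by (simp add: powr_realpow[symmetric] powr_powr less_le)

lemma sig_4: "sig r ^ 4 = 1 + r\<^sup>2"
  using one_add_sq_pos[of r] by (simp add: sig_power)

lemma sig_2: "(sig r)\<^sup>2 = sqrt (1 + r\<^sup>2)"
  using one_add_sq_pos[of r] sig_power[of r 2] by (simp add: powr_half_sqrt)

lemma sq_le_sig: "r\<^sup>2 \<le> sig r ^ 4"
  by (simp add: sig_4)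

lemma abs_le_sig: "\<bar>r\<bar> \<le> (sig r)\<^sup>2"
  unfolding sig_2 by (rule real_le_rsqrt) simp

lemma sqrt_abs_le_sig: "sqrt \<bar>r\<bar> \<le> sig r"
  using abs_le_sig[of r] sig_pos[of r] by (intro real_le_lsqrt) auto

lemma sig_ge_1_power: "1 \<le> sig r ^ n"
  by (rule one_le_power[OF sig_ge_1])

lemma sig_power_mono: "m \<le> n \<Longrightarrow> sig r ^ m \<le> sig r ^ n"
  by (rule power_increasing[OF _ sig_ge_1])

lemma inverse_sig_mono: "m \<le> n \<Longrightarrow> 1 / sig r ^ n \<le> 1 / sig r ^ m"
  using sig_power_mono[of m n r] sig_pos[of r] by (simp add: frac_le)

lemma DERIV_sig: "(sig has_real_derivative r / (2 * sig r ^ 3)) (at r)"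
proof -
  have eq: "sig = (\<lambda>r. (1 + r\<^sup>2) powr (1 / 4))" by (simp add: fun_eq_iff sig_def)
  have "(sig has_real_derivative (1 / 4) * (1 + r\<^sup>2) powr (1 / 4 - 1) * (2 * r)) (at r)"
    unfolding eq using one_add_sq_pos[of r] by (auto intro!: derivative_eq_intros)
  moreover have "(1 + r\<^sup>2) powr (1 / 4 - 1) = 1 / sig r ^ 3"
    unfolding sig_power using one_add_sq_pos[of r] by (simp add: powr_minus_divide[symmetric])
  then have "(1 / 4) * (1 + r\<^sup>2) powr (1 / 4 - 1) * (2 * r) = r / (2 * sig r ^ 3)" by simp
  ultimately show ?thesis by (rule DERIV_cong)
qed

lemma sig_neq_0: "sig r \<noteq> 0"
  using sig_pos[of r] by simp

lemma continuous_sig: "continuous_on S sig"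
  by (meson DERIV_isCont continuous_at_imp_continuous_on DERIV_sig)

lemma continuous_div_sig: "continuous_on S f \<Longrightarrow> continuous_on S (\<lambda>r. f r / sig r ^ n)"
  by (intro continuous_on_divide continuous_on_power continuous_sig) (auto simp: sig_neq_0)

text \<open>Since the derivative of \<open>sig\<close> is r / (2 sig^3), quotients of polynomials by
  powers of \<open>sig\<close> are closed under differentiation, at the price of raising the power
  by 4.\<close>

lemma DERIV_div_sig:
  assumes "(f has_real_derivative f') (at r)"
  shows "((\<lambda>r. f r / sig r ^ n) has_real_derivative f' / sig r ^ n - n * f r * r / (2 * sig r ^ (n + 4))) (at r)"
proof -
  have p: "sig r > 0" by (rule sig_pos)
  have D: "((\<lambda>r. f r / sig r ^ n) has_real_derivative
      (f' * sig r ^ n - f r * (real n * (r / (2 * sig r ^ 3) * sig r ^ (n - 1)))) / (sig r ^ n * sig r ^ n)) (at r)"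
    by (rule DERIV_divide[OF assms]) (use p in \<open>auto intro!: derivative_eq_intros DERIV_sig\<close>)
  have "(f' * s ^ n - f r * (real n * (r / (2 * s ^ 3) * s ^ (n - 1)))) / (s ^ n * s ^ n)
      = f' / s ^ n - n * f r * r / (2 * s ^ (n + 4))" if "s > 0" for s :: real
  proof (cases n)
    case (Suc m)
    have "(f' * (s * P) - F * (N * (r / (2 * s ^ 3) * P))) / ((s * P) * (s * P)) = f' / (s * P) - N * F * r / (2 * (P * s ^ 5))"
      if "P > 0" for F N P :: real
      using that \<open>s > 0\<close> by (simp add: field_simps eval_nat_numeral)
    note * = this[of "s ^ m" "f r" "real n"]
    have e: "s ^ n = s * s ^ m" "s ^ (n - 1) = s ^ m" "s ^ (n + 4) = s ^ m * s ^ 5"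
      by (simp_all add: Suc power_add[symmetric] add.commute)
    show ?thesis unfolding e by (rule *) (use that in simp)
  qed (use that in simp)
  from this[OF p] show ?thesis using D by (simp only:)
qed

section \<open>Pointwise estimates for the force and its potential\<close>

definition nonlin :: "real \<Rightarrow> real \<Rightarrow> real" where
  "nonlin r y = potential_V r * y + 6 * kink_H r * y\<^sup>2 / (1 + r\<^sup>2) powr (5 / 4)
    + 2 * y ^ 3 / (1 + r\<^sup>2) powr (3 / 2)"

lemma kink_H_sig: "kink_H r = r / (sig r)\<^sup>2"
  by (simp add: kink_H_def sig_2)

lemma potential_V_sig: "potential_V r = 3 / 4 * (5 * r\<^sup>2 - 2) / sig r ^ 8"
proof -
  have "(1 + r\<^sup>2)\<^sup>2 = sig r ^ 8" by (simp add: sig_4[symmetric] power_mult[symmetric])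
  then show ?thesis by (simp add: potential_V_def)
qed

lemma nonlin_sig: "nonlin r y = 3 / 4 * (5 * r\<^sup>2 - 2) / sig r ^ 8 * y + 6 * r / sig r ^ 7 * y\<^sup>2 + 2 / sig r ^ 6 * y ^ 3"
proof -
  have "(1 + r\<^sup>2) powr (5 / 4) = sig r ^ 5" "(1 + r\<^sup>2) powr (3 / 2) = sig r ^ 6"
    by (simp_all add: sig_power)
  then show ?thesis unfolding nonlin_def kink_H_sig potential_V_sig
    by (simp add: power_add[symmetric])
qed

lemma continuous_coeff:
  "continuous_on S potential_V" "continuous_on S kink_H"
  unfolding potential_V_sig[abs_def] kink_H_sig[abs_def]
  by (intro continuous_div_sig continuous_intros)+

lemma measurable_nonlin:
  assumes "f \<in> borel_measurable lebesgue" shows "(\<lambda>r. nonlin r (f r)) \<in> borel_measurable lebesgue"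
  unfolding nonlin_sig
  by (intro borel_measurable_add borel_measurable_times borel_measurable_power assms
      borel_measurable_lebesgue_continuous continuous_div_sig continuous_intros)

lemma five_sq_le: "\<bar>5 * r\<^sup>2 - 2\<bar> \<le> 5 * sig r ^ 4"
  by (simp add: sig_4 abs_le_iff)

lemma V_bound: "\<bar>3 / 4 * (5 * r\<^sup>2 - 2) / sig r ^ 8\<bar> \<le> 15 / 4 / sig r ^ 4"
proof -
  have "\<bar>3 / 4 * (5 * r\<^sup>2 - 2) / sig r ^ 8\<bar> = 3 / 4 * \<bar>5 * r\<^sup>2 - 2\<bar> / sig r ^ 8"
    unfolding abs_mult abs_divide using sig_pos[of r] by simp
  also have "\<dots> \<le> 3 / 4 * (5 * sig r ^ 4) / sig r ^ 8"
    using five_sq_le[of r] sig_pos[of r] by (intro divide_right_mono mult_left_mono) auto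
  also have "\<dots> = 15 / 4 / sig r ^ 4"
    using sig_pos[of r] by (simp add: field_simps power_add[symmetric])
  finally show ?thesis .
qed

lemma r7_bound: "\<bar>r / sig r ^ 7\<bar> \<le> 1 / sig r ^ 5"
proof -
  have "\<bar>r / sig r ^ 7\<bar> = \<bar>r\<bar> / sig r ^ 7" using sig_pos[of r] by simp
  also have "\<dots> \<le> (sig r)\<^sup>2 / sig r ^ 7"
    using abs_le_sig[of r] sig_pos[of r] by (intro divide_right_mono) auto
  also have "\<dots> = 1 / sig r ^ 5" using sig_pos[of r] by (simp add: field_simps power_add[symmetric])
  finally show ?thesis .
qed

text \<open>The assumption \<open>sig r * m\<close> is the growth that functions of finite energy
  have. The quadratic coefficient is of size sig^(-5) and the cubic one of size sig^(-6), so after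
  one and two factors of size sig all three terms decay like sig^(-4). The constant 4 rounds 15/4,
  the bound for V.\<close>

lemma nonlin_lipschitz:
  assumes y: "\<bar>y\<bar> \<le> sig r * m" and z: "\<bar>z\<bar> \<le> sig r * m"
  shows "\<bar>nonlin r y - nonlin r z\<bar> \<le> (4 + 12 * m + 6 * m\<^sup>2) * \<bar>y - z\<bar> / sig r ^ 4"
proof -
  define s where "s = sig r"
  have s: "s > 0" by (simp add: s_def sig_pos)
  have m: "m \<ge> 0" using y s by (metis abs_ge_zero mult_less_0_iff not_less order_trans s_def)
  define d where "d = \<bar>y - z\<bar>"
  define A B E where "A = 3 / 4 * (5 * r\<^sup>2 - 2) / s ^ 8" and "B = r / s ^ 7" and "E = 2 / s ^ 6"
  have nl: "nonlin r x = A * x + 6 * B * x\<^sup>2 + E * x ^ 3" for x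
    by (simp add: nonlin_sig A_def B_def E_def s_def)
  have "nonlin r y - nonlin r z = A * (y - z) + 6 * B * ((y - z) * (y + z)) + E * ((y - z) * (y\<^sup>2 + y * z + z\<^sup>2))"
    unfolding nl by (simp add: algebra_simps power2_eq_square power3_eq_cube)
  then have "nonlin r y - nonlin r z = 3 / 4 * (5 * r\<^sup>2 - 2) / s ^ 8 * (y - z) + 6 * (r / s ^ 7) * ((y - z) * (y + z))
      + 2 / s ^ 6 * ((y - z) * (y\<^sup>2 + y * z + z\<^sup>2))" by (simp only: A_def B_def E_def)
  then have "\<bar>nonlin r y - nonlin r z\<bar> \<le> \<bar>3 / 4 * (5 * r\<^sup>2 - 2) / s ^ 8\<bar> * d + 6 * \<bar>r / s ^ 7\<bar> * (d * \<bar>y + z\<bar>)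
      + 2 / s ^ 6 * (d * \<bar>y\<^sup>2 + y * z + z\<^sup>2\<bar>)"
    using s abs_triangle_ineq[of "3 / 4 * (5 * r\<^sup>2 - 2) / s ^ 8 * (y - z) + 6 * (r / s ^ 7) * ((y - z) * (y + z))"
        "2 / s ^ 6 * ((y - z) * (y\<^sup>2 + y * z + z\<^sup>2))"]
      abs_triangle_ineq[of "3 / 4 * (5 * r\<^sup>2 - 2) / s ^ 8 * (y - z)" "6 * (r / s ^ 7) * ((y - z) * (y + z))"]
    unfolding d_def abs_mult by simp
  also have "\<dots> \<le> 15 / 4 / s ^ 4 * d + 6 * (1 / s ^ 5) * (d * (2 * (s * m))) + 2 / s ^ 6 * (d * (3 * (s * m)\<^sup>2))"
  proof (intro add_mono mult_mono mult_left_mono)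
    show "\<bar>3 / 4 * (5 * r\<^sup>2 - 2) / s ^ 8\<bar> \<le> 15 / 4 / s ^ 4" unfolding s_def by (rule V_bound)
    show "\<bar>r / s ^ 7\<bar> \<le> 1 / s ^ 5" unfolding s_def by (rule r7_bound)
    show "\<bar>y + z\<bar> \<le> 2 * (s * m)" using y z by (simp add: s_def)
    have sm: "\<bar>y\<bar> \<le> s * m" "\<bar>z\<bar> \<le> s * m" "0 \<le> s * m" using y z s m by (auto simp: s_def)
    have "\<bar>y\<bar>\<^sup>2 \<le> (s * m)\<^sup>2" "\<bar>z\<bar>\<^sup>2 \<le> (s * m)\<^sup>2" "\<bar>y\<bar> * \<bar>z\<bar> \<le> (s * m) * (s * m)"
      by (intro power_mono mult_mono sm abs_ge_zero)+
    then show "\<bar>y\<^sup>2 + y * z + z\<^sup>2\<bar> \<le> 3 * (s * m)\<^sup>2"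
      using abs_triangle_ineq[of "y\<^sup>2 + y * z" "z\<^sup>2"] abs_triangle_ineq[of "y\<^sup>2" "y * z"]
      by (simp add: abs_mult power2_eq_square)
  qed (use s m in \<open>auto simp: d_def\<close>)
  also have "\<dots> = (15 / 4 + 12 * m + 6 * m\<^sup>2) * d / s ^ 4"
    using s by (simp add: field_simps power_add[symmetric] power_mult_distrib) (simp add: algebra_simps power_numeral_reduce)
  also have "\<dots> \<le> (4 + 12 * m + 6 * m\<^sup>2) * d / s ^ 4"
    using s by (intro divide_right_mono mult_right_mono) (auto simp: d_def)
  finally show ?thesis by (simp add: s_def d_def)
qed

lemma nonlin_0: "nonlin r 0 = 0"
  by (simp add: nonlin_sig)

lemma nonlin_bound:
  assumes y: "\<bar>y\<bar> \<le> sig r * m" and m: "m \<ge> 0"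
  shows "\<bar>nonlin r y\<bar> \<le> (4 + 12 * m + 6 * m\<^sup>2) * \<bar>y\<bar> / sig r ^ 4"
  using nonlin_lipschitz[OF y, of 0] m sig_pos[of r] by (simp add: nonlin_0)

text \<open>The antiderivative of \<open>nonlin r\<close> in y that vanishes at y = 0.\<close>

definition nonlin_pot :: "real \<Rightarrow> real \<Rightarrow> real" where
  "nonlin_pot r y = 3 / 8 * (5 * r\<^sup>2 - 2) / sig r ^ 8 * y\<^sup>2 + 2 * (r / sig r ^ 7) * y ^ 3 + 1 / 2 / sig r ^ 6 * y ^ 4"

text \<open>Each monomial minus its tangent has the factor (y - z)^2, and the cofactors are
  controlled by the same balance of powers of \<open>sig\<close> as for the force.\<close>

lemma nonlin_pot_taylor:
  assumes y: "\<bar>y\<bar> \<le> sig r * m" and z: "\<bar>z\<bar> \<le> sig r * m"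
  shows "\<bar>nonlin_pot r y - nonlin_pot r z - nonlin r z * (y - z)\<bar> \<le> (2 + 6 * m + 3 * m\<^sup>2) * (y - z)\<^sup>2 / sig r ^ 4"
proof -
  define s where "s = sig r"
  have s: "s > 0" by (simp add: s_def sig_pos)
  have m: "m \<ge> 0" using y s by (metis abs_ge_zero mult_less_0_iff not_less order_trans s_def)
  define d where "d = (y - z)\<^sup>2"
  have id: "y ^ 3 - z ^ 3 - 3 * z\<^sup>2 * (y - z) = (y - z)\<^sup>2 * (y + 2 * z)"
    "y ^ 4 - z ^ 4 - 4 * z ^ 3 * (y - z) = (y - z)\<^sup>2 * (y\<^sup>2 + 2 * y * z + 3 * z\<^sup>2)"
    by (simp_all add: algebra_simps power2_eq_square power3_eq_cube power4_eq_xxxx)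
  define A B E where "A = 3 / 4 * (5 * r\<^sup>2 - 2) / s ^ 8" and "B = r / s ^ 7" and "E = 1 / 2 / s ^ 6"
  have nl: "nonlin r x = A * x + 6 * B * x\<^sup>2 + 4 * E * x ^ 3" for x
    by (simp add: nonlin_sig A_def B_def E_def s_def)
  have np: "nonlin_pot r x = A / 2 * x\<^sup>2 + 2 * B * x ^ 3 + E * x ^ 4" for x
    by (simp add: nonlin_pot_def A_def B_def E_def s_def)
  have "nonlin_pot r y - nonlin_pot r z - nonlin r z * (y - z)
    = A * (y\<^sup>2 / 2 - z\<^sup>2 / 2 - z * (y - z)) + 2 * B * (y ^ 3 - z ^ 3 - 3 * z\<^sup>2 * (y - z)) + E * (y ^ 4 - z ^ 4 - 4 * z ^ 3 * (y - z))"
    unfolding nl np by (simp add: algebra_simps)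
  then have "nonlin_pot r y - nonlin_pot r z - nonlin r z * (y - z)
    = A * (y\<^sup>2 / 2 - z\<^sup>2 / 2 - z * (y - z)) + 2 * B * (y ^ 3 - z ^ 3 - 3 * z\<^sup>2 * (y - z)) + 1 / 2 / s ^ 6 * (y ^ 4 - z ^ 4 - 4 * z ^ 3 * (y - z))"
    by (simp only: E_def)
  also have "y\<^sup>2 / 2 - z\<^sup>2 / 2 - z * (y - z) = d / 2" by (simp add: d_def power2_eq_square field_simps)
  finally have "nonlin_pot r y - nonlin_pot r z - nonlin r z * (y - z)
    = A * (d / 2) + 2 * B * (d * (y + 2 * z)) + 1 / 2 / s ^ 6 * (d * (y\<^sup>2 + 2 * y * z + 3 * z\<^sup>2))"
    unfolding id d_def[symmetric] .
  then have "\<bar>nonlin_pot r y - nonlin_pot r z - nonlin r z * (y - z)\<bar>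
    \<le> \<bar>A\<bar> * (d / 2) + 2 * \<bar>B\<bar> * (d * \<bar>y + 2 * z\<bar>) + 1 / 2 / s ^ 6 * (d * \<bar>y\<^sup>2 + 2 * y * z + 3 * z\<^sup>2\<bar>)"
    using s abs_triangle_ineq[of "A * (d / 2) + 2 * B * (d * (y + 2 * z))" "1 / 2 / s ^ 6 * (d * (y\<^sup>2 + 2 * y * z + 3 * z\<^sup>2))"]
      abs_triangle_ineq[of "A * (d / 2)" "2 * B * (d * (y + 2 * z))"]
    by (simp add: abs_mult d_def)
  also have "\<dots> \<le> 15 / 4 / s ^ 4 * (d / 2) + 2 * (1 / s ^ 5) * (d * (3 * (s * m))) + 1 / 2 / s ^ 6 * (d * (6 * (s * m)\<^sup>2))"
  proof (intro add_mono mult_mono mult_left_mono)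
    show "\<bar>A\<bar> \<le> 15 / 4 / s ^ 4" unfolding s_def A_def by (rule V_bound)
    show "\<bar>B\<bar> \<le> 1 / s ^ 5" unfolding s_def B_def by (rule r7_bound)
    show "\<bar>y + 2 * z\<bar> \<le> 3 * (s * m)" using y z by (simp add: s_def)
    have sm: "\<bar>y\<bar> \<le> s * m" "\<bar>z\<bar> \<le> s * m" "0 \<le> s * m" using y z s m by (auto simp: s_def)
    have "\<bar>y\<bar>\<^sup>2 \<le> (s * m)\<^sup>2" "\<bar>z\<bar>\<^sup>2 \<le> (s * m)\<^sup>2" "\<bar>y\<bar> * \<bar>z\<bar> \<le> (s * m) * (s * m)"
      by (intro power_mono mult_mono sm abs_ge_zero)+
    then show "\<bar>y\<^sup>2 + 2 * y * z + 3 * z\<^sup>2\<bar> \<le> 6 * (s * m)\<^sup>2"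
      using abs_triangle_ineq[of "y\<^sup>2 + 2 * y * z" "3 * z\<^sup>2"] abs_triangle_ineq[of "y\<^sup>2" "2 * y * z"]
      by (simp add: abs_mult power2_eq_square)
  qed (use s m in \<open>auto simp: d_def\<close>)
  also have "\<dots> = (15 / 8 + 6 * m + 3 * m\<^sup>2) * d / s ^ 4"
    using s by (simp add: field_simps power_add[symmetric] power_mult_distrib) (simp add: algebra_simps power_numeral_reduce)
  also have "\<dots> \<le> (2 + 6 * m + 3 * m\<^sup>2) * d / s ^ 4"
    using s by (intro divide_right_mono mult_right_mono) (auto simp: d_def)
  finally show ?thesis by (simp add: s_def d_def)
qed

section \<open>Static estimates at a fixed time\<close>

locale profile =
  fixes g :: "real \<Rightarrow> real"
  assumes g: "in_L2 g" and w_weighted: "in_L2 (\<lambda>r. primitive g r / (sig r)\<^sup>2)"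
begin

abbreviation "w \<equiv> primitive g"
abbreviation "M \<equiv> L2_norm_fun g"

definition Q :: real where "Q = (LINT r|lebesgue. (w r)\<^sup>2 / sig r ^ 4)"

lemma M_nonneg: "0 \<le> M"
  by (rule L2_norm_nonneg)

lemma w_ac: "ac_deriv w g"
  by (rule ac_deriv_primitive[OF in_L2_locally_integrable[OF g]])

lemma w_measurable: "w \<in> borel_measurable lebesgue"
  by (rule borel_measurable_lebesgue_continuous[OF ac_deriv_continuous[OF w_ac]])

lemma w_bound: "\<bar>w r\<bar> \<le> sig r * M"
  using primitive_bound[OF g, of r] mult_right_mono[OF sqrt_abs_le_sig[of r] M_nonneg] by linarith

lemma integrable_w2: "integrable lebesgue (\<lambda>r. (w r)\<^sup>2 / sig r ^ 4)"
  using in_L2_integrable_sq[OF w_weighted] by (simp add: power_divide flip: power_mult)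

lemma Q_nonneg: "0 \<le> Q"
  unfolding Q_def by (rule Bochner_Integration.integral_nonneg) simp

text \<open>A coefficient that decays by one more power of \<open>sig\<close> for each extra factor
  w bounds a monomial of any degree by the quadratic density, with the power M^k as a small
  factor.\<close>

lemma coeff_bound:
  assumes "\<bar>c\<bar> \<le> C / sig r ^ (k + 4)"
  shows "\<bar>c * w r ^ (k + 2)\<bar> \<le> C * M ^ k * ((w r)\<^sup>2 / sig r ^ 4)"
proof -
  have C: "0 \<le> C / sig r ^ (k + 4)" using assms by linarith
  have "\<bar>w r\<bar> ^ k \<le> (sig r * M) ^ k" by (intro power_mono w_bound) simp
  then have "\<bar>c\<bar> * (\<bar>w r\<bar> ^ k * (w r)\<^sup>2) \<le> C / sig r ^ (k + 4) * ((sig r * M) ^ k * (w r)\<^sup>2)"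
    by (intro mult_mono assms mult_right_mono C mult_nonneg_nonneg) auto
  also have "\<dots> = C * M ^ k * ((w r)\<^sup>2 / sig r ^ 4)"
    using sig_pos[of r] by (simp add: power_mult_distrib power_add)
  also have "\<bar>c\<bar> * (\<bar>w r\<bar> ^ k * (w r)\<^sup>2) = \<bar>c * w r ^ (k + 2)\<bar>"
  proof -
    have "\<bar>w r\<bar> ^ (k + 2) = \<bar>w r\<bar> ^ k * (w r)\<^sup>2" unfolding power_add by simp
    then show ?thesis by (simp only: abs_mult power_abs)
  qed
  finally show ?thesis .
qed

lemma coeff_integrable:
  assumes c: "continuous_on UNIV c" and b: "\<And>r. \<bar>c r\<bar> \<le> C / sig r ^ (k + 4)"
  shows "integrable lebesgue (\<lambda>r. c r * w r ^ (k + 2))"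
    "\<bar>LINT r|lebesgue. c r * w r ^ (k + 2)\<bar> \<le> C * M ^ k * Q"
proof -
  show i: "integrable lebesgue (\<lambda>r. c r * w r ^ (k + 2))"
  proof (rule Bochner_Integration.integrable_bound)
    show "integrable lebesgue (\<lambda>r. C * M ^ k * ((w r)\<^sup>2 / sig r ^ 4))"
      by (rule integrable_mult_right[OF integrable_w2])
    show "(\<lambda>r. c r * w r ^ (k + 2)) \<in> borel_measurable lebesgue"
      by (intro borel_measurable_times borel_measurable_power w_measurable borel_measurable_lebesgue_continuous c)
    show "AE r in lebesgue. norm (c r * w r ^ (k + 2)) \<le> norm (C * M ^ k * ((w r)\<^sup>2 / sig r ^ 4))"
    proof (rule AE_I2)
      fix r show "norm (c r * w r ^ (k + 2)) \<le> norm (C * M ^ k * ((w r)\<^sup>2 / sig r ^ 4))"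
        using coeff_bound[OF b[of r]] abs_ge_self order_trans unfolding real_norm_def by blast
    qed
  qed
  have "norm (LINT r|lebesgue. c r * w r ^ (k + 2)) \<le> (LINT r|lebesgue. C * M ^ k * ((w r)\<^sup>2 / sig r ^ 4))"
    by (rule Bochner_Integration.integral_norm_bound_integral[OF i integrable_mult_right[OF integrable_w2]])
      (simp only: real_norm_def coeff_bound[OF b])
  then show "\<bar>LINT r|lebesgue. c r * w r ^ (k + 2)\<bar> \<le> C * M ^ k * Q"
    by (simp only: Q_def real_norm_def integral_mult_right_zero)
qed

lemma V_continuous: "continuous_on S (\<lambda>r. 3 / 4 * (5 * r\<^sup>2 - 2) / sig r ^ 8)"
  by (intro continuous_div_sig continuous_intros)

text \<open>The multiplier p = H'/H satisfies p' + p^2 = -3 / (1 + r^2)^2, which more than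
  compensates for the negative part of V: the sum V + 3 / (1 + r^2)^2 has numerator 15/4 r^2 + 3/2,
  at least (3/2) (1 + r^2).\<close>

lemma hardy_energy: "3 / 2 * Q \<le> M\<^sup>2 + (LINT r|lebesgue. 3 / 4 * (5 * r\<^sup>2 - 2) / sig r ^ 8 * (w r)\<^sup>2)"
proof -
  have s8: "sig r ^ 8 = (1 + r\<^sup>2)\<^sup>2" for r by (simp add: sig_4[symmetric] power_mult[symmetric])
  have qb: "\<bar>- 3 / sig r ^ 8\<bar> \<le> 3 / sig r ^ (0 + 4)" for r
    using inverse_sig_mono[of 4 8 r] sig_pos[of r] by simp
  have qc: "continuous_on UNIV (\<lambda>r. - 3 / sig r ^ 8)" by (intro continuous_div_sig continuous_intros)
  have qi: "integrable lebesgue (\<lambda>r. - 3 / sig r ^ 8 * (w r)\<^sup>2)"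
    using coeff_integrable(1)[OF qc qb] by (simp only: add_0)
  have Vi: "integrable lebesgue (\<lambda>r. 3 / 4 * (5 * r\<^sup>2 - 2) / sig r ^ 8 * (w r)\<^sup>2)"
    by (rule coeff_integrable(1)[where k = 0 and C = "15 / 4", OF V_continuous, unfolded add_0, OF V_bound])
  have gi: "integrable lebesgue (\<lambda>r. 1 * (g r)\<^sup>2)" using in_L2_integrable_sq[OF g] by simp
  have "0 \<le> (LINT r|lebesgue. 1 * (g r)\<^sup>2 + - 3 / sig r ^ 8 * (w r)\<^sup>2)"
  proof (rule weighted_hardy[OF g, where p = "\<lambda>r. 1 / (r * (1 + r\<^sup>2))" and C = 2
        and p' = "\<lambda>r. - (1 + 3 * r\<^sup>2) / (r\<^sup>2 * (1 + r\<^sup>2)\<^sup>2)"])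
    fix x :: real assume x: "x \<noteq> 0"
    have n: "1 + x\<^sup>2 \<noteq> 0" using one_add_sq_pos[of x] by simp
    show "((\<lambda>r. 1 / (r * (1 + r\<^sup>2))) has_real_derivative - (1 + 3 * x\<^sup>2) / (x\<^sup>2 * (1 + x\<^sup>2)\<^sup>2)) (at x)"
    proof (rule DERIV_cong)
      have "((\<lambda>r. r * (1 + r\<^sup>2)) has_real_derivative (1 + 3 * x\<^sup>2)) (at x)"
        by (auto intro!: derivative_eq_intros simp: power2_eq_square)
      from DERIV_divide[OF DERIV_const this, of 1] x n
      show "((\<lambda>r. 1 / (r * (1 + r\<^sup>2))) has_real_derivative
          (0 * (x * (1 + x\<^sup>2)) - 1 * (1 + 3 * x\<^sup>2)) / ((x * (1 + x\<^sup>2)) * (x * (1 + x\<^sup>2)))) (at x)" by simp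
    qed (simp add: power2_eq_square mult_ac)
    show "- 3 / sig x ^ 8 = - (1 + 3 * x\<^sup>2) / (x\<^sup>2 * (1 + x\<^sup>2)\<^sup>2) + (1 / (x * (1 + x\<^sup>2)))\<^sup>2 / 1"
    proof -
      define R where "R = (1 + x\<^sup>2)\<^sup>2"
      have "- (1 + 3 * x\<^sup>2) / (x\<^sup>2 * R) + 1 / (x\<^sup>2 * R) = (x\<^sup>2 * - 3) / (x\<^sup>2 * R)"
        unfolding add_divide_distrib[symmetric] by simp
      also have "\<dots> = - 3 / R" using x by simp
      finally show ?thesis by (simp add: s8 power_divide power_mult_distrib R_def)
    qed
    have "\<bar>1 / (x * (1 + x\<^sup>2))\<bar> * \<bar>x\<bar> * (1 + \<bar>x\<bar>) = (1 + \<bar>x\<bar>) / (1 + x\<^sup>2)"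
      using x one_add_sq_pos[of x] by (simp add: abs_mult)
    also have "\<dots> \<le> 2"
    proof -
      have "0 \<le> (\<bar>x\<bar> - 1)\<^sup>2" by simp
      then have "1 + \<bar>x\<bar> \<le> 2 * (1 + x\<^sup>2)" by (simp add: power2_diff) (smt (verit) zero_le_power2)
      then show ?thesis using one_add_sq_pos[of x] by (simp add: divide_le_eq)
    qed
    finally show "\<bar>1 / (x * (1 + x\<^sup>2))\<bar> * \<bar>x\<bar> * (1 + \<bar>x\<bar>) \<le> 2" .
  next
    show "continuous_on (- {0}) (\<lambda>r::real. - (1 + 3 * r\<^sup>2) / (r\<^sup>2 * (1 + r\<^sup>2)\<^sup>2))"
      by (intro continuous_intros) (use one_add_sq_pos in \<open>auto simp: less_imp_neq[symmetric]\<close>)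
    show "integrable lebesgue (\<lambda>r. 1 * (g r)\<^sup>2 + - 3 / sig r ^ 8 * (w r)\<^sup>2)"
      by (rule Bochner_Integration.integrable_add[OF gi qi])
  qed auto
  also have "\<dots> = (LINT r|lebesgue. 1 * (g r)\<^sup>2) + (LINT r|lebesgue. - 3 / sig r ^ 8 * (w r)\<^sup>2)"
    by (rule Bochner_Integration.integral_add[OF gi qi])
  also have "(LINT r|lebesgue. 1 * (g r)\<^sup>2) = M\<^sup>2" by (simp add: L2_norm_sq)
  finally have "- (LINT r|lebesgue. - 3 / sig r ^ 8 * (w r)\<^sup>2) \<le> M\<^sup>2" by linarith
  moreover have "3 / 2 * Q \<le> (LINT r|lebesgue. 3 / 4 * (5 * r\<^sup>2 - 2) / sig r ^ 8 * (w r)\<^sup>2) - (LINT r|lebesgue. - 3 / sig r ^ 8 * (w r)\<^sup>2)"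
  proof -
    have "3 / 2 * Q = (LINT r|lebesgue. 3 / 2 * ((w r)\<^sup>2 / sig r ^ 4))"
      unfolding Q_def by (rule integral_mult_right_zero[symmetric])
    also have "\<dots> \<le> (LINT r|lebesgue. 3 / 4 * (5 * r\<^sup>2 - 2) / sig r ^ 8 * (w r)\<^sup>2 - - 3 / sig r ^ 8 * (w r)\<^sup>2)"
    proof (rule integral_mono)
      show "integrable lebesgue (\<lambda>r. 3 / 2 * ((w r)\<^sup>2 / sig r ^ 4))" by (rule integrable_mult_right[OF integrable_w2])
      show "integrable lebesgue (\<lambda>r. 3 / 4 * (5 * r\<^sup>2 - 2) / sig r ^ 8 * (w r)\<^sup>2 - - 3 / sig r ^ 8 * (w r)\<^sup>2)"
        by (rule Bochner_Integration.integrable_diff[OF Vi qi])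
      fix r
      have "3 / 2 * ((w r)\<^sup>2 / sig r ^ 4) = (3 / 2 * sig r ^ 4) * ((w r)\<^sup>2 / sig r ^ 8)"
        using sig_pos[of r] by (simp add: field_simps power_add[symmetric])
      also have "3 / 2 * sig r ^ 4 \<le> 3 / 4 * (5 * r\<^sup>2 - 2) + 3"
        using zero_le_power2[of r] unfolding sig_4 by (simp add: field_simps)
      then have "3 / 2 * sig r ^ 4 * ((w r)\<^sup>2 / sig r ^ 8) \<le> (3 / 4 * (5 * r\<^sup>2 - 2) + 3) * ((w r)\<^sup>2 / sig r ^ 8)"
        using sig_pos[of r] by (intro mult_right_mono) auto
      also have "\<dots> = 3 / 4 * (5 * r\<^sup>2 - 2) / sig r ^ 8 * (w r)\<^sup>2 - - 3 / sig r ^ 8 * (w r)\<^sup>2"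
        by (simp add: add_divide_distrib distrib_right)
      finally show "3 / 2 * ((w r)\<^sup>2 / sig r ^ 4)
        \<le> 3 / 4 * (5 * r\<^sup>2 - 2) / sig r ^ 8 * (w r)\<^sup>2 - - 3 / sig r ^ 8 * (w r)\<^sup>2" .
    qed
    also have "\<dots> = (LINT r|lebesgue. 3 / 4 * (5 * r\<^sup>2 - 2) / sig r ^ 8 * (w r)\<^sup>2) - (LINT r|lebesgue. - 3 / sig r ^ 8 * (w r)\<^sup>2)"
      by (rule Bochner_Integration.integral_diff[OF Vi qi])
    finally show ?thesis .
  qed
  ultimately show ?thesis by linarith
qed

end

section \<open>The Hardy inequality behind the virial identity\<close>

text \<open>The derivative of H V, brought to the common denominator sig^14.\<close>

definition virial_coeff :: "real \<Rightarrow> real" where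
  "virial_coeff r = (69 / 4 * r\<^sup>2 - 15 / 2 * r ^ 4 - 3 / 2) / sig r ^ 14"

lemma r4_le: "r ^ 4 \<le> sig r ^ 8"
proof -
  have "(r\<^sup>2)\<^sup>2 \<le> (sig r ^ 4)\<^sup>2" by (intro power_mono sq_le_sig) simp
  then show ?thesis by (simp flip: power_mult)
qed

lemma virial_coeff_bound: "\<bar>virial_coeff r\<bar> \<le> 27 / sig r ^ 6"
proof -
  have "r\<^sup>2 \<le> sig r ^ 8" using sq_le_sig[of r] sig_power_mono[of 4 8 r] by linarith
  moreover have "0 \<le> r ^ 4" by simp
  ultimately have "\<bar>69 / 4 * r\<^sup>2 - 15 / 2 * r ^ 4 - 3 / 2\<bar> \<le> 27 * sig r ^ 8"
    using r4_le[of r] sig_ge_1_power[of r 8] zero_le_power2[of r] by (simp only: abs_le_iff) linarith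
  then have "\<bar>virial_coeff r\<bar> \<le> 27 * sig r ^ 8 / sig r ^ 14"
    unfolding virial_coeff_def abs_divide using sig_pos[of r] by (simp add: divide_right_mono)
  also have "\<dots> = 27 / sig r ^ 6" using sig_pos[of r] by (simp add: field_simps power_add[symmetric])
  finally show ?thesis .
qed

text \<open>With x standing for r^2, this is the pointwise inequality behind
  \<open>virial_q_le\<close>, multiplied by (1 + r^2)^(7/2). The term (1 + x)^2 / 10 is a margin
  built in for later use.\<close>

lemma virial_polynomial:
  fixes x :: real
  assumes x: "x \<ge> 0"
  defines "D \<equiv> 2 + x"
  shows "0 \<le> (3 - 15 * x\<^sup>2 / D\<^sup>2) * (1 + x) + (25 * x / D\<^sup>2 - 20 * x\<^sup>2 / D ^ 3 - 25 * x ^ 3 / D ^ 4) * (1 + x)\<^sup>2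
    + (15 / 2 * x\<^sup>2 - 69 / 4 * x + 3 / 2) - (1 + x)\<^sup>2 / 10" (is "0 \<le> ?L")
proof -
  have D: "D > 0" using x by (simp add: D_def)
  define a b c d where "a = 15 * x\<^sup>2 / D\<^sup>2" and "b = 25 * x / D\<^sup>2" and "c = 20 * x\<^sup>2 / D ^ 3" and "d = 25 * x ^ 3 / D ^ 4"
  have abcd: "a * D ^ 4 = 15 * x\<^sup>2 * D\<^sup>2" "b * D ^ 4 = 25 * x * D\<^sup>2" "c * D ^ 4 = 20 * x\<^sup>2 * D" "d * D ^ 4 = 25 * x ^ 3"
    unfolding a_def b_def c_def d_def using D by (simp_all add: field_simps eval_nat_numeral)
  have dist: "((3 - a) * u + (b - c - d) * v + e - f) * E = (3 * E - a * E) * u + (b * E - c * E - d * E) * v + (e - f) * E"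
    for u v e f E :: real by (simp add: algebra_simps)
  have "?L * D ^ 4 = (3 * D ^ 4 - 15 * x\<^sup>2 * D\<^sup>2) * (1 + x) + (25 * x * D\<^sup>2 - 20 * x\<^sup>2 * D - 25 * x ^ 3) * (1 + x)\<^sup>2
    + (15 / 2 * x\<^sup>2 - 69 / 4 * x + 3 / 2 - (1 + x)\<^sup>2 / 10) * D ^ 4"
    unfolding a_def[symmetric] b_def[symmetric] c_def[symmetric] d_def[symmetric] dist abcd ..
  also have "\<dots> = (704 + 96 * x - 384 * x\<^sup>2 + 52 * x ^ 3 + 114 * x ^ 4 + 195 / 2 * x ^ 5 + 74 * x ^ 6) / 10"
    unfolding D_def by (simp add: field_simps eval_nat_numeral)
  \<comment> \<open>Only the coefficient of x^2 is negative. Completing the square with the quartic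
    term, 384 = 2 * 114 * 32/19, leaves a positive constant.\<close>
  also have "\<dots> = (114 * (x\<^sup>2 - 32 / 19)\<^sup>2 + (704 - 114 * (32 / 19)\<^sup>2) + 96 * x + 52 * x ^ 3 + 195 / 2 * x ^ 5 + 74 * x ^ 6) / 10"
    by (simp add: power2_diff power_mult[symmetric] algebra_simps power_divide)
  also have "\<dots> \<ge> 0" using x by (intro divide_nonneg_pos add_nonneg_nonneg) (simp_all add: power_divide)
  finally show ?thesis using D by (simp add: zero_le_mult_iff)
qed

text \<open>The Riccati expression p' + p^2 / \<kappa> for \<kappa> = H' and p =
  \<open>virial_mult r / sig r ^ 6\<close>, after its singular parts have cancelled; this form is
  continuous at 0.\<close>

definition virial_q :: "real \<Rightarrow> real" where
  "virial_q r = (15 * r ^ 4 / (2 + r\<^sup>2)\<^sup>2 - 3) / sig r ^ 10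
    + (20 * r ^ 4 / (2 + r\<^sup>2) ^ 3 + 25 * r ^ 6 / (2 + r\<^sup>2) ^ 4 - 25 * r\<^sup>2 / (2 + r\<^sup>2)\<^sup>2) / sig r ^ 6"

lemma two_add_sq_pos: "0 < 2 + (r::real)\<^sup>2"
  by (smt (verit) zero_le_power2)

lemma virial_q_le: "virial_coeff r + 1 / 10 / sig r ^ 6 \<le> - virial_q r"
proof -
  define x where "x = r\<^sup>2"
  have pw: "r ^ 4 = x\<^sup>2" "r ^ 6 = x ^ 3" by (simp_all add: x_def flip: power_mult)
  have s4: "sig r ^ 4 = 1 + x" by (simp add: sig_4 x_def)
  define Z where "Z = 1 / sig r ^ 14"
  have s14: "1 / sig r ^ 10 = (1 + x) * Z" "1 / sig r ^ 6 = (1 + x)\<^sup>2 * Z"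
    using sig_pos[of r] unfolding s4[symmetric] Z_def by (simp_all add: field_simps flip: power_add power_mult)
  have vc: "virial_coeff r = (69 / 4 * x - 15 / 2 * x\<^sup>2 - 3 / 2) * Z"
    by (simp add: virial_coeff_def pw x_def[symmetric] Z_def)
  define A B where "A = 3 - 15 * x\<^sup>2 / (2 + x)\<^sup>2"
    and "B = 25 * x / (2 + x)\<^sup>2 - 20 * x\<^sup>2 / (2 + x) ^ 3 - 25 * x ^ 3 / (2 + x) ^ 4"
  have "- virial_q r = A * (1 / sig r ^ 10) + B * (1 / sig r ^ 6)"
    unfolding virial_q_def pw x_def[symmetric] A_def B_def by (simp add: diff_divide_distrib add_divide_distrib)
  then have "- virial_q r - virial_coeff r - 1 / 10 * (1 / sig r ^ 6)
      = (A * (1 + x) + B * (1 + x)\<^sup>2 + (15 / 2 * x\<^sup>2 - 69 / 4 * x + 3 / 2) - (1 + x)\<^sup>2 / 10) * Z"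
    unfolding s14 vc by (simp add: algebra_simps)
  also have "\<dots> \<ge> 0"
    using virial_polynomial[of x] sig_pos[of r] unfolding A_def B_def by (intro mult_nonneg_nonneg) (simp_all add: x_def Z_def)
  finally show ?thesis by simp
qed

lemma continuous_virial_q: "continuous_on S virial_q"
  unfolding virial_q_def[abs_def]
  by (intro continuous_on_add continuous_div_sig continuous_intros)
    (use two_add_sq_pos in \<open>auto simp: less_imp_neq[symmetric]\<close>)

lemma virial_q_bound: "\<bar>virial_q r\<bar> \<le> 100 / sig r ^ 6"
proof -
  define x D where "x = r\<^sup>2" and "D = 2 + r\<^sup>2"
  have x: "0 \<le> x" "x \<le> D" "D \<ge> 1" by (auto simp: x_def D_def)
  have pw: "r ^ 4 = x\<^sup>2" "r ^ 6 = x ^ 3" by (simp_all add: x_def flip: power_mult)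
  have le1: "0 \<le> x ^ m / D ^ n \<and> x ^ m / D ^ n \<le> 1" if "m \<le> n" for m n
  proof -
    have "x ^ m \<le> D ^ m" using x by (intro power_mono) auto
    also have "\<dots> \<le> D ^ n" by (rule power_increasing[OF that x(3)])
    finally show ?thesis using x by simp
  qed
  define A B where "A = 15 * (x\<^sup>2 / D\<^sup>2) - 3" and "B = 20 * (x\<^sup>2 / D ^ 3) + 25 * (x ^ 3 / D ^ 4) - 25 * (x ^ 1 / D\<^sup>2)"
  have q: "virial_q r = A * (1 / sig r ^ 10) + B * (1 / sig r ^ 6)"
    unfolding virial_q_def pw A_def B_def D_def x_def[symmetric] by simp
  have "\<bar>A\<bar> \<le> 15" using le1[of 2 2] unfolding A_def by linarith
  moreover have "\<bar>B\<bar> \<le> 45" using le1[of 2 3] le1[of 3 4] le1[of 1 2] unfolding B_def by linarith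
  moreover have "1 / sig r ^ 10 \<le> 1 / sig r ^ 6" by (rule inverse_sig_mono) simp
  ultimately have "\<bar>A\<bar> * (1 / sig r ^ 10) + \<bar>B\<bar> * (1 / sig r ^ 6) \<le> 15 * (1 / sig r ^ 6) + 45 * (1 / sig r ^ 6)"
    using sig_pos[of r] by (intro add_mono mult_mono) auto
  moreover have "\<bar>virial_q r\<bar> \<le> \<bar>A\<bar> * (1 / sig r ^ 10) + \<bar>B\<bar> * (1 / sig r ^ 6)"
    unfolding q using abs_triangle_ineq[of "A * (1 / sig r ^ 10)" "B * (1 / sig r ^ 6)"] sig_pos[of r]
    by (simp add: abs_mult)
  moreover have "15 * (1 / sig r ^ 6) + 45 * (1 / sig r ^ 6) \<le> 100 / sig r ^ 6"
    using sig_pos[of r] by (simp add: field_simps)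
  ultimately show ?thesis by linarith
qed

text \<open>The multiplier \<open>1 / x - 5 x\<^sup>3 / (2 + x\<^sup>2)\<^sup>2\<close> is the logarithmic derivative of a positive
  supersolution vanishing at \<open>0\<close>; it was found numerically.\<close>

definition virial_mult :: "real \<Rightarrow> real" where
  "virial_mult x = 1 / x - 5 * x ^ 3 / (2 + x\<^sup>2)\<^sup>2"

lemma DERIV_virial_mult:
  assumes x: "x \<noteq> 0"
  shows "(virial_mult has_real_derivative - (1 / x\<^sup>2) - (15 * x\<^sup>2 / (2 + x\<^sup>2)\<^sup>2 - 20 * x ^ 4 / (2 + x\<^sup>2) ^ 3)) (at x)"
proof -
  define D where "D = 2 + x\<^sup>2"
  have D: "D > 0" unfolding D_def by (rule two_add_sq_pos)
  have 1: "((\<lambda>x. 1 / x) has_real_derivative - (1 / x\<^sup>2)) (at x)"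
    using x by (auto intro!: derivative_eq_intros simp: power2_eq_square)
  have "((\<lambda>x. (2 + x\<^sup>2)\<^sup>2) has_real_derivative 2 * D * (2 * x)) (at x)"
    by (auto intro!: derivative_eq_intros simp: D_def)
  moreover have "((\<lambda>x. 5 * x ^ 3) has_real_derivative 15 * x\<^sup>2) (at x)"
    by (auto intro!: derivative_eq_intros)
  ultimately have "((\<lambda>x. 5 * x ^ 3 / (2 + x\<^sup>2)\<^sup>2) has_real_derivative
      (15 * x\<^sup>2 * D\<^sup>2 - 5 * x ^ 3 * (2 * D * (2 * x))) / (D\<^sup>2 * D\<^sup>2)) (at x)"
    unfolding D_def using two_add_sq_pos[of x] by (intro DERIV_divide) auto
  moreover have "(15 * x\<^sup>2 * D\<^sup>2 - 5 * x ^ 3 * (2 * D * (2 * x))) / (D\<^sup>2 * D\<^sup>2) = 15 * x\<^sup>2 / D\<^sup>2 - 20 * x ^ 4 / D ^ 3"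
    using D by (simp add: field_simps eval_nat_numeral)
  ultimately have 2: "((\<lambda>x. 5 * x ^ 3 / (2 + x\<^sup>2)\<^sup>2) has_real_derivative 15 * x\<^sup>2 / D\<^sup>2 - 20 * x ^ 4 / D ^ 3) (at x)"
    by simp
  show ?thesis
    using DERIV_diff[OF 1 2] unfolding virial_mult_def[abs_def] D_def .
qed

text \<open>The residue 1 of the multiplier at 0 is essential: the derivative contributes -1/x^2 and
  the square +1/x^2, so the double pole disappears.\<close>

lemma virial_q_eq:
  assumes x: "x \<noteq> 0"
  shows "virial_q x = ((- (1 / x\<^sup>2) - (15 * x\<^sup>2 / (2 + x\<^sup>2)\<^sup>2 - 20 * x ^ 4 / (2 + x\<^sup>2) ^ 3)) / sig x ^ 6
      - real 6 * virial_mult x * x / (2 * sig x ^ (6 + 4)))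
    + (virial_mult x / sig x ^ 6)\<^sup>2 / (1 / sig x ^ 6)"
proof -
  define D where "D = 2 + x\<^sup>2"
  have D: "D > 0" unfolding D_def by (rule two_add_sq_pos)
  define S T where "S = 1 / sig x ^ 6" and "T = 1 / sig x ^ 10"
  have S: "S > 0" using sig_pos[of x] by (simp add: S_def)
  have sq: "(virial_mult x)\<^sup>2 = 1 / x\<^sup>2 - 10 * x\<^sup>2 / D\<^sup>2 + 25 * x ^ 6 / D ^ 4"
    unfolding virial_mult_def D_def[symmetric] using x D
    by (simp add: power2_diff power_divide power_mult_distrib flip: power_mult) (simp add: field_simps eval_nat_numeral)
  have mx: "virial_mult x * x = 1 - 5 * x ^ 4 / D\<^sup>2"
    unfolding virial_mult_def D_def[symmetric] using x D by (simp add: left_diff_distrib eval_nat_numeral)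
  have a1: "(virial_mult x / sig x ^ 6)\<^sup>2 / (1 / sig x ^ 6) = (virial_mult x)\<^sup>2 * S"
  proof -
    have *: "(m / s)\<^sup>2 / (1 / s) = m\<^sup>2 * (1 / s)" if "s > 0" for m s :: real
      using that by (simp add: power2_eq_square field_simps)
    show ?thesis unfolding S_def by (rule *) (simp add: sig_pos sig_neq_0)
  qed
  have a2: "real 6 * virial_mult x * x / (2 * sig x ^ (6 + 4)) = 3 * (virial_mult x * x) * T"
    by (simp add: T_def)
  have a3: "(- (1 / x\<^sup>2) - (15 * x\<^sup>2 / D\<^sup>2 - 20 * x ^ 4 / D ^ 3)) / sig x ^ 6 = (- (1 / x\<^sup>2) - (15 * x\<^sup>2 / D\<^sup>2 - 20 * x ^ 4 / D ^ 3)) * S"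
    by (simp add: S_def)
  have a4: "virial_q x = (15 * x ^ 4 / D\<^sup>2 - 3) * T + (20 * x ^ 4 / D ^ 3 + 25 * x ^ 6 / D ^ 4 - 25 * x\<^sup>2 / D\<^sup>2) * S"
    by (simp add: virial_q_def S_def T_def D_def)
  show ?thesis
    unfolding D_def[symmetric] a1 a2 a3 a4 sq mx by (simp add: algebra_simps)
qed

lemma virial_mult_bound:
  assumes x: "x \<noteq> 0"
  shows "\<bar>virial_mult x / sig x ^ 6\<bar> * \<bar>x\<bar> * (1 + \<bar>x\<bar>) \<le> 12"
proof -
  define D where "D = 2 + x\<^sup>2"
  have D: "D > 0" unfolding D_def by (rule two_add_sq_pos)
  have mx: "virial_mult x * x = 1 - 5 * (x ^ 4 / D\<^sup>2)"
    unfolding virial_mult_def D_def[symmetric] using x D by (simp add: left_diff_distrib eval_nat_numeral)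
  have "(x\<^sup>2)\<^sup>2 \<le> D\<^sup>2" by (intro power_mono) (auto simp: D_def)
  then have "x ^ 4 / D\<^sup>2 \<le> 1" using D by (simp flip: power_mult)
  moreover have "0 \<le> x ^ 4 / D\<^sup>2" using D by simp
  ultimately have a: "\<bar>virial_mult x\<bar> * \<bar>x\<bar> \<le> 6" unfolding abs_mult[symmetric] mx by linarith
  have b: "1 + \<bar>x\<bar> \<le> 2 * sig x ^ 6"
    using abs_le_sig[of x] sig_ge_1_power[of x 6] sig_power_mono[of 2 6 x] by simp
  have "\<bar>virial_mult x / sig x ^ 6\<bar> * \<bar>x\<bar> * (1 + \<bar>x\<bar>) = (\<bar>virial_mult x\<bar> * \<bar>x\<bar>) * (1 + \<bar>x\<bar>) / sig x ^ 6"
    using sig_pos[of x] by simp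
  also have "\<dots> \<le> 6 * (2 * sig x ^ 6) / sig x ^ 6"
    using sig_pos[of x] by (intro divide_right_mono mult_mono a b) auto
  also have "\<dots> = 12" using sig_pos[of x] by simp
  finally show ?thesis .
qed

context profile
begin

text \<open>As 1 / sig^6 = H', these are the integrals of H' w^2 and H' w_r^2, the quantities that
  the virial identity can control.\<close>

definition K6 :: real where "K6 = (LINT r|lebesgue. (w r)\<^sup>2 / sig r ^ 6)"
definition G6 :: real where "G6 = (LINT r|lebesgue. 1 / sig r ^ 6 * (g r)\<^sup>2)"

lemma integrable_w6: "integrable lebesgue (\<lambda>r. (w r)\<^sup>2 / sig r ^ 6)"
proof -
  have c: "continuous_on UNIV (\<lambda>r. 1 / sig r ^ 6)" by (intro continuous_div_sig continuous_intros)
  have "\<bar>1 / sig r ^ 6\<bar> \<le> 1 / sig r ^ 4" for r using inverse_sig_mono[of 4 6 r] sig_pos[of r] by simp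
  from coeff_integrable(1)[where k = 0, OF c, unfolded add_0, OF this] show ?thesis by simp
qed

lemma K6_nonneg: "0 \<le> K6"
  unfolding K6_def by (rule Bochner_Integration.integral_nonneg) (use sig_pos in \<open>simp add: less_imp_le\<close>)

lemma integrable_g6: "integrable lebesgue (\<lambda>r. 1 / sig r ^ 6 * (g r)\<^sup>2)"
proof -
  have m: "(\<lambda>r. 1 / sig r ^ 6) \<in> borel_measurable lebesgue"
    by (intro borel_measurable_lebesgue_continuous continuous_div_sig continuous_intros)
  have "\<bar>1 / sig r ^ 6\<bar> \<le> 1" for r using inverse_sig_mono[of 0 6 r] sig_pos[of r] by simp
  from L2_mult_integrable[OF in_L2_bounded_mult(1)[OF g m this] g] show ?thesis
    by (simp add: power2_eq_square mult.assoc)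
qed

lemma virial_coeff_continuous: "continuous_on S virial_coeff"
  unfolding virial_coeff_def[abs_def] by (intro continuous_div_sig continuous_intros)

lemma integrable_virial_coeff: "integrable lebesgue (\<lambda>r. virial_coeff r * (w r)\<^sup>2)"
proof -
  have "\<bar>virial_coeff r\<bar> \<le> 27 / sig r ^ 4" for r
    using virial_coeff_bound[of r] inverse_sig_mono[of 4 6 r] by simp
  from coeff_integrable(1)[where k = 0, OF virial_coeff_continuous, unfolded add_0, OF this] show ?thesis .
qed

text \<open>The weighted Hardy inequality bounds int -q w^2 by \<open>G6\<close>, and -q exceeds (H
  V)' by a tenth of the weight H'.\<close>

lemma hardy_virial: "(LINT r|lebesgue. virial_coeff r * (w r)\<^sup>2) + K6 / 10 \<le> G6"
proof -
  have qb: "\<bar>virial_q r\<bar> \<le> 100 / sig r ^ 4" for r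
    using virial_q_bound[of r] inverse_sig_mono[of 4 6 r] by simp
  note qi = coeff_integrable(1)[where k = 0, OF continuous_virial_q, unfolded add_0, OF qb]
  have "0 \<le> (LINT r|lebesgue. 1 / sig r ^ 6 * (g r)\<^sup>2 + virial_q r * (w r)\<^sup>2)"
  proof (rule weighted_hardy[OF g, where p = "\<lambda>r. virial_mult r / sig r ^ 6" and C = 12
        and p' = "\<lambda>x. (- (1 / x\<^sup>2) - (15 * x\<^sup>2 / (2 + x\<^sup>2)\<^sup>2 - 20 * x ^ 4 / (2 + x\<^sup>2) ^ 3)) / sig x ^ 6
          - real 6 * virial_mult x * x / (2 * sig x ^ (6 + 4))"])
    fix x :: real assume x: "x \<noteq> 0"
    show "((\<lambda>r. virial_mult r / sig r ^ 6) has_real_derivative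
        (- (1 / x\<^sup>2) - (15 * x\<^sup>2 / (2 + x\<^sup>2)\<^sup>2 - 20 * x ^ 4 / (2 + x\<^sup>2) ^ 3)) / sig x ^ 6
          - real 6 * virial_mult x * x / (2 * sig x ^ (6 + 4))) (at x)"
      by (rule DERIV_div_sig[OF DERIV_virial_mult[OF x]])
    show "\<bar>virial_mult x / sig x ^ 6\<bar> * \<bar>x\<bar> * (1 + \<bar>x\<bar>) \<le> 12" by (rule virial_mult_bound[OF x])
    show "virial_q x = ((- (1 / x\<^sup>2) - (15 * x\<^sup>2 / (2 + x\<^sup>2)\<^sup>2 - 20 * x ^ 4 / (2 + x\<^sup>2) ^ 3)) / sig x ^ 6
        - real 6 * virial_mult x * x / (2 * sig x ^ (6 + 4))) + (virial_mult x / sig x ^ 6)\<^sup>2 / (1 / sig x ^ 6)"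
      by (rule virial_q_eq[OF x])
  next
    show "continuous_on (- {0}) (\<lambda>x. (- (1 / x\<^sup>2) - (15 * x\<^sup>2 / (2 + x\<^sup>2)\<^sup>2 - 20 * x ^ 4 / (2 + x\<^sup>2) ^ 3)) / sig x ^ 6
          - real 6 * virial_mult x * x / (2 * sig x ^ (6 + 4)))"
      unfolding virial_mult_def
      by (intro continuous_on_diff continuous_div_sig continuous_intros)
        (use two_add_sq_pos in \<open>auto simp: less_imp_neq[symmetric] sig_neq_0 intro!: continuous_sig\<close>)
    show "integrable lebesgue (\<lambda>r. 1 / sig r ^ 6 * (g r)\<^sup>2 + virial_q r * (w r)\<^sup>2)"
      by (rule Bochner_Integration.integrable_add[OF integrable_g6 qi])
  qed (simp add: sig_pos sig_neq_0)
  also have "\<dots> = G6 + (LINT r|lebesgue. virial_q r * (w r)\<^sup>2)"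
    unfolding G6_def by (rule Bochner_Integration.integral_add[OF integrable_g6 qi])
  finally have "0 \<le> G6 + (LINT r|lebesgue. virial_q r * (w r)\<^sup>2)" .
  moreover have "(LINT r|lebesgue. virial_coeff r * (w r)\<^sup>2 + 1 / 10 * ((w r)\<^sup>2 / sig r ^ 6))
      \<le> (LINT r|lebesgue. (- 1) * (virial_q r * (w r)\<^sup>2))"
  proof (rule integral_mono[OF Bochner_Integration.integrable_add[OF integrable_virial_coeff integrable_mult_right[OF integrable_w6]]
        integrable_mult_right[OF qi]])
    fix r
    have "(virial_coeff r + 1 / 10 / sig r ^ 6) * (w r)\<^sup>2 \<le> - virial_q r * (w r)\<^sup>2"
      by (intro mult_right_mono virial_q_le) simp
    then show "virial_coeff r * (w r)\<^sup>2 + 1 / 10 * ((w r)\<^sup>2 / sig r ^ 6) \<le> (- 1) * (virial_q r * (w r)\<^sup>2)"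
      by (simp add: distrib_right)
  qed
  moreover have "(LINT r|lebesgue. virial_coeff r * (w r)\<^sup>2 + 1 / 10 * ((w r)\<^sup>2 / sig r ^ 6))
      = (LINT r|lebesgue. virial_coeff r * (w r)\<^sup>2) + 1 / 10 * K6"
    unfolding K6_def integral_mult_right_zero[symmetric]
    by (rule Bochner_Integration.integral_add[OF integrable_virial_coeff integrable_mult_right[OF integrable_w6]])
  ultimately show ?thesis by simp
qed

text \<open>With I the integral of (H V)' w^2, the margin gives \<open>K6\<close> <= 10 (G6 - I),
  while I <= 27 \<open>K6\<close>. Hence I <= 270 (G6 - I), and adding G6 - I gives 271.\<close>

lemma virial_coercive: "G6 \<le> 271 * (G6 - (LINT r|lebesgue. virial_coeff r * (w r)\<^sup>2))"
proof -
  have "(LINT r|lebesgue. virial_coeff r * (w r)\<^sup>2) \<le> (LINT r|lebesgue. 27 * ((w r)\<^sup>2 / sig r ^ 6))"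
  proof (rule integral_mono[OF integrable_virial_coeff integrable_mult_right[OF integrable_w6]])
    fix r
    have "virial_coeff r * (w r)\<^sup>2 \<le> 27 / sig r ^ 6 * (w r)\<^sup>2"
      using virial_coeff_bound[of r] by (intro mult_right_mono) auto
    then show "virial_coeff r * (w r)\<^sup>2 \<le> 27 * ((w r)\<^sup>2 / sig r ^ 6)" by simp
  qed
  then have "(LINT r|lebesgue. virial_coeff r * (w r)\<^sup>2) \<le> 27 * K6" by (simp only: K6_def integral_mult_right_zero)
  then show ?thesis using hardy_virial by argo
qed

end

section \<open>Integration by parts in the virial identity\<close>

lemma DERIV_kink_H: "(kink_H has_real_derivative 1 / sig r ^ 6) (at r)"
proof -
  have "((\<lambda>r. r / sig r ^ 2) has_real_derivative 1 / sig r ^ 2 - real 2 * r * r / (2 * sig r ^ (2 + 4))) (at r)"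
    by (rule DERIV_div_sig) (rule DERIV_ident)
  moreover have "1 / sig r ^ 2 - real 2 * r * r / (2 * sig r ^ (2 + 4)) = (sig r ^ 4 - r\<^sup>2) / sig r ^ 6"
  proof -
    have "1 / sig r ^ 2 = sig r ^ 4 / sig r ^ 6" using sig_pos[of r] by (simp add: field_simps flip: power_add)
    then show ?thesis by (simp add: diff_divide_distrib power2_eq_square)
  qed
  ultimately show ?thesis unfolding kink_H_sig[abs_def] by (simp add: sig_4)
qed

lemma kink_H_bound: "\<bar>kink_H r\<bar> \<le> 1"
  unfolding kink_H_sig using abs_le_sig[of r] sig_pos[of r] by (simp add: abs_divide divide_le_eq)

text \<open>H times the potential \<open>nonlin_pot r y\<close> is 1/2 \<open>ibp2\<close> y^2 +
  \<open>ibp3\<close> y^3 + \<open>ibp4\<close> y^4; in particular \<open>ibp2\<close> is H V. The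
  primed functions are derivatives in r.\<close>

definition ibp2 :: "real \<Rightarrow> real" where "ibp2 r = (15 / 4 * r ^ 3 - 3 / 2 * r) / sig r ^ 10"
definition ibp3 :: "real \<Rightarrow> real" where "ibp3 r = (2 * r\<^sup>2) / sig r ^ 9"
definition ibp4 :: "real \<Rightarrow> real" where "ibp4 r = (r / 2) / sig r ^ 8"
definition ibp3' :: "real \<Rightarrow> real" where
  "ibp3' r = (4 * r) / sig r ^ 9 - (9 * r ^ 3) / sig r ^ 13"
definition ibp4' :: "real \<Rightarrow> real" where
  "ibp4' r = (1 / 2) / sig r ^ 8 - (2 * r\<^sup>2) / sig r ^ 12"

lemma DERIV_ibp2: "(ibp2 has_real_derivative virial_coeff r) (at r)"
proof -
  have "((\<lambda>r. 15 / 4 * r ^ 3 - 3 / 2 * r) has_real_derivative 45 / 4 * r\<^sup>2 - 3 / 2) (at r)"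
    by (auto intro!: derivative_eq_intros)
  from DERIV_div_sig[OF this, of 10]
  have "(ibp2 has_real_derivative (45 / 4 * r\<^sup>2 - 3 / 2) / sig r ^ 10
      - real 10 * (15 / 4 * r ^ 3 - 3 / 2 * r) * r / (2 * sig r ^ (10 + 4))) (at r)"
    unfolding ibp2_def[abs_def] .
  moreover have "(45 / 4 * r\<^sup>2 - 3 / 2) / sig r ^ 10 = (45 / 4 * r\<^sup>2 - 3 / 2) * (1 + r\<^sup>2) / sig r ^ 14"
    using sig_pos[of r] unfolding sig_4[symmetric] by (simp add: field_simps flip: power_add)
  moreover have "real 10 * (15 / 4 * r ^ 3 - 3 / 2 * r) * r / (2 * sig r ^ (10 + 4)) = 5 * (15 / 4 * r ^ 3 - 3 / 2 * r) * r / sig r ^ 14"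
  proof -
    have *: "real 10 * a * r / (2 * S) = 5 * a * r / S" for a S :: real by simp
    show ?thesis unfolding * by simp
  qed
  moreover have "(45 / 4 * r\<^sup>2 - 3 / 2) * (1 + r\<^sup>2) - 5 * (15 / 4 * r ^ 3 - 3 / 2 * r) * r = 69 / 4 * r\<^sup>2 - 15 / 2 * r ^ 4 - 3 / 2"
    by (simp add: field_simps eval_nat_numeral)
  ultimately show ?thesis unfolding virial_coeff_def by (metis diff_divide_distrib)
qed

lemma DERIV_ibp3: "(ibp3 has_real_derivative ibp3' r) (at r)"
proof -
  have "((\<lambda>r. 2 * r\<^sup>2) has_real_derivative 4 * r) (at r)" by (auto intro!: derivative_eq_intros)
  from DERIV_div_sig[OF this, of 9]
  have "(ibp3 has_real_derivative (4 * r) / sig r ^ 9 - real 9 * (2 * r\<^sup>2) * r / (2 * sig r ^ (9 + 4))) (at r)"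
    unfolding ibp3_def[abs_def] .
  then show ?thesis by (rule DERIV_cong) (simp add: ibp3'_def eval_nat_numeral)
qed

lemma DERIV_ibp4: "(ibp4 has_real_derivative ibp4' r) (at r)"
proof -
  have "((\<lambda>r::real. r / 2) has_real_derivative 1 / 2) (at r)" by (auto intro!: derivative_eq_intros)
  from DERIV_div_sig[OF this, of 8]
  have "(ibp4 has_real_derivative (1 / 2) / sig r ^ 8 - real 8 * (r / 2) * r / (2 * sig r ^ (8 + 4))) (at r)"
    unfolding ibp4_def[abs_def] .
  then show ?thesis by (rule DERIV_cong) (simp add: ibp4'_def power2_eq_square)
qed

lemma continuous_ibp: "continuous_on S ibp3'" "continuous_on S ibp4'"
  unfolding ibp3'_def[abs_def] ibp4'_def[abs_def]
  by (intro continuous_on_diff continuous_div_sig continuous_intros)+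

lemma div_sig_bound:
  assumes "\<bar>a\<bar> \<le> c * sig r ^ m" shows "\<bar>a / sig r ^ (m + n)\<bar> \<le> c / sig r ^ n"
proof -
  have "\<bar>a / sig r ^ (m + n)\<bar> \<le> c * sig r ^ m / sig r ^ (m + n)"
    unfolding abs_divide using assms sig_pos[of r] by (simp add: divide_right_mono)
  also have "\<dots> = c / sig r ^ n" using sig_pos[of r] by (simp add: power_add)
  finally show ?thesis .
qed

lemma abs_r3_le: "\<bar>r ^ 3\<bar> \<le> sig r ^ 6"
proof -
  have "\<bar>r\<bar> ^ 3 \<le> ((sig r)\<^sup>2) ^ 3" by (intro power_mono abs_le_sig) simp
  then show ?thesis by (simp add: power_abs flip: power_mult)
qed

lemma ibp2_bound: "\<bar>ibp2 r\<bar> \<le> 6 / sig r ^ 4"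
proof -
  have "\<bar>15 / 4 * r ^ 3 - 3 / 2 * r\<bar> \<le> 15 / 4 * \<bar>r ^ 3\<bar> + 3 / 2 * \<bar>r\<bar>"
    using abs_triangle_ineq4[of "15 / 4 * r ^ 3" "3 / 2 * r"] by (simp add: abs_mult)
  also have "\<dots> \<le> 6 * sig r ^ 6"
    using abs_r3_le[of r] abs_le_sig[of r] sig_power_mono[of 2 6 r] by simp
  finally show ?thesis unfolding ibp2_def using div_sig_bound[of _ 6 r 6 4] by simp
qed

lemma ibp3_bound: "\<bar>ibp3 r\<bar> \<le> 2 / sig r ^ 5"
  unfolding ibp3_def using div_sig_bound[of "2 * r\<^sup>2" 2 r 4 5] sq_le_sig[of r] by simp

lemma ibp4_bound: "\<bar>ibp4 r\<bar> \<le> 1 / sig r ^ 6"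
  unfolding ibp4_def using div_sig_bound[of "r / 2" 1 r 2 6] abs_le_sig[of r] by simp

lemma ibp3'_bound: "\<bar>ibp3' r\<bar> \<le> 13 / sig r ^ 7"
proof -
  have "\<bar>(4 * r) / sig r ^ 9\<bar> \<le> 4 / sig r ^ 7"
    using div_sig_bound[of "4 * r" 4 r 2 7] abs_le_sig[of r] by (simp add: abs_mult)
  moreover have "\<bar>(9 * r ^ 3) / sig r ^ 13\<bar> \<le> 9 / sig r ^ 7"
    using div_sig_bound[of "9 * r ^ 3" 9 r 6 7] abs_r3_le[of r] by (simp add: abs_mult)
  ultimately have "\<bar>ibp3' r\<bar> \<le> 4 / sig r ^ 7 + 9 / sig r ^ 7" unfolding ibp3'_def by linarith
  then show ?thesis by (simp add: add_divide_distrib[symmetric])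
qed

lemma ibp4'_bound: "\<bar>ibp4' r\<bar> \<le> 5 / 2 / sig r ^ 8"
proof -
  have "\<bar>(2 * r\<^sup>2) / sig r ^ 12\<bar> \<le> 2 / sig r ^ 8"
    using div_sig_bound[of "2 * r\<^sup>2" 2 r 4 8] sq_le_sig[of r] by simp
  moreover have "\<bar>1 / 2 / sig r ^ 8\<bar> = 1 / 2 / sig r ^ 8" using sig_pos[of r] by simp
  ultimately have "\<bar>ibp4' r\<bar> \<le> 1 / 2 / sig r ^ 8 + 2 / sig r ^ 8" unfolding ibp4'_def by linarith
  also have "\<dots> = 5 / 2 / sig r ^ 8" by (simp add: add_divide_distrib[symmetric])
  finally show ?thesis .
qed

context profile
begin

lemma norm_weighted: "(L2_norm_fun (\<lambda>r. w r / (sig r)\<^sup>2))\<^sup>2 = Q"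
  by (simp add: L2_norm_sq Q_def power_divide flip: power_mult)

lemma nonlin_in_L2:
  "in_L2 (\<lambda>r. nonlin r (w r))"
  "L2_norm_fun (\<lambda>r. nonlin r (w r)) \<le> (4 + 12 * M + 6 * M\<^sup>2) * sqrt Q"
proof -
  define C where "C = 4 + 12 * M + 6 * M\<^sup>2"
  have C: "C \<ge> 0" using M_nonneg by (simp add: C_def)
  have "\<bar>nonlin r (w r)\<bar> \<le> \<bar>C * (w r / (sig r)\<^sup>2)\<bar>" for r
  proof -
    have "\<bar>nonlin r (w r)\<bar> \<le> C * \<bar>w r\<bar> / sig r ^ 4"
      unfolding C_def by (rule nonlin_bound[OF w_bound M_nonneg])
    also have "\<dots> = C * \<bar>w r\<bar> * (1 / sig r ^ 4)" by simp
    also have "\<dots> \<le> C * \<bar>w r\<bar> * (1 / sig r ^ 2)"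
      using C by (intro mult_left_mono inverse_sig_mono) auto
    also have "\<dots> = \<bar>C * (w r / (sig r)\<^sup>2)\<bar>" using C by (simp add: abs_mult)
    finally show ?thesis .
  qed
  then have le: "AE r in lebesgue. \<bar>nonlin r (w r)\<bar> \<le> \<bar>C * (w r / (sig r)\<^sup>2)\<bar>" by simp
  note d = in_L2_dominated[OF in_L2_cmult[OF w_weighted] measurable_nonlin[OF w_measurable] le]
  show "in_L2 (\<lambda>r. nonlin r (w r))" by (rule d(1))
  have nq: "L2_norm_fun (\<lambda>r. w r / (sig r)\<^sup>2) = sqrt Q"
    using norm_weighted by (metis L2_norm_nonneg real_sqrt_abs abs_of_nonneg)
  show "L2_norm_fun (\<lambda>r. nonlin r (w r)) \<le> (4 + 12 * M + 6 * M\<^sup>2) * sqrt Q"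
    using d(2) C unfolding C_def[symmetric] L2_norm_cmult nq by simp
qed

text \<open>The one-sided bound is better than the two-sided one because the quartic part is
  nonnegative, so that only the cubic part is a loss.\<close>

lemma pot_parts:
  "integrable lebesgue (\<lambda>r. nonlin_pot r (w r))"
  "\<bar>(LINT r|lebesgue. nonlin_pot r (w r)) - 1 / 2 * (LINT r|lebesgue. 3 / 4 * (5 * r\<^sup>2 - 2) / sig r ^ 8 * (w r)\<^sup>2)\<bar>
    \<le> (2 * M + 1 / 2 * M\<^sup>2) * Q"
  "1 / 2 * (LINT r|lebesgue. 3 / 4 * (5 * r\<^sup>2 - 2) / sig r ^ 8 * (w r)\<^sup>2) - 2 * M * Q \<le> (LINT r|lebesgue. nonlin_pot r (w r))"
proof -
  have e: "(1::nat) + 2 = 3" "(1::nat) + 4 = 5" "(2::nat) + 2 = 4" "(2::nat) + 4 = 6" by simp_all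
  note i2 = coeff_integrable(1)[where k = 0 and C = "15 / 4", OF V_continuous, unfolded add_0, OF V_bound]
  have c3: "continuous_on UNIV (\<lambda>r. 2 * (r / sig r ^ 7))"
    by (intro continuous_on_mult continuous_div_sig continuous_intros)
  have b3: "\<bar>2 * (r / sig r ^ 7)\<bar> \<le> 2 / sig r ^ 5" for r
    using r7_bound[of r] by (simp only: abs_mult)
  note i3 = coeff_integrable[where k = 1 and C = 2, OF c3, unfolded e power_one_right, OF b3]
  have c4: "continuous_on UNIV (\<lambda>r. 1 / 2 / sig r ^ 6)" by (intro continuous_div_sig continuous_intros)
  have b4: "\<bar>1 / 2 / sig r ^ 6\<bar> \<le> 1 / 2 / sig r ^ 6" for r using sig_pos[of r] by simp
  note i4 = coeff_integrable[where k = 2 and C = "1 / 2", OF c4, unfolded e, OF b4]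
  have eq: "nonlin_pot r (w r) = 1 / 2 * (3 / 4 * (5 * r\<^sup>2 - 2) / sig r ^ 8 * (w r)\<^sup>2)
      + (2 * (r / sig r ^ 7) * w r ^ 3 + 1 / 2 / sig r ^ 6 * w r ^ 4)" for r
    by (simp add: nonlin_pot_def)
  note s1 = integrable_mult_right[OF i2, of "1 / 2"] and s2 = Bochner_Integration.integrable_add[OF i3(1) i4(1)]
  show "integrable lebesgue (\<lambda>r. nonlin_pot r (w r))"
    unfolding eq by (rule Bochner_Integration.integrable_add[OF s1 s2])
  have P: "(LINT r|lebesgue. nonlin_pot r (w r)) = 1 / 2 * (LINT r|lebesgue. 3 / 4 * (5 * r\<^sup>2 - 2) / sig r ^ 8 * (w r)\<^sup>2)
      + ((LINT r|lebesgue. 2 * (r / sig r ^ 7) * w r ^ 3) + (LINT r|lebesgue. 1 / 2 / sig r ^ 6 * w r ^ 4))"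
    unfolding eq Bochner_Integration.integral_add[OF s1 s2] Bochner_Integration.integral_add[OF i3(1) i4(1)]
      integral_mult_right_zero ..
  have p4: "0 \<le> (LINT r|lebesgue. 1 / 2 / sig r ^ 6 * w r ^ 4)"
    by (rule Bochner_Integration.integral_nonneg) (use sig_pos in \<open>simp add: less_imp_le\<close>)
  show "\<bar>(LINT r|lebesgue. nonlin_pot r (w r)) - 1 / 2 * (LINT r|lebesgue. 3 / 4 * (5 * r\<^sup>2 - 2) / sig r ^ 8 * (w r)\<^sup>2)\<bar>
    \<le> (2 * M + 1 / 2 * M\<^sup>2) * Q"
    unfolding P distrib_right using i3(2) i4(2) by linarith
  show "1 / 2 * (LINT r|lebesgue. 3 / 4 * (5 * r\<^sup>2 - 2) / sig r ^ 8 * (w r)\<^sup>2) - 2 * M * Q \<le> (LINT r|lebesgue. nonlin_pot r (w r))"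
    unfolding P using i3(2) p4 by linarith
qed

lemma V_integral_bounds:
  "(LINT r|lebesgue. 3 / 4 * (5 * r\<^sup>2 - 2) / sig r ^ 8 * (w r)\<^sup>2) \<le> 15 / 4 * Q"
  "- (3 / 2) * Q \<le> (LINT r|lebesgue. 3 / 4 * (5 * r\<^sup>2 - 2) / sig r ^ 8 * (w r)\<^sup>2)"
proof -
  note i2 = coeff_integrable[where k = 0 and C = "15 / 4", OF V_continuous, unfolded add_0, OF V_bound]
  show "(LINT r|lebesgue. 3 / 4 * (5 * r\<^sup>2 - 2) / sig r ^ 8 * (w r)\<^sup>2) \<le> 15 / 4 * Q" using i2(2) by simp
  have "(LINT r|lebesgue. - (3 / 2) * ((w r)\<^sup>2 / sig r ^ 4)) \<le> (LINT r|lebesgue. 3 / 4 * (5 * r\<^sup>2 - 2) / sig r ^ 8 * (w r)\<^sup>2)"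
  proof (rule integral_mono[OF integrable_mult_right[OF integrable_w2] i2(1)])
    fix r
    have "- (3 / 2) / sig r ^ 4 \<le> - (3 / 2) / sig r ^ 8" using inverse_sig_mono[of 4 8 r] by simp
    also have "\<dots> \<le> 3 / 4 * (5 * r\<^sup>2 - 2) / sig r ^ 8"
      using sig_pos[of r] by (intro divide_right_mono) auto
    finally have "- (3 / 2) / sig r ^ 4 * (w r)\<^sup>2 \<le> 3 / 4 * (5 * r\<^sup>2 - 2) / sig r ^ 8 * (w r)\<^sup>2"
      by (rule mult_right_mono) simp
    then show "- (3 / 2) * ((w r)\<^sup>2 / sig r ^ 4) \<le> 3 / 4 * (5 * r\<^sup>2 - 2) / sig r ^ 8 * (w r)\<^sup>2" by simp
  qed
  then show "- (3 / 2) * Q \<le> (LINT r|lebesgue. 3 / 4 * (5 * r\<^sup>2 - 2) / sig r ^ 8 * (w r)\<^sup>2)"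
    by (simp only: Q_def integral_mult_right_zero)
qed

text \<open>For M <= 1/8 the cubic loss is at most Q/4, and the Hardy inequality leaves 3/4 Q - 1/4
  Q. For the first bound, two thirds of the quadratic energy are estimated by Hardy and one third
  through V >= -(3/2) / (1 + r^2): the contributions to Q cancel and M^2 / 6 is left.\<close>

lemma energy_lower:
  assumes "M \<le> 1 / 8"
  shows "M\<^sup>2 / 6 \<le> 1 / 2 * M\<^sup>2 + (LINT r|lebesgue. nonlin_pot r (w r))"
    "Q / 2 \<le> 1 / 2 * M\<^sup>2 + (LINT r|lebesgue. nonlin_pot r (w r))"
proof -
  have "M * Q \<le> 1 / 8 * Q" using assms Q_nonneg by (intro mult_right_mono)
  then show "M\<^sup>2 / 6 \<le> 1 / 2 * M\<^sup>2 + (LINT r|lebesgue. nonlin_pot r (w r))"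
    "Q / 2 \<le> 1 / 2 * M\<^sup>2 + (LINT r|lebesgue. nonlin_pot r (w r))"
    using pot_parts(3) hardy_energy V_integral_bounds(2) by argo+
qed

lemma energy_upper:
  assumes "M \<le> 1" shows "(LINT r|lebesgue. nonlin_pot r (w r)) \<le> 5 * Q"
proof -
  have "M\<^sup>2 \<le> 1" using assms M_nonneg by (simp add: power_le_one)
  from mult_right_mono[OF assms Q_nonneg] mult_right_mono[OF this Q_nonneg]
  show ?thesis using pot_parts(2) V_integral_bounds(1) unfolding distrib_right by argo
qed

text \<open>The analogue of \<open>coeff_integrable\<close> for the weight H'. Two more powers of
  decay are required, since the virial identity controls \<open>K6\<close> only, and not
  \<open>Q\<close>.\<close>

lemma coeff6:
  assumes c: "continuous_on UNIV c" and b: "\<And>r. \<bar>c r\<bar> \<le> C / sig r ^ (k + 6)"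
  shows "integrable lebesgue (\<lambda>r. c r * w r ^ (k + 2))"
    "\<bar>LINT r|lebesgue. c r * w r ^ (k + 2)\<bar> \<le> C * M ^ k * K6"
proof -
  have C: "C \<ge> 0" using b[of 0] sig_pos[of 0] by (smt (verit) abs_ge_zero divide_neg_pos zero_less_power)
  have "\<bar>c r\<bar> \<le> C / sig r ^ (k + 4)" for r
    using b[of r] mult_left_mono[OF inverse_sig_mono[of "k + 4" "k + 6" r] C] by simp
  from coeff_integrable(1)[OF c this] show i: "integrable lebesgue (\<lambda>r. c r * w r ^ (k + 2))" .
  have p: "\<bar>c r * w r ^ (k + 2)\<bar> \<le> C * M ^ k * ((w r)\<^sup>2 / sig r ^ 6)" for r
  proof -
    \<comment> \<open>Multiplication by sig^2 reduces the claim to the earlier bound, and the factor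
      is divided out afterwards.\<close>
    have "\<bar>c r * (sig r)\<^sup>2\<bar> \<le> C / sig r ^ (k + 6) * (sig r)\<^sup>2"
      using mult_right_mono[OF b[of r] zero_le_power2, of "sig r"] by (simp only: abs_mult abs_power2)
    also have "\<dots> = C / sig r ^ (k + 4)" using sig_pos[of r] by (simp add: field_simps flip: power_add)
    finally have "\<bar>c r * (sig r)\<^sup>2 * w r ^ (k + 2)\<bar> \<le> C * M ^ k * ((w r)\<^sup>2 / sig r ^ 4)" by (rule coeff_bound)
    moreover have "\<bar>c r * (sig r)\<^sup>2 * w r ^ (k + 2)\<bar> = \<bar>c r * w r ^ (k + 2)\<bar> * (sig r)\<^sup>2"
      using sig_pos[of r] unfolding abs_mult by (simp only: power2_abs abs_power2 mult_ac)
    moreover have "C * M ^ k * ((w r)\<^sup>2 / sig r ^ 4) = C * M ^ k * ((w r)\<^sup>2 / sig r ^ 6) * (sig r)\<^sup>2"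
      using sig_pos[of r] by (simp add: field_simps flip: power_add)
    ultimately show ?thesis using sig_pos[of r] by (simp only: mult_le_cancel_right) auto
  qed
  have "norm (LINT r|lebesgue. c r * w r ^ (k + 2)) \<le> (LINT r|lebesgue. C * M ^ k * ((w r)\<^sup>2 / sig r ^ 6))"
    by (rule Bochner_Integration.integral_norm_bound_integral[OF i integrable_mult_right[OF integrable_w6]])
      (simp only: real_norm_def p)
  then show "\<bar>LINT r|lebesgue. c r * w r ^ (k + 2)\<bar> \<le> C * M ^ k * K6"
    by (simp only: K6_def real_norm_def integral_mult_right_zero)
qed

lemma ac_coeff_power:
  assumes "\<And>r. (c has_real_derivative c' r) (at r)" "continuous_on UNIV c'"
  shows "ac_deriv (\<lambda>r. c r * w r ^ Suc n) (\<lambda>r. c' r * w r ^ Suc n + real (Suc n) * w r ^ n * g r * c r)"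
  by (rule ac_deriv_mult[OF ac_deriv_C1[OF assms] ac_deriv_power[OF w_ac]])

lemma integrable_Hfg: "integrable lebesgue (\<lambda>r. kink_H r * nonlin r (w r) * g r)"
  by (rule L2_mult_integrable[OF in_L2_bounded_mult(1)[OF nonlin_in_L2(1)
      borel_measurable_lebesgue_continuous[OF continuous_coeff(2)] kink_H_bound] g])

text \<open>Integrating the total derivative of H * \<open>nonlin_pot r (w r)\<close> moves the
  derivative from w to the coefficients. The quadratic part reproduces (H V)', and the cubic and
  quartic parts decay fast enough to be small multiples of \<open>K6\<close>.\<close>

lemma virial_ibp:
  "\<bar>(LINT r|lebesgue. kink_H r * nonlin r (w r) * g r) + 1 / 2 * (LINT r|lebesgue. virial_coeff r * (w r)\<^sup>2)\<bar>
    \<le> (13 * M + 5 / 2 * M\<^sup>2) * K6"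
proof -
  have e: "Suc 1 = 2" "Suc 2 = 3" "Suc 3 = 4" "(1::nat) + 2 = 3" "(1::nat) + 6 = 7" "(2::nat) + 2 = 4" "(2::nat) + 6 = 8"
    by simp_all
  note a2 = ac_coeff_power[OF DERIV_ibp2 virial_coeff_continuous, of 1, unfolded e]
  note a3 = ac_coeff_power[OF DERIV_ibp3 continuous_ibp(1), of 2, unfolded e]
  note a4 = ac_coeff_power[OF DERIV_ibp4 continuous_ibp(2), of 3, unfolded e]
  have half: "ac_deriv (\<lambda>r. 1 / 2) (\<lambda>r. 0)" by (rule ac_deriv_C1) auto
  note ac = ac_deriv_add[OF ac_deriv_mult[OF half a2] ac_deriv_add[OF a3 a4]]
  let ?f = "\<lambda>r. 1 / 2 * (ibp2 r * (w r)\<^sup>2) + (ibp3 r * w r ^ 3 + ibp4 r * w r ^ 4)"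
  let ?f' = "\<lambda>r. kink_H r * nonlin r (w r) * g r + (1 / 2 * (virial_coeff r * (w r)\<^sup>2) + (ibp3' r * w r ^ 3 + ibp4' r * w r ^ 4))"
  have f': "(0 * (ibp2 r * (w r)\<^sup>2) + (virial_coeff r * (w r)\<^sup>2 + real 2 * w r ^ 1 * g r * ibp2 r) * (1 / 2)
      + (ibp3' r * w r ^ 3 + real 3 * (w r)\<^sup>2 * g r * ibp3 r + (ibp4' r * w r ^ 4 + real 4 * w r ^ 3 * g r * ibp4 r))) = ?f' r" for r
  proof -
    have c: "kink_H r * (3 / 4 * (5 * r\<^sup>2 - 2) / sig r ^ 8) = ibp2 r" "kink_H r * (6 * r / sig r ^ 7) = 3 * ibp3 r"
      "kink_H r * (2 / sig r ^ 6) = 4 * ibp4 r"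
      unfolding kink_H_sig ibp2_def ibp3_def ibp4_def using sig_pos[of r]
      by (simp_all add: field_simps flip: power_add) (simp_all add: field_simps eval_nat_numeral)
    have "kink_H r * nonlin r (w r) = kink_H r * (3 / 4 * (5 * r\<^sup>2 - 2) / sig r ^ 8) * w r
        + kink_H r * (6 * r / sig r ^ 7) * (w r)\<^sup>2 + kink_H r * (2 / sig r ^ 6) * w r ^ 3"
      unfolding nonlin_sig by (simp only: distrib_left mult.assoc)
    then have "kink_H r * nonlin r (w r) * g r = (ibp2 r * w r + 3 * ibp3 r * (w r)\<^sup>2 + 4 * ibp4 r * w r ^ 3) * g r"
      unfolding c by (simp only:)
    then show ?thesis by (simp add: algebra_simps)
  qed
  have ac': "ac_deriv ?f ?f'" using ac unfolding f' .
  note j2 = integrable_mult_right[OF integrable_virial_coeff, of "1 / 2"]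
  note j3 = coeff6[where k = 1 and C = 13, OF continuous_ibp(1), unfolded e power_one_right, OF ibp3'_bound]
  note j4 = coeff6[where k = 2 and C = "5 / 2", OF continuous_ibp(2), unfolded e, OF ibp4'_bound]
  note j34 = Bochner_Integration.integrable_add[OF j3(1) j4(1)]
  note j = Bochner_Integration.integrable_add[OF j2 j34]
  have "(LINT r|lebesgue. ?f' r) = 0"
  proof (rule ac_deriv_integral_eq_0[OF ac' Bochner_Integration.integrable_add[OF integrable_Hfg j]])
    define C where "C = 3 * M\<^sup>2 + 2 * M ^ 3 + M ^ 4"
    \<comment> \<open>The boundary terms are O(1 / |r|): the coefficients beat the growth of w by
      two powers of \<open>sig\<close>.\<close>
    have fb: "\<bar>?f r\<bar> * \<bar>r\<bar> \<le> C" for r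
    proof -
      have 1: "\<bar>c * w r ^ n\<bar> \<le> b * M ^ n / (sig r)\<^sup>2" if "\<bar>c\<bar> \<le> b / sig r ^ (n + 2)" for c b n
      proof -
        have b: "0 \<le> b / sig r ^ (n + 2)" using that by linarith
        have "\<bar>c\<bar> * \<bar>w r\<bar> ^ n \<le> b / sig r ^ (n + 2) * (sig r * M) ^ n"
          by (intro mult_mono that power_mono w_bound b) auto
        also have "\<dots> = b * M ^ n / (sig r)\<^sup>2" using sig_pos[of r] by (simp add: power_mult_distrib power_add power2_eq_square)
        finally show ?thesis by (simp add: abs_mult power_abs)
      qed
      have "\<bar>ibp2 r * (w r)\<^sup>2\<bar> \<le> 6 * M\<^sup>2 / (sig r)\<^sup>2" by (rule 1) (use ibp2_bound[of r] in simp)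
      moreover have "\<bar>ibp3 r * w r ^ 3\<bar> \<le> 2 * M ^ 3 / (sig r)\<^sup>2" by (rule 1) (use ibp3_bound[of r] in simp)
      moreover have "\<bar>ibp4 r * w r ^ 4\<bar> \<le> 1 * M ^ 4 / (sig r)\<^sup>2" by (rule 1) (use ibp4_bound[of r] in simp)
      moreover have "C / (sig r)\<^sup>2 = 1 / 2 * (6 * M\<^sup>2 / (sig r)\<^sup>2) + 2 * M ^ 3 / (sig r)\<^sup>2 + 1 * M ^ 4 / (sig r)\<^sup>2"
        by (simp add: C_def add_divide_distrib)
      ultimately have "\<bar>?f r\<bar> \<le> C / (sig r)\<^sup>2" by linarith
      then have "\<bar>?f r\<bar> * \<bar>r\<bar> \<le> C / (sig r)\<^sup>2 * (sig r)\<^sup>2"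
        by (intro mult_mono abs_le_sig) (auto simp: C_def M_nonneg)
      then show ?thesis using sig_pos[of r] by simp
    qed
    have z: "(\<lambda>n. C * (1 / real n)) \<longlonglongrightarrow> 0" by (rule tendsto_mult_right_zero[OF lim_1_over_n])
    have ev: "\<forall>\<^sub>F n in sequentially. norm (?f (x n)) \<le> C * (1 / real n)" if "\<And>n. \<bar>x n\<bar> = real n" for x
      unfolding eventually_sequentially
    proof (intro exI[of _ 1] allI impI)
      fix n :: nat assume "n \<ge> 1"
      then have n: "real n > 0" by simp
      show "norm (?f (x n)) \<le> C * (1 / real n)"
        using fb[of "x n"] n unfolding that by (simp add: field_simps)
    qed
    show "(\<lambda>n. ?f (real n)) \<longlonglongrightarrow> 0" by (rule Lim_null_comparison[OF ev z]) simp
    show "(\<lambda>n. ?f (- real n)) \<longlonglongrightarrow> 0" by (rule Lim_null_comparison[OF ev z]) simp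
  qed
  also have "(LINT r|lebesgue. ?f' r) = (LINT r|lebesgue. kink_H r * nonlin r (w r) * g r)
      + (1 / 2 * (LINT r|lebesgue. virial_coeff r * (w r)\<^sup>2)
        + ((LINT r|lebesgue. ibp3' r * w r ^ 3) + (LINT r|lebesgue. ibp4' r * w r ^ 4)))"
    unfolding Bochner_Integration.integral_add[OF integrable_Hfg j] Bochner_Integration.integral_add[OF j2 j34]
      Bochner_Integration.integral_add[OF j3(1) j4(1)] integral_mult_right_zero ..
  finally show ?thesis using j3(2) j4(2) unfolding distrib_right by linarith
qed

text \<open>With D = G6 - int (H V)' w^2 the error is at most \<open>K6\<close> / 50 <= D / 5, so at
  least (1/2 - 1/5) D >= D / 4 of the dissipation remains, and D >= G6 / 271. Thus 1084 = 4 *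
  271.\<close>

lemma virial_static:
  assumes M: "M \<le> 1 / 1000"
  shows "- (1 / 2) * G6 - (LINT r|lebesgue. kink_H r * nonlin r (w r) * g r) \<le> - (1 / 1084) * G6"
proof -
  have "M\<^sup>2 \<le> 1 / 1000 * (1 / 1000)" unfolding power2_eq_square using M M_nonneg by (intro mult_mono) auto
  then have "13 * M + 5 / 2 * M\<^sup>2 \<le> 1 / 50" using M by simp
  then have "(13 * M + 5 / 2 * M\<^sup>2) * K6 \<le> 1 / 50 * K6" using K6_nonneg by (intro mult_right_mono)
  then show ?thesis using virial_ibp hardy_virial virial_coercive by argo
qed

end

section \<open>The evolution\<close>

lemma kappa'_bound: "\<bar>- (3 * r) / sig r ^ 10\<bar> \<le> 3"
proof -
  have "\<bar>- (3 * r) / sig r ^ 10\<bar> \<le> 3 / sig r ^ 8"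
    using div_sig_bound[of "- (3 * r)" 3 r 2 8] abs_le_sig[of r] by (simp add: abs_mult)
  also have "\<dots> \<le> 3" using sig_ge_1_power[of r 8] by (simp add: divide_le_eq)
  finally show ?thesis .
qed

lemma kappa_lipschitz:
  shows "((\<lambda>r. 1 / sig r ^ 6) has_real_derivative - (3 * r) / sig r ^ 10) (at r)"
    and "\<bar>1 / sig (r + h) ^ 6 - 1 / sig r ^ 6\<bar> \<le> 3 * \<bar>h\<bar>"
proof -
  have D: "((\<lambda>r. 1 / sig r ^ 6) has_real_derivative - (3 * r) / sig r ^ 10) (at r)" for r
  proof -
    have "((\<lambda>r. 1 / sig r ^ 6) has_real_derivative 0 / sig r ^ 6 - real 6 * 1 * r / (2 * sig r ^ (6 + 4))) (at r)"
      by (rule DERIV_div_sig) simp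
    then show ?thesis by (rule DERIV_cong) simp
  qed
  show "((\<lambda>r. 1 / sig r ^ 6) has_real_derivative - (3 * r) / sig r ^ 10) (at r)" by (rule D)
  have "norm (1 / sig (r + h) ^ 6 - 1 / sig r ^ 6) \<le> 3 * norm (r + h - r)"
    by (rule field_differentiable_bound[where S = UNIV and f' = "\<lambda>r. - (3 * r) / sig r ^ 10"])
      (use D kappa'_bound in auto)
  then show "\<bar>1 / sig (r + h) ^ 6 - 1 / sig r ^ 6\<bar> \<le> 3 * \<bar>h\<bar>" by simp
qed

lemma kappa_bound: "\<bar>1 / sig r ^ 6\<bar> \<le> 1"
  using inverse_sig_mono[of 0 6 r] sig_pos[of r] by simp

lemma kappa'_lipschitz: "\<bar>- (3 * (r + h)) / sig (r + h) ^ 10 - - (3 * r) / sig r ^ 10\<bar> \<le> 18 * \<bar>h\<bar>"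
proof -
  have D: "((\<lambda>r. - (3 * r) / sig r ^ 10) has_real_derivative - 3 / sig r ^ 10 - real 10 * (- (3 * r)) * r / (2 * sig r ^ (10 + 4))) (at r)" for r
    by (rule DERIV_div_sig) (auto intro!: derivative_eq_intros)
  have b: "\<bar>- 3 / sig r ^ 10 - real 10 * (- (3 * r)) * r / (2 * sig r ^ (10 + 4))\<bar> \<le> 18" for r
  proof -
    have "\<bar>3 / sig r ^ 10\<bar> \<le> 3" using sig_ge_1_power[of r 10] by (simp add: divide_le_eq abs_of_nonneg)
    moreover have "\<bar>15 * r\<^sup>2 / sig r ^ 14\<bar> \<le> 15 / sig r ^ 10"
      using div_sig_bound[of "15 * r\<^sup>2" 15 r 4 10] sq_le_sig[of r] by simp
    moreover have "15 / sig r ^ 10 \<le> 15" using sig_ge_1_power[of r 10] by (simp add: divide_le_eq)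
    moreover have "- 3 / sig r ^ 10 - real 10 * (- (3 * r)) * r / (2 * sig r ^ (10 + 4)) = 15 * r\<^sup>2 / sig r ^ 14 - 3 / sig r ^ 10"
      by (simp add: power2_eq_square)
    ultimately show ?thesis by linarith
  qed
  have "norm (- (3 * (r + h)) / sig (r + h) ^ 10 - - (3 * r) / sig r ^ 10) \<le> 18 * norm (r + h - r)"
    by (rule field_differentiable_bound[where S = UNIV and f = "\<lambda>r. - (3 * r) / sig r ^ 10", OF convex_UNIV D])
      (use b in auto)
  then show ?thesis by simp
qed

lemma eventually_within_nonneg: "\<forall>\<^sub>F s in at t within {0..}. (s::real) \<ge> 0"
  by (simp add: eventually_at_filter)

lemma L2_continuous_lin:
  assumes a: "L2_continuous a" and b: "L2_continuous b"
  shows "L2_continuous (\<lambda>s r. a s r + c * b s r)"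
  unfolding L2_continuous_def
proof (intro conjI allI impI)
  show i: "in_L2 (\<lambda>r. a t r + c * b t r)" if "t \<ge> 0" for t
    by (intro in_L2_add in_L2_cmult L2_continuous_in[OF a that] L2_continuous_in[OF b that])
  fix t :: real assume t: "t \<ge> 0"
  have lim: "((\<lambda>s. L2_norm_fun (\<lambda>r. a s r - a t r) + \<bar>c\<bar> * L2_norm_fun (\<lambda>r. b s r - b t r)) \<longlongrightarrow> 0) (at t within {0..})"
    using tendsto_add[OF L2_continuous_tendsto[OF a t] tendsto_mult_right_zero[OF L2_continuous_tendsto[OF b t], of "\<bar>c\<bar>"]] by simp
  show "((\<lambda>s. L2_norm_fun (\<lambda>r. a s r + c * b s r - (a t r + c * b t r))) \<longlongrightarrow> 0) (at t within {0..})"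
  proof (rule Lim_null_comparison[OF _ lim])
    show "\<forall>\<^sub>F s in at t within {0..}. norm (L2_norm_fun (\<lambda>r. a s r + c * b s r - (a t r + c * b t r)))
        \<le> L2_norm_fun (\<lambda>r. a s r - a t r) + \<bar>c\<bar> * L2_norm_fun (\<lambda>r. b s r - b t r)"
      using eventually_within_nonneg
    proof eventually_elim
      case (elim s)
      have "L2_norm_fun (\<lambda>r. (a s r - a t r) + c * (b s r - b t r))
          \<le> L2_norm_fun (\<lambda>r. a s r - a t r) + L2_norm_fun (\<lambda>r. c * (b s r - b t r))"
        by (intro L2_norm_triangle in_L2_cmult in_L2_diff L2_continuous_in[OF a] L2_continuous_in[OF b] elim t)
      then show ?case by (simp add: L2_norm_cmult[of c "\<lambda>r. b s r - b t r"] L2_norm_nonneg) (simp add: algebra_simps)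
    qed
  qed
qed

section \<open>The first-order system for w_t and w_r\<close>

text \<open>Here \<open>g\<close> is w_r and \<open>v\<close> is w_t, while w itself is recovered as
  the primitive of \<open>g\<close>. The equation for w_rr is stated with one derivative on the test
  function, the other being contained in \<open>g\<close>.\<close>

locale wave =
  fixes g v :: "real \<Rightarrow> real \<Rightarrow> real"
  assumes gc: "L2_continuous g" and vc: "L2_continuous v"
    and ww: "t \<ge> 0 \<Longrightarrow> in_L2 (\<lambda>r. primitive (g t) r / (sig r)\<^sup>2)"
    and wc: "t \<ge> 0 \<Longrightarrow>
      ((\<lambda>s. L2_norm_fun (\<lambda>r. (primitive (g s) r - primitive (g t) r) / (sig r)\<^sup>2)) \<longlongrightarrow> 0) (at t within {0..})"
    and dw: "test_function \<phi> \<Longrightarrow> t \<ge> 0 \<Longrightarrow>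
      ((\<lambda>s. LINT r|lebesgue. primitive (g s) r * \<phi> r) has_real_derivative (LINT r|lebesgue. v t r * \<phi> r)) (at t within {0..})"
    and dv: "test_function \<phi> \<Longrightarrow> t \<ge> 0 \<Longrightarrow>
      ((\<lambda>s. LINT r|lebesgue. v s r * \<phi> r) has_real_derivative
        - (LINT r|lebesgue. g t r * deriv \<phi> r) - (LINT r|lebesgue. nonlin r (primitive (g t) r) * \<phi> r)) (at t within {0..})"
begin

abbreviation "w t \<equiv> primitive (g t)"
abbreviation "M t \<equiv> L2_norm_fun (g t)"
definition "F t r = nonlin r (w t r)"
definition "P t = (LINT r|lebesgue. nonlin_pot r (w t r))"

lemma gi: "t \<ge> 0 \<Longrightarrow> in_L2 (g t)" and vi: "t \<ge> 0 \<Longrightarrow> in_L2 (v t)"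
  by (auto intro: L2_continuous_in gc vc)

lemma prof: "t \<ge> 0 \<Longrightarrow> profile (g t)"
  by unfold_locales (auto intro: gi ww)

lemma Fi: "t \<ge> 0 \<Longrightarrow> in_L2 (F t)"
  unfolding F_def[abs_def] by (rule profile.nonlin_in_L2(1)[OF prof])

lemma M_tendsto: assumes t: "t \<ge> 0" shows "(M \<longlongrightarrow> M t) (at t within {0..})"
proof -
  have "((\<lambda>s. M s - M t) \<longlongrightarrow> 0) (at t within {0..})"
  proof (rule Lim_null_comparison[OF _ L2_continuous_tendsto[OF gc t]])
    show "\<forall>\<^sub>F s in at t within {0..}. norm (M s - M t) \<le> L2_norm_fun (\<lambda>r. g s r - g t r)"
      using eventually_within_nonneg by eventually_elim (simp add: L2_norm_abs_diff gi t)
  qed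
  then show ?thesis by (simp add: LIM_zero_iff)
qed

lemma M_eventually: "t \<ge> 0 \<Longrightarrow> \<forall>\<^sub>F s in at t within {0..}. M s < M t + 1"
  by (rule order_tendstoD(2)[OF M_tendsto]) auto

lemma w_le: assumes "t \<ge> 0" "M t \<le> m" shows "\<bar>w t r\<bar> \<le> sig r * m"
  using profile.w_bound[OF prof[OF assms(1)], of r] mult_left_mono[OF assms(2), of "sig r"] sig_pos[of r] by linarith

text \<open>The force is Lipschitz on sets of bounded \<open>M\<close>, measured in the weighted
  norm of w in which the solution is continuous; \<open>M\<close> itself is locally bounded in time
  by continuity.\<close>

lemma Fc: "L2_continuous F"
  unfolding L2_continuous_def
proof (intro conjI allI impI Fi)
  fix t :: real assume t: "t \<ge> 0"
  define m where "m = M t + 1"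
  define C where "C = 4 + 12 * m + 6 * m\<^sup>2"
  have C: "C \<ge> 0" using L2_norm_nonneg[of "g t"] by (simp add: C_def m_def)
  have lim: "((\<lambda>s. C * L2_norm_fun (\<lambda>r. (w s r - w t r) / (sig r)\<^sup>2)) \<longlongrightarrow> 0) (at t within {0..})"
    by (rule tendsto_mult_right_zero[OF wc[OF t]])
  show "((\<lambda>s. L2_norm_fun (\<lambda>r. F s r - F t r)) \<longlongrightarrow> 0) (at t within {0..})"
  proof (rule Lim_null_comparison[OF _ lim])
    show "\<forall>\<^sub>F s in at t within {0..}. norm (L2_norm_fun (\<lambda>r. F s r - F t r))
        \<le> C * L2_norm_fun (\<lambda>r. (w s r - w t r) / (sig r)\<^sup>2)"
      using eventually_within_nonneg M_eventually[OF t]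
    proof eventually_elim
      case (elim s)
      have b: "\<bar>w s r\<bar> \<le> sig r * m" "\<bar>w t r\<bar> \<le> sig r * m" for r
        by (rule w_le; use elim t in \<open>simp add: m_def\<close>)+
      have "\<bar>F s r - F t r\<bar> \<le> \<bar>C * ((w s r - w t r) / (sig r)\<^sup>2)\<bar>" for r
      proof -
        have "\<bar>F s r - F t r\<bar> \<le> C * \<bar>w s r - w t r\<bar> * (1 / sig r ^ 4)"
          unfolding F_def C_def using nonlin_lipschitz[OF b] by simp
        also have "\<dots> \<le> C * \<bar>w s r - w t r\<bar> * (1 / sig r ^ 2)"
          using C by (intro mult_left_mono inverse_sig_mono) auto
        also have "\<dots> = \<bar>C * ((w s r - w t r) / (sig r)\<^sup>2)\<bar>" using C by (simp add: abs_mult)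
        finally show ?thesis .
      qed
      then have le: "AE r in lebesgue. \<bar>F s r - F t r\<bar> \<le> \<bar>C * ((w s r - w t r) / (sig r)\<^sup>2)\<bar>" by simp
      have i: "in_L2 (\<lambda>r. (w s r - w t r) / (sig r)\<^sup>2)"
        using in_L2_diff[OF ww[OF elim(1)] ww[OF t]] by (simp add: diff_divide_distrib)
      have "L2_norm_fun (\<lambda>r. F s r - F t r) \<le> L2_norm_fun (\<lambda>r. C * ((w s r - w t r) / (sig r)\<^sup>2))"
        by (rule in_L2_dominated(2)[OF in_L2_cmult[OF i] in_L2_measurable[OF in_L2_diff[OF Fi[OF elim(1)] Fi[OF t]]] le])
      also have "\<dots> = \<bar>C\<bar> * L2_norm_fun (\<lambda>r. (w s r - w t r) / (sig r)\<^sup>2)" by (rule L2_norm_cmult)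
      finally show ?case using C by (simp add: L2_norm_nonneg)
    qed
  qed
qed

text \<open>The compatibility relation g_t = v_r: both derivatives are passed to the test function,
  where they commute.\<close>

lemma dg:
  assumes \<phi>: "test_function \<phi>" and t: "t \<ge> 0"
  shows "((\<lambda>s. LINT r|lebesgue. g s r * \<phi> r) has_real_derivative - (LINT r|lebesgue. v t r * deriv \<phi> r)) (at t within {0..})"
proof -
  have eq: "(LINT r|lebesgue. g s r * \<phi> r) = - (LINT r|lebesgue. w s r * deriv \<phi> r)" if "s \<ge> 0" for s
    using ac_weak_deriv[OF profile.w_ac[OF prof[OF that]]] \<phi> by (simp add: has_weak_deriv_def)
  have "((\<lambda>s. - (LINT r|lebesgue. w s r * deriv \<phi> r)) has_real_derivative - (LINT r|lebesgue. v t r * deriv \<phi> r)) (at t within {0..})"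
    by (rule DERIV_minus[OF dw[OF test_function_deriv[OF \<phi>] t]])
  then show ?thesis
    by (rule has_field_derivative_transform_within[OF _ zero_less_one]) (use t eq in auto)
qed

text \<open>In one space dimension the wave equation diagonalises into the two transport equations for \<open>v \<plusminus> g\<close>.\<close>

lemma characteristic:
  assumes c: "c = 1 \<or> c = - 1"
    and k: "\<And>r. (k has_real_derivative k' r) (at r)" "continuous_on UNIV k'"
    and kb: "\<And>r. \<bar>k r\<bar> \<le> C" "\<And>r. \<bar>k' r\<bar> \<le> C" "\<And>r h. \<bar>k' (r + h) - k' r\<bar> \<le> C * \<bar>h\<bar>"
    and t: "t \<ge> 0"
  shows "((\<lambda>s. LINT r|lebesgue. k r * (v s r + c * g s r)\<^sup>2) has_real_derivative
      - c * (LINT r|lebesgue. k' r * (v t r + c * g t r)\<^sup>2)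
      - 2 * (LINT r|lebesgue. k r * F t r * (v t r + c * g t r))) (at t within {0..})"
proof (rule transport_energy[where C = C, OF L2_continuous_lin[OF vc gc] Fc _ _ k kb t])
  show "\<bar>c\<bar> \<le> 1" using c by auto
  fix \<phi> and t :: real assume \<phi>: "test_function \<phi>" and t: "t \<ge> 0"
  note p = in_L2_test_function[OF \<phi>] and p' = in_L2_test_function[OF test_function_deriv[OF \<phi>]]
  have D0: "((\<lambda>s. (LINT r|lebesgue. v s r * \<phi> r) + c * (LINT r|lebesgue. g s r * \<phi> r)) has_real_derivative
      (- (LINT r|lebesgue. g t r * deriv \<phi> r) - (LINT r|lebesgue. F t r * \<phi> r)) + c * - (LINT r|lebesgue. v t r * deriv \<phi> r)) (at t within {0..})"
    unfolding F_def by (intro DERIV_add DERIV_cmult dv dg \<phi> t)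
  have split: "(LINT r|lebesgue. (v s r + c * g s r) * q r) = (LINT r|lebesgue. v s r * q r) + c * (LINT r|lebesgue. g s r * q r)"
    if "s \<ge> 0" "in_L2 q" for s q
  proof -
    have "(LINT r|lebesgue. (v s r + c * g s r) * q r) = (LINT r|lebesgue. v s r * q r + c * (g s r * q r))"
      by (simp add: algebra_simps)
    then show ?thesis using that by (simp add: L2_mult_integrable vi gi)
  qed
  have eqc: "(- (LINT r|lebesgue. g t r * deriv \<phi> r) - (LINT r|lebesgue. F t r * \<phi> r)) + c * - (LINT r|lebesgue. v t r * deriv \<phi> r)
      = - c * (LINT r|lebesgue. (v t r + c * g t r) * deriv \<phi> r) - (LINT r|lebesgue. F t r * \<phi> r)"
    using c unfolding split[OF t p'] by auto
  note D = DERIV_cong[OF D0 eqc]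
  show "((\<lambda>s. LINT r|lebesgue. (v s r + c * g s r) * \<phi> r) has_real_derivative
      - c * (LINT r|lebesgue. (v t r + c * g t r) * deriv \<phi> r) - (LINT r|lebesgue. F t r * \<phi> r)) (at t within {0..})"
    by (rule has_field_derivative_transform_within[OF D zero_less_one]) (use t split p in auto)
qed

text \<open>Polarisation of the two characteristic identities: half of the sum of (v + g)^2 and (v -
  g)^2 is v^2 + g^2, and a quarter of their difference is v g.\<close>

lemma quadratic_derivs:
  assumes k: "\<And>r. (k has_real_derivative k' r) (at r)" "continuous_on UNIV k'"
    and kb: "\<And>r. \<bar>k r\<bar> \<le> C" "\<And>r. \<bar>k' r\<bar> \<le> C" "\<And>r h. \<bar>k' (r + h) - k' r\<bar> \<le> C * \<bar>h\<bar>"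
    and t: "t \<ge> 0"
  shows "((\<lambda>s. (LINT r|lebesgue. k r * (v s r)\<^sup>2) + (LINT r|lebesgue. k r * (g s r)\<^sup>2)) has_real_derivative
      - 2 * (LINT r|lebesgue. k' r * v t r * g t r) - 2 * (LINT r|lebesgue. k r * F t r * v t r)) (at t within {0..})" (is ?A)
    and "((\<lambda>s. LINT r|lebesgue. k r * v s r * g s r) has_real_derivative
      - (1 / 2) * ((LINT r|lebesgue. k' r * (v t r)\<^sup>2) + (LINT r|lebesgue. k' r * (g t r)\<^sup>2))
      - (LINT r|lebesgue. k r * F t r * g t r)) (at t within {0..})" (is ?B)
proof -
  have kc: "continuous_on UNIV k" by (meson DERIV_isCont continuous_at_imp_continuous_on k(1))
  note km = borel_measurable_lebesgue_continuous[OF kc] and k'm = borel_measurable_lebesgue_continuous[OF k(2)]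
  have i: "integrable lebesgue (\<lambda>r. k r * a r * b r)" "integrable lebesgue (\<lambda>r. k' r * a r * b r)"
    if "in_L2 a" "in_L2 b" for a b
    by (intro L2_mult_integrable in_L2_bounded_mult(1)[OF that(1) km kb(1)] in_L2_bounded_mult(1)[OF that(1) k'm kb(2)] that(2))+
  have sq: "(LINT r|lebesgue. j r * (v s r + c * g s r)\<^sup>2) = (LINT r|lebesgue. j r * (v s r)\<^sup>2)
      + c\<^sup>2 * (LINT r|lebesgue. j r * (g s r)\<^sup>2) + 2 * c * (LINT r|lebesgue. j r * v s r * g s r)"
    if "s \<ge> 0" and j: "\<And>a b. in_L2 a \<Longrightarrow> in_L2 b \<Longrightarrow> integrable lebesgue (\<lambda>r. j r * a r * b r)" for s c j
  proof -
    have "(LINT r|lebesgue. j r * (v s r + c * g s r)\<^sup>2) = (LINT r|lebesgue. j r * v s r * v s r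
        + c\<^sup>2 * (j r * g s r * g s r) + 2 * c * (j r * v s r * g s r))"
      by (intro Bochner_Integration.integral_cong refl) (simp add: algebra_simps power2_eq_square)
    also have "\<dots> = (LINT r|lebesgue. j r * v s r * v s r) + c\<^sup>2 * (LINT r|lebesgue. j r * g s r * g s r)
        + 2 * c * (LINT r|lebesgue. j r * v s r * g s r)"
      using j[OF vi[OF that(1)] vi[OF that(1)]] j[OF gi[OF that(1)] gi[OF that(1)]] j[OF vi[OF that(1)] gi[OF that(1)]]
      by simp
    finally show ?thesis by (simp add: power2_eq_square mult.assoc)
  qed
  have lin: "(LINT r|lebesgue. k r * F t r * (v t r + c * g t r)) = (LINT r|lebesgue. k r * F t r * v t r)
      + c * (LINT r|lebesgue. k r * F t r * g t r)" for c
  proof -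
    have "(LINT r|lebesgue. k r * F t r * (v t r + c * g t r)) = (LINT r|lebesgue. k r * F t r * v t r + c * (k r * F t r * g t r))"
      by (simp add: algebra_simps)
    then show ?thesis using i(1)[OF Fi[OF t] vi[OF t]] i(1)[OF Fi[OF t] gi[OF t]] by simp
  qed
  note ch = characteristic[OF _ k kb t]
  have 1: "(1::real) = 1 \<or> (1::real) = - 1" and 2: "(- 1::real) = 1 \<or> (- 1::real) = - 1" by auto
  note D1 = ch[OF 1] and D2 = ch[OF 2]
  have sq': "(LINT r|lebesgue. k' r * (v t r + c * g t r)\<^sup>2) = (LINT r|lebesgue. k' r * (v t r)\<^sup>2)
      + c\<^sup>2 * (LINT r|lebesgue. k' r * (g t r)\<^sup>2) + 2 * c * (LINT r|lebesgue. k' r * v t r * g t r)" for c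
    by (rule sq[OF t i(2)])
  have sqk: "(LINT r|lebesgue. k r * (v s r + c * g s r)\<^sup>2) = (LINT r|lebesgue. k r * (v s r)\<^sup>2)
      + c\<^sup>2 * (LINT r|lebesgue. k r * (g s r)\<^sup>2) + 2 * c * (LINT r|lebesgue. k r * v s r * g s r)" if "s \<ge> 0" for s c
    by (rule sq[OF that i(1)])
  have DA: "((\<lambda>s. 1 / 2 * ((LINT r|lebesgue. k r * (v s r + 1 * g s r)\<^sup>2) + (LINT r|lebesgue. k r * (v s r + - 1 * g s r)\<^sup>2)))
      has_real_derivative - 2 * (LINT r|lebesgue. k' r * v t r * g t r) - 2 * (LINT r|lebesgue. k r * F t r * v t r)) (at t within {0..})"
    by (rule DERIV_cong[OF DERIV_cmult[OF DERIV_add[OF D1 D2]]], unfold sq' lin) (simp add: algebra_simps)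
  have DB: "((\<lambda>s. 1 / 4 * ((LINT r|lebesgue. k r * (v s r + 1 * g s r)\<^sup>2) - (LINT r|lebesgue. k r * (v s r + - 1 * g s r)\<^sup>2)))
      has_real_derivative - (1 / 2) * ((LINT r|lebesgue. k' r * (v t r)\<^sup>2) + (LINT r|lebesgue. k' r * (g t r)\<^sup>2))
      - (LINT r|lebesgue. k r * F t r * g t r)) (at t within {0..})"
    by (rule DERIV_cong[OF DERIV_cmult[OF DERIV_diff[OF D1 D2]]], unfold sq' lin) (simp add: field_simps)
  have t0: "t \<in> {0..}" using t by simp
  have eA: "1 / 2 * ((LINT r|lebesgue. k r * (v s r + 1 * g s r)\<^sup>2) + (LINT r|lebesgue. k r * (v s r + - 1 * g s r)\<^sup>2))
      = (LINT r|lebesgue. k r * (v s r)\<^sup>2) + (LINT r|lebesgue. k r * (g s r)\<^sup>2)" if "s \<in> {0..}" for s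
    unfolding sqk[of s, OF that[unfolded atLeast_iff]] by simp
  have eB: "1 / 4 * ((LINT r|lebesgue. k r * (v s r + 1 * g s r)\<^sup>2) - (LINT r|lebesgue. k r * (v s r + - 1 * g s r)\<^sup>2))
      = (LINT r|lebesgue. k r * v s r * g s r)" if "s \<in> {0..}" for s
    unfolding sqk[of s, OF that[unfolded atLeast_iff]] by simp
  show ?A by (rule has_field_derivative_transform_within[OF DA zero_less_one t0 eA])
  show ?B by (rule has_field_derivative_transform_within[OF DB zero_less_one t0 eB])
qed

lemma w_locally_L2: assumes t: "t \<ge> 0" shows "locally_L2 (w t)"
  unfolding locally_L2_def
proof (intro conjI allI)
  show m: "w t \<in> borel_measurable lebesgue" by (rule profile.w_measurable[OF prof[OF t]])
  fix R :: real
  have c: "compact (w t ` {-R..R})"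
    by (intro compact_continuous_image ac_deriv_continuous[OF profile.w_ac[OF prof[OF t]]]) simp
  from compact_imp_bounded[OF c] obtain B where "\<forall>x\<in>w t ` {-R..R}. norm x \<le> B" unfolding bounded_iff by blast
  then have B: "\<bar>w t r\<bar> \<le> B" if "r \<in> {-R..R}" for r using that by auto
  show "in_L2 (\<lambda>r. indicator {-R..R} r * w t r)"
  proof (rule in_L2_bounded_support[where C = "max B 0" and M = R])
    show "(\<lambda>r. indicator {-R..R} r * w t r) \<in> borel_measurable lebesgue"
      by (intro borel_measurable_times measurable_lebesgue_indicator m)
    show "\<bar>indicator {-R..R} r * w t r\<bar> \<le> max B 0" for r
      using B[of r] by (auto simp: indicator_def)
  qed (auto simp: indicator_def)
qed

section \<open>The potential energy and conservation of energy\<close>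

text \<open>A chain rule in which w need not belong to L^2: the increments of w do, by
  \<open>strong_derivative\<close>, the force lies in L^2 as well, and the second-order remainder of
  the potential is bounded by the squared norm of the increment.\<close>

lemma P_deriv:
  assumes t: "t \<ge> 0"
  shows "(P has_real_derivative (LINT r|lebesgue. F t r * v t r)) (at t within {0..})"
proof -
  define \<omega> where "\<omega> s r = w s r - w t r - (s - t) * v t r" for s r
  define e where "e s = L2_norm_fun (\<omega> s) / \<bar>s - t\<bar>" for s
  define m where "m = M t + 1"
  define C where "C = 2 + 6 * m + 3 * m\<^sup>2"
  have C: "C \<ge> 0" using L2_norm_nonneg[of "g t"] by (simp add: C_def m_def)
  have str: "\<forall>\<^sub>F s in at t within {0..}. in_L2 (\<omega> s) \<and> L2_norm_fun (\<omega> s) \<le> d * \<bar>s - t\<bar>" if "d > 0" for d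
    using strong_derivative[OF w_locally_L2 vc dw t that] unfolding \<omega>_def[abs_def] .
  have ne: "\<forall>\<^sub>F s in at t within {0..}. s \<noteq> t" by (simp add: eventually_at_filter)
  have e0: "(e \<longlongrightarrow> 0) (at t within {0..})"
  proof (rule tendstoI)
    fix d :: real assume d: "d > 0"
    have "\<forall>\<^sub>F s in at t within {0..}. in_L2 (\<omega> s) \<and> L2_norm_fun (\<omega> s) \<le> d / 2 * \<bar>s - t\<bar>" by (rule str) (use d in simp)
    then show "\<forall>\<^sub>F s in at t within {0..}. dist (e s) 0 < d"
      using ne
    proof eventually_elim
      case (elim s)
      then have "L2_norm_fun (\<omega> s) < d * \<bar>s - t\<bar>"
        using d by (intro le_less_trans[OF conjunct2[OF elim(1)]] mult_strict_right_mono) auto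
      with elim(2) show ?case by (simp add: e_def L2_norm_nonneg divide_less_eq)
    qed
  qed
  let ?E = "\<lambda>s. C * ((e s + L2_norm_fun (v t))\<^sup>2 * \<bar>s - t\<bar>) + L2_norm_fun (F t) * e s"
  have lim: "(?E \<longlongrightarrow> 0) (at t within {0..})"
    by (rule tendsto_eq_intros e0 refl)+ simp
  show ?thesis
  proof (rule has_real_derivative_within_eps[OF lim])
    have "\<forall>\<^sub>F s in at t within {0..}. in_L2 (\<omega> s)" using str[of 1] by (auto elim: eventually_mono)
    then show "\<forall>\<^sub>F s in at t within {0..}. \<bar>P s - P t - (s - t) * (LINT r|lebesgue. F t r * v t r)\<bar> \<le> ?E s * \<bar>s - t\<bar>"
      using ne eventually_within_nonneg M_eventually[OF t]
    proof eventually_elim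
      case (elim s)
      note \<omega> = elim(1) and s = elim(3)
      have b: "\<bar>w s r\<bar> \<le> sig r * m" "\<bar>w t r\<bar> \<le> sig r * m" for r
        by (rule w_le; use elim t in \<open>simp add: m_def\<close>)+
      have \<omega>n: "L2_norm_fun (\<omega> s) = e s * \<bar>s - t\<bar>" using elim(2) by (simp add: e_def)
      define \<delta> where "\<delta> r = w s r - w t r" for r
      have \<delta>: "\<delta> = (\<lambda>r. \<omega> s r + (s - t) * v t r)" by (simp add: \<delta>_def \<omega>_def fun_eq_iff)
      have \<delta>i: "in_L2 \<delta>" unfolding \<delta> by (intro in_L2_add in_L2_cmult \<omega> vi t)
      have "L2_norm_fun \<delta> \<le> L2_norm_fun (\<omega> s) + L2_norm_fun (\<lambda>r. (s - t) * v t r)"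
        unfolding \<delta> by (intro L2_norm_triangle in_L2_cmult \<omega> vi t)
      also have "\<dots> = (e s + L2_norm_fun (v t)) * \<bar>s - t\<bar>"
        by (simp add: \<omega>n L2_norm_cmult distrib_right)
      finally have \<delta>n: "L2_norm_fun \<delta> \<le> (e s + L2_norm_fun (v t)) * \<bar>s - t\<bar>" .
      note Fd = L2_mult_integrable[OF Fi[OF t] \<delta>i]
      note pots = profile.pot_parts(1)[OF prof[OF s]] profile.pot_parts(1)[OF prof[OF t]]
      have "P s - P t - (LINT r|lebesgue. F t r * \<delta> r) = (LINT r|lebesgue. nonlin_pot r (w s r) - nonlin_pot r (w t r) - F t r * \<delta> r)"
        unfolding P_def using pots Fd by simp
      also have "\<bar>\<dots>\<bar> \<le> (LINT r|lebesgue. C * (\<delta> r)\<^sup>2)"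
        unfolding real_norm_def[symmetric]
      proof (rule Bochner_Integration.integral_norm_bound_integral)
        show "integrable lebesgue (\<lambda>r. nonlin_pot r (w s r) - nonlin_pot r (w t r) - F t r * \<delta> r)" using pots Fd by simp
        show "integrable lebesgue (\<lambda>r. C * (\<delta> r)\<^sup>2)" by (intro integrable_mult_right in_L2_integrable_sq \<delta>i)
        fix r
        have "\<bar>nonlin_pot r (w s r) - nonlin_pot r (w t r) - F t r * \<delta> r\<bar> \<le> C * (\<delta> r)\<^sup>2 * (1 / sig r ^ 4)"
          using nonlin_pot_taylor[OF b] by (simp add: C_def F_def \<delta>_def)
        also have "\<dots> \<le> C * (\<delta> r)\<^sup>2 * (1 / sig r ^ 0)" using C by (intro mult_left_mono inverse_sig_mono) auto
        finally show "norm (nonlin_pot r (w s r) - nonlin_pot r (w t r) - F t r * \<delta> r) \<le> C * (\<delta> r)\<^sup>2" by simp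
      qed
      also have "(LINT r|lebesgue. C * (\<delta> r)\<^sup>2) = C * (L2_norm_fun \<delta>)\<^sup>2" by (simp add: L2_norm_sq)
      also have "\<dots> \<le> C * ((e s + L2_norm_fun (v t)) * \<bar>s - t\<bar>)\<^sup>2"
        by (intro mult_left_mono power_mono \<delta>n L2_norm_nonneg C)
      finally have 1: "\<bar>P s - P t - (LINT r|lebesgue. F t r * \<delta> r)\<bar> \<le> C * ((e s + L2_norm_fun (v t)) * \<bar>s - t\<bar>)\<^sup>2" .
      have "(LINT r|lebesgue. F t r * \<delta> r) = (LINT r|lebesgue. F t r * \<omega> s r + (s - t) * (F t r * v t r))"
        unfolding \<delta> by (simp add: algebra_simps)
      also have "\<dots> = (LINT r|lebesgue. F t r * \<omega> s r) + (s - t) * (LINT r|lebesgue. F t r * v t r)"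
        by (simp add: L2_mult_integrable Fi t \<omega> vi)
      finally have "(LINT r|lebesgue. F t r * \<delta> r) - (s - t) * (LINT r|lebesgue. F t r * v t r) = (LINT r|lebesgue. F t r * \<omega> s r)" by simp
      moreover have "\<bar>LINT r|lebesgue. F t r * \<omega> s r\<bar> \<le> L2_norm_fun (F t) * (e s * \<bar>s - t\<bar>)"
        unfolding \<omega>n[symmetric] by (rule L2_Cauchy_Schwarz[OF Fi[OF t] \<omega>])
      ultimately have "\<bar>P s - P t - (s - t) * (LINT r|lebesgue. F t r * v t r)\<bar>
          \<le> C * ((e s + L2_norm_fun (v t)) * \<bar>s - t\<bar>)\<^sup>2 + L2_norm_fun (F t) * (e s * \<bar>s - t\<bar>)"
        using 1 by linarith
      moreover have "C * (A * d)\<^sup>2 + N * (x * d) = (C * (A\<^sup>2 * d) + N * x) * d" for A N x d :: real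
        by (simp add: power2_eq_square algebra_simps)
      ultimately show ?case by (simp only:)
    qed
  qed
qed

definition "En t = 1 / 2 * ((L2_norm_fun (v t))\<^sup>2 + (M t)\<^sup>2) + P t"

lemma energy_conserved: assumes t: "t \<ge> 0" shows "En t = En 0"
proof -
  have "(En has_real_derivative 0) (at s within {0..})" if s: "s \<ge> 0" for s
  proof -
    \<comment> \<open>With constant weight the flux term vanishes, and the remaining work of the
      force is cancelled by \<open>P_deriv\<close>.\<close>
    have "((\<lambda>s. (LINT r|lebesgue. 1 * (v s r)\<^sup>2) + (LINT r|lebesgue. 1 * (g s r)\<^sup>2)) has_real_derivative
        - 2 * (LINT r|lebesgue. 0 * v s r * g s r) - 2 * (LINT r|lebesgue. 1 * F s r * v s r)) (at s within {0..})"
      by (rule quadratic_derivs(1)[where C = 1, OF _ _ _ _ _ s]) auto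
    then have "((\<lambda>s. (L2_norm_fun (v s))\<^sup>2 + (M s)\<^sup>2) has_real_derivative - 2 * (LINT r|lebesgue. F s r * v s r)) (at s within {0..})"
      by (simp add: L2_norm_sq)
    from DERIV_add[OF DERIV_cmult[OF this, of "1 / 2"] P_deriv[OF s]]
    show ?thesis unfolding En_def[abs_def] by simp
  qed
  then obtain c where "\<forall>s\<in>{0..}. En s = c"
    using has_field_derivative_zero_constant[of "{0..}" En] convex_real_interval(1) by auto
  then show ?thesis using t by auto
qed

end

section \<open>Decay\<close>

text \<open>\<open>J\<close> decreases to a finite infimum, so its drop over a time step of fixed
  length tends to 0. If \<open>A t\<close> is not small, the Lipschitz bound keeps it large during
  the whole step and the drop would be too big.\<close>

lemma decay_to_zero:
  fixes J A :: "real \<Rightarrow> real"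
  assumes J: "\<And>t. t \<ge> 0 \<Longrightarrow> (J has_real_derivative J' t) (at t within {0..})"
    and le: "\<And>t. t \<ge> 0 \<Longrightarrow> J' t \<le> - c * A t" and c: "c > 0"
    and lip: "\<And>s t. s \<ge> 0 \<Longrightarrow> t \<ge> 0 \<Longrightarrow> \<bar>A s - A t\<bar> \<le> L * \<bar>s - t\<bar>"
    and A: "\<And>t. t \<ge> 0 \<Longrightarrow> 0 \<le> A t" and bdd: "\<And>t. t \<ge> 0 \<Longrightarrow> - B \<le> J t"
  shows "(A \<longlongrightarrow> 0) at_top"
proof -
  have L: "L \<ge> 0" using lip[of 1 0] by simp
  have D: "(J has_real_derivative J' t) (at t)" if "t > 0" for t
    using J[of t] that at_within_interior[of t "{0..}"] by simp
  have drop: "J (t + h) - J t \<le> - c * h * (A t - L * h)" if t: "t > 0" and h: "h > 0" for t h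
  proof -
    \<comment> \<open>On the step from t to t + h the function A stays above A t - L h, so adding
      this linear term still leaves a nonincreasing function.\<close>
    let ?K = "\<lambda>s. J s + c * (A t - L * h) * s"
    have "?K (t + h) \<le> ?K t"
    proof (rule DERIV_nonpos_imp_nonincreasing[of t "t + h" ?K])
      fix s assume s: "t \<le> s" "s \<le> t + h"
      have "(?K has_real_derivative J' s + c * (A t - L * h)) (at s)"
        using D[of s] s t by (auto intro!: derivative_eq_intros)
      moreover have "J' s + c * (A t - L * h) \<le> 0"
      proof -
        have "L * \<bar>s - t\<bar> \<le> L * h" using s L by (intro mult_left_mono) auto
        then have "A t - L * h \<le> A s" using lip[of s t] s t by auto
        then have "c * (A t - L * h) \<le> c * A s" using c by simp
        then show ?thesis using le[of s] s t by simp
      qed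
      ultimately show "\<exists>y. (?K has_real_derivative y) (at s) \<and> y \<le> 0" by blast
    qed (use h in simp)
    then show ?thesis by (simp add: algebra_simps)
  qed
  have anti: "J t \<le> J s" if "0 < s" "s \<le> t" for s t
  proof (rule DERIV_nonpos_imp_nonincreasing[OF that(2)])
    fix x assume x: "s \<le> x" "x \<le> t"
    have "0 \<le> c * A x" using c A[of x] x that by simp
    then show "\<exists>y. (J has_real_derivative y) (at x) \<and> y \<le> 0"
      using D[of x] le[of x] x that by (intro exI[of _ "J' x"]) auto
  qed
  \<comment> \<open>Two-sided derivatives of J, and hence the monotonicity, are available for
    positive times only; starting at 1 avoids the endpoint.\<close>
  define l where "l = Inf (J ` {1..})"
  have bb: "bdd_below (J ` {1..})" by (rule bdd_belowI[of _ "- B"]) (auto intro: bdd)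
  have lb: "l \<le> J t" if "t \<ge> 1" for t unfolding l_def by (rule cInf_lower[OF _ bb]) (use that in auto)
  show ?thesis
  proof (rule tendstoI)
    fix e :: real assume e: "e > 0"
    define h where "h = e / (2 * (L + 1))"
    have h: "h > 0" using e L by (simp add: h_def)
    have "L * h \<le> (L + 1) * h" using h by simp
    moreover have "x * (e / (2 * x)) = e / 2" if "x \<noteq> 0" for x by (use that in simp)
    from this[of "L + 1"] have "(L + 1) * h = e / 2" using L by (simp add: h_def)
    ultimately have Lh: "L * h \<le> e / 2" by simp
    \<comment> \<open>Once J is within this distance of its infimum, a step of length h allows A t -
      L h < e/2 only, and L h <= e/2 by the choice of h.\<close>
    define e' where "e' = c * h * (e / 2)"
    have e': "e' > 0" using c h e by (simp add: e'_def)
    have "\<exists>x\<in>J ` {1..}. x < l + e'" using cInf_lessD[of "J ` {1..}" "l + e'"] e' by (force simp: l_def)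
    then obtain T where T: "T \<ge> 1" "J T < l + e'" by auto
    have "dist (A t) 0 < e" if t: "t \<ge> T" for t
    proof -
      have "J t < l + e'" using anti[of T t] T t by auto
      moreover have "l \<le> J (t + h)" by (rule lb) (use T t h in auto)
      moreover have "J (t + h) - J t \<le> - c * h * (A t - L * h)" by (rule drop) (use T t h in auto)
      ultimately have "c * h * (A t - L * h) < c * h * (e / 2)" unfolding e'_def by linarith
      then have "A t - L * h < e / 2" using c h by (simp add: mult_less_cancel_left_pos)
      then show ?thesis using Lh A[of t] T t by (simp add: dist_real_def)
    qed
    then show "\<forall>\<^sub>F t in at_top. dist (A t) 0 < e"
      unfolding eventually_at_top_linorder by blast
  qed
qed

lemma sig_mono: "\<bar>r\<bar> \<le> R \<Longrightarrow> sig r \<le> sig R"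
proof -
  assume "\<bar>r\<bar> \<le> R"
  then have "r\<^sup>2 \<le> R\<^sup>2" using abs_le_square_iff[of r R] by simp
  then show ?thesis unfolding sig_def using one_add_sq_pos[of r] by (intro powr_mono2) auto
qed

section \<open>Small data: global smallness and decay\<close>

locale small_wave = wave +
  assumes small: "L2_norm_fun (g 0) < 1 / 100000" "L2_norm_fun (v 0) < 1 / 100000"
    "L2_norm_fun (\<lambda>r. primitive (g 0) r / (sig r)\<^sup>2) < 1 / 100000"
begin

abbreviation "Q t \<equiv> profile.Q (g t)"
abbreviation "\<delta> \<equiv> (1 / 100000 :: real)"

text \<open>The kinetic and gradient parts contribute one, the potential five.\<close>

lemma En_0_le: "En 0 \<le> 6 * \<delta>\<^sup>2"
proof -
  have "(L2_norm_fun (v 0))\<^sup>2 \<le> \<delta>\<^sup>2" "(M 0)\<^sup>2 \<le> \<delta>\<^sup>2"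
    using small by (auto intro!: power_mono L2_norm_nonneg)
  moreover have "Q 0 \<le> \<delta>\<^sup>2"
    unfolding profile.norm_weighted[OF prof[of 0], symmetric, OF order_refl]
    using small(3) by (intro power_mono L2_norm_nonneg) auto
  moreover have "P 0 \<le> 5 * Q 0"
    unfolding P_def by (rule profile.energy_upper[OF prof]) (use small in auto)
  ultimately show ?thesis unfolding En_def by argo
qed

lemma En_lower:
  assumes t: "t \<ge> 0" and M: "M t \<le> 1 / 8"
  shows "1 / 2 * (L2_norm_fun (v t))\<^sup>2 + (M t)\<^sup>2 / 6 \<le> 6 * \<delta>\<^sup>2" "1 / 2 * (L2_norm_fun (v t))\<^sup>2 + Q t / 2 \<le> 6 * \<delta>\<^sup>2"
  using profile.energy_lower[OF prof[OF t] M] En_0_le energy_conserved[OF t]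
  unfolding En_def P_def by argo+

lemma M_small_step: assumes t: "t \<ge> 0" and M: "M t \<le> 1 / 8" shows "M t \<le> 6 * \<delta>"
proof -
  have "0 \<le> (L2_norm_fun (v t))\<^sup>2" by simp
  then have "(M t)\<^sup>2 / 6 \<le> 6 * \<delta>\<^sup>2" using En_lower(1)[OF t M] by argo
  then have "(M t)\<^sup>2 \<le> (6 * \<delta>)\<^sup>2" unfolding power_mult_distrib by simp
  then show ?thesis by (rule power2_le_imp_le) simp
qed

text \<open>A continuity argument: energy conservation excludes values of \<open>M\<close> between 6
  \<delta> and 1/8, and a continuous function that starts below this gap cannot jump across
  it.\<close>

lemma M_small: assumes t: "t \<ge> 0" shows "M t \<le> 6 * \<delta>"
proof (rule ccontr)
  assume "\<not> M t \<le> 6 * \<delta>"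
  then have *: "6 * \<delta> < M t" by simp
  \<comment> \<open>A value inside the forbidden gap that would have to be attained before time
    t.\<close>
  define y where "y = min (M t) (1 / 8)"
  have y: "6 * \<delta> < y" "y \<le> M t" "y \<le> 1 / 8" using * by (auto simp: y_def)
  have c: "continuous_on {0..t} M"
    unfolding continuous_on_def
  proof
    fix x assume "x \<in> {0..t}"
    then show "(M \<longlongrightarrow> M x) (at x within {0..t})"
      using M_tendsto[of x] by (auto intro: tendsto_within_subset)
  qed
  have "\<exists>s. 0 \<le> s \<and> s \<le> t \<and> M s = y"
    by (rule IVT'[OF _ y(2) t c]) (use small(1) y(1) in auto)
  then obtain s where s: "0 \<le> s" "M s = y" by blast
  then have "y \<le> 6 * \<delta>" using M_small_step[of s] y(3) by auto
  then show False using y(1) by simp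
qed

lemma v_small: assumes t: "t \<ge> 0" shows "L2_norm_fun (v t) \<le> 1" and "Q t \<le> 1"
proof -
  have M: "M t \<le> 1 / 8" using M_small[OF t] by simp
  have "0 \<le> (M t)\<^sup>2" "0 \<le> (L2_norm_fun (v t))\<^sup>2" by simp_all
  then have a: "1 / 2 * (L2_norm_fun (v t))\<^sup>2 \<le> 6 * \<delta>\<^sup>2" "Q t / 2 \<le> 6 * \<delta>\<^sup>2"
    using En_lower[OF t M] by argo+
  then have "(L2_norm_fun (v t))\<^sup>2 \<le> 1\<^sup>2" by (simp add: power_divide)
  then show "L2_norm_fun (v t) \<le> 1" by (rule power2_le_imp_le) simp
  show "Q t \<le> 1" using a(2) by (simp add: power_divide)
qed

definition "A t = (LINT r|lebesgue. 1 / sig r ^ 6 * (v t r)\<^sup>2) + (LINT r|lebesgue. 1 / sig r ^ 6 * (g t r)\<^sup>2)"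

lemma kappa_continuous: "continuous_on S (\<lambda>r. 1 / sig r ^ 6)" "continuous_on S (\<lambda>r. - (3 * r) / sig r ^ 10)"
  by (intro continuous_div_sig continuous_intros)+

text \<open>The constant 50 is 2 * 3 + 2 * 22: the first from |H''| <= 3, the second from the bound
  4 + 12 + 6 for the norm of the force.\<close>

lemma A_deriv:
  assumes t: "t \<ge> 0"
  shows "\<exists>D. (A has_real_derivative D) (at t within {0..}) \<and> \<bar>D\<bar> \<le> 50"
proof -
  let ?k = "\<lambda>r. 1 / sig r ^ 6" and ?k' = "\<lambda>r. - (3 * r) / sig r ^ 10"
  have "(A has_real_derivative - 2 * (LINT r|lebesgue. ?k' r * v t r * g t r) - 2 * (LINT r|lebesgue. ?k r * F t r * v t r))
      (at t within {0..})"
    unfolding A_def[abs_def]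
  proof (rule quadratic_derivs(1)[where C = 18, OF kappa_lipschitz(1) kappa_continuous(2) _ _ kappa'_lipschitz t])
    show "\<bar>?k r\<bar> \<le> 18" "\<bar>?k' r\<bar> \<le> 18" for r using kappa_bound[of r] kappa'_bound[of r] by linarith+
  qed
  moreover have "\<bar>- 2 * (LINT r|lebesgue. ?k' r * v t r * g t r) - 2 * (LINT r|lebesgue. ?k r * F t r * v t r)\<bar> \<le> 50"
  proof -
    note m = borel_measurable_lebesgue_continuous[OF kappa_continuous(1)]
      borel_measurable_lebesgue_continuous[OF kappa_continuous(2)]
    note b1 = in_L2_bounded_mult[OF vi[OF t] m(2) kappa'_bound] and b2 = in_L2_bounded_mult[OF Fi[OF t] m(1) kappa_bound]
    have M1: "M t \<le> 1" using M_small[OF t] by simp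
    have "\<bar>LINT r|lebesgue. ?k' r * v t r * g t r\<bar> \<le> L2_norm_fun (\<lambda>r. ?k' r * v t r) * M t"
      by (rule L2_Cauchy_Schwarz[OF b1(1) gi[OF t]])
    also have "\<dots> \<le> (3 * 1) * 1"
      using b1(2) v_small(1)[OF t] M1 by (intro mult_mono) (auto simp: L2_norm_nonneg)
    finally have 1: "\<bar>LINT r|lebesgue. ?k' r * v t r * g t r\<bar> \<le> 3" by simp
    have "L2_norm_fun (F t) \<le> (4 + 12 * M t + 6 * (M t)\<^sup>2) * sqrt (Q t)"
      unfolding F_def[abs_def] by (rule profile.nonlin_in_L2(2)[OF prof[OF t]])
    also have "\<dots> \<le> (4 + 12 * 1 + 6 * 1\<^sup>2) * 1"
      using M1 v_small(2)[OF t] profile.Q_nonneg[OF prof[OF t]]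
      by (intro mult_mono add_mono power_mono) (auto simp: L2_norm_nonneg)
    finally have F: "L2_norm_fun (F t) \<le> 22" by simp
    have "\<bar>LINT r|lebesgue. ?k r * F t r * v t r\<bar> \<le> L2_norm_fun (\<lambda>r. ?k r * F t r) * L2_norm_fun (v t)"
      by (rule L2_Cauchy_Schwarz[OF b2(1) vi[OF t]])
    also have "\<dots> \<le> 22 * 1"
      using b2(2) F v_small(1)[OF t] by (intro mult_mono) (auto simp: L2_norm_nonneg)
    finally have 2: "\<bar>LINT r|lebesgue. ?k r * F t r * v t r\<bar> \<le> 22" by simp
    show ?thesis using 1 2 by linarith
  qed
  ultimately show ?thesis by blast
qed

lemma A_nonneg: "0 \<le> A t"
  unfolding A_def using sig_pos by (intro add_nonneg_nonneg Bochner_Integration.integral_nonneg) (simp_all add: less_imp_le)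

lemma A_tendsto: "(A \<longlongrightarrow> 0) at_top"
proof (rule decay_to_zero[where c = "1 / 1084" and L = 50 and B = 1])
  let ?J' = "\<lambda>t. - (1 / 2) * ((LINT r|lebesgue. 1 / sig r ^ 6 * (v t r)\<^sup>2) + (LINT r|lebesgue. 1 / sig r ^ 6 * (g t r)\<^sup>2))
      - (LINT r|lebesgue. kink_H r * F t r * g t r)"
  fix t :: real assume t: "t \<ge> 0"
  show "((\<lambda>s. LINT r|lebesgue. kink_H r * v s r * g s r) has_real_derivative ?J' t) (at t within {0..})"
  proof (rule quadratic_derivs(2)[where C = 18, OF DERIV_kink_H kappa_continuous(1) _ _ _ t])
    show "\<bar>kink_H r\<bar> \<le> 18" "\<bar>1 / sig r ^ 6\<bar> \<le> 18" for r using kink_H_bound[of r] kappa_bound[of r] by linarith+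
    show "\<bar>1 / sig (r + h) ^ 6 - 1 / sig r ^ 6\<bar> \<le> 18 * \<bar>h\<bar>" for r h using kappa_lipschitz(2)[of r h] by simp
  qed
  have "M t \<le> 1 / 1000" using M_small[OF t] by simp
  from profile.virial_static[OF prof[OF t] this]
  have "- (1 / 2) * (LINT r|lebesgue. 1 / sig r ^ 6 * (g t r)\<^sup>2) - (LINT r|lebesgue. kink_H r * F t r * g t r)
      \<le> - (1 / 1084) * (LINT r|lebesgue. 1 / sig r ^ 6 * (g t r)\<^sup>2)"
    unfolding profile.G6_def[OF prof[OF t]] F_def .
  \<comment> \<open>The kinetic part has the factor 1/2 in the dissipation, far better than 1/1084;
    the static estimate concerns the gradient part only.\<close>
  moreover have "0 \<le> (LINT r|lebesgue. 1 / sig r ^ 6 * (v t r)\<^sup>2)"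
    using sig_pos by (intro Bochner_Integration.integral_nonneg) (simp add: less_imp_le)
  ultimately show "?J' t \<le> - (1 / 1084) * A t" unfolding A_def by argo
  have "\<bar>LINT r|lebesgue. kink_H r * v t r * g t r\<bar> \<le> L2_norm_fun (\<lambda>r. kink_H r * v t r) * M t"
    by (rule L2_Cauchy_Schwarz[OF in_L2_bounded_mult(1)[OF vi[OF t] borel_measurable_lebesgue_continuous[OF continuous_coeff(2)] kink_H_bound] gi[OF t]])
  also have "\<dots> \<le> 1 * 1"
    using in_L2_bounded_mult(2)[OF vi[OF t] borel_measurable_lebesgue_continuous[OF continuous_coeff(2)] kink_H_bound]
      v_small(1)[OF t] M_small[OF t] by (intro mult_mono) (auto simp: L2_norm_nonneg)
  finally show "- 1 \<le> (LINT r|lebesgue. kink_H r * v t r * g t r)" by simp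
  show "0 \<le> A t" by (rule A_nonneg)
next
  fix s t :: real assume s: "s \<ge> 0" and t: "t \<ge> 0"
  obtain D where D: "\<And>x. x \<ge> 0 \<Longrightarrow> (A has_real_derivative D x) (at x within {0..})" "\<And>x. x \<ge> 0 \<Longrightarrow> \<bar>D x\<bar> \<le> 50"
    using A_deriv by metis
  have "norm (A s - A t) \<le> 50 * norm (s - t)"
    by (rule field_differentiable_bound[where S = "{0..}" and f' = D]) (use D s t in auto)
  then show "\<bar>A s - A t\<bar> \<le> 50 * \<bar>s - t\<bar>" by simp
qed simp

text \<open>On [-R, R] the weight H' is at least sig(R)^(-6), so \<open>A\<close> controls v and g
  there; for w the vanishing at 0 gives w^2 <= R int g^2 over the same interval, and a second
  integration yields 2 R^2.\<close>

lemma local_bound: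
  assumes t: "t \<ge> 0" and R: "R > 0"
  shows "set_integrable lebesgue {-R..R} (\<lambda>r. (w t r)\<^sup>2)" (is ?I)
    and "(LINT r:{-R..R}|lebesgue. (w t r)\<^sup>2) \<le> 2 * R\<^sup>2 * sig R ^ 6 * A t" (is ?W)
    and "(LINT r:{-R..R}|lebesgue. (v t r)\<^sup>2 + (g t r)\<^sup>2 + (w t r)\<^sup>2) \<le> (1 + 2 * R\<^sup>2) * sig R ^ 6 * A t" (is ?T)
proof -
  let ?i = "indicator {-R..R} :: real \<Rightarrow> real"
  have si: "set_integrable lebesgue {-R..R} (\<lambda>r. (u r)\<^sup>2)" if "in_L2 u" for u
    unfolding set_integrable_def by (rule integrable_mult_indicator[OF _ in_L2_integrable_sq[OF that]]) simp
  have km: "(\<lambda>r. 1 / sig r ^ 6) \<in> borel_measurable lebesgue"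
    by (rule borel_measurable_lebesgue_continuous[OF kappa_continuous(1)])
  have loc: "(LINT r:{-R..R}|lebesgue. (u r)\<^sup>2) \<le> sig R ^ 6 * (LINT r|lebesgue. 1 / sig r ^ 6 * (u r)\<^sup>2)" if u: "in_L2 u" for u
  proof -
    have i: "integrable lebesgue (\<lambda>r. 1 / sig r ^ 6 * (u r)\<^sup>2)"
      using L2_mult_integrable[OF in_L2_bounded_mult(1)[OF u km kappa_bound] u] by (simp add: power2_eq_square mult.assoc)
    have "(LINT r:{-R..R}|lebesgue. (u r)\<^sup>2) \<le> (LINT r|lebesgue. sig R ^ 6 * (1 / sig r ^ 6 * (u r)\<^sup>2))"
      unfolding set_lebesgue_integral_def
    proof (rule integral_mono[OF si[OF u, unfolded set_integrable_def] integrable_mult_right[OF i]])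
      fix r
      show "?i r *\<^sub>R (u r)\<^sup>2 \<le> sig R ^ 6 * (1 / sig r ^ 6 * (u r)\<^sup>2)"
      proof (cases "r \<in> {-R..R}")
        case True
        then have "sig r ^ 6 \<le> sig R ^ 6" using sig_mono[of r R] sig_pos[of r] by (intro power_mono) auto
        then have "1 \<le> sig R ^ 6 / sig r ^ 6" using sig_pos[of r] by simp
        then have "1 * (u r)\<^sup>2 \<le> sig R ^ 6 / sig r ^ 6 * (u r)\<^sup>2" by (intro mult_right_mono) auto
        then show ?thesis using True by simp
      next
        case False
        then show ?thesis using sig_pos[of r] sig_pos[of R] by simp
      qed
    qed
    then show ?thesis by (simp only: integral_mult_right_zero)
  qed
  define N where "N = (LINT r:{-R..R}|lebesgue. (g t r)\<^sup>2)"
  have N0: "N \<ge> 0" unfolding N_def set_lebesgue_integral_def by (rule Bochner_Integration.integral_nonneg) simp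
  have Nn: "(L2_norm_fun (\<lambda>x. ?i x * g t x))\<^sup>2 = N"
    unfolding L2_norm_sq N_def set_lebesgue_integral_def
    by (rule Bochner_Integration.integral_cong) (auto simp: indicator_def)
  have wb: "(w t r)\<^sup>2 \<le> R * N" if "r \<in> {-R..R}" for r
  proof -
    have r: "\<bar>r\<bar> \<le> R" using that by auto
    have "\<bar>w t r\<bar>\<^sup>2 \<le> (sqrt \<bar>r\<bar> * L2_norm_fun (\<lambda>x. ?i x * g t x))\<^sup>2"
      by (intro power_mono primitive_bound_local[OF gi[OF t] r]) simp
    also have "\<dots> = \<bar>r\<bar> * N" by (simp add: power_mult_distrib Nn)
    also have "\<dots> \<le> R * N" using r N0 by (rule mult_right_mono)
    finally show ?thesis by simp
  qed
  have wm: "w t \<in> borel_measurable lebesgue" by (rule profile.w_measurable[OF prof[OF t]])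
  have wi: "in_L2 (\<lambda>r. ?i r * w t r)" using w_locally_L2[OF t] by (simp add: locally_L2_def)
  have eqi: "?i r *\<^sub>R (w t r)\<^sup>2 = (?i r * w t r)\<^sup>2" for r by (simp add: indicator_def)
  show I: ?I unfolding set_integrable_def eqi by (rule in_L2_integrable_sq[OF wi])
  have "(LINT r:{-R..R}|lebesgue. (w t r)\<^sup>2) \<le> (LINT r|lebesgue. (R * N) * ?i r)"
    unfolding set_lebesgue_integral_def
    by (rule integral_mono[OF I[unfolded set_integrable_def] integrable_mult_right[OF indicator_one_integrable]])
      (use wb in \<open>auto simp: indicator_def\<close>)
  also have "\<dots> = 2 * R\<^sup>2 * N" using R by (simp add: power2_eq_square)
  finally have wN: "(LINT r:{-R..R}|lebesgue. (w t r)\<^sup>2) \<le> 2 * R\<^sup>2 * N" .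
  have Vn: "0 \<le> (LINT r|lebesgue. 1 / sig r ^ 6 * (v t r)\<^sup>2)"
    using sig_pos by (intro Bochner_Integration.integral_nonneg) (simp add: less_imp_le)
  have S: "0 \<le> sig R ^ 6" using sig_pos[of R] by simp
  have VA: "(LINT r:{-R..R}|lebesgue. (v t r)\<^sup>2) + N \<le> sig R ^ 6 * A t"
    unfolding A_def distrib_left N_def by (intro add_mono loc vi gi t)
  have "0 \<le> sig R ^ 6 * (LINT r|lebesgue. 1 / sig r ^ 6 * (v t r)\<^sup>2)" using S Vn by simp
  then have NA: "N \<le> sig R ^ 6 * A t" using loc[OF gi[OF t]] unfolding A_def N_def distrib_left by linarith
  have "2 * R\<^sup>2 * N \<le> 2 * R\<^sup>2 * (sig R ^ 6 * A t)" by (rule mult_left_mono[OF NA]) simp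
  then show W: ?W using wN by (simp add: mult.assoc)
  have "(LINT r:{-R..R}|lebesgue. (v t r)\<^sup>2 + (g t r)\<^sup>2 + (w t r)\<^sup>2)
    = (LINT r:{-R..R}|lebesgue. (v t r)\<^sup>2) + N + (LINT r:{-R..R}|lebesgue. (w t r)\<^sup>2)"
    unfolding N_def using si[OF vi[OF t]] si[OF gi[OF t]] I by (simp add: set_integral_add)
  also have "\<dots> \<le> sig R ^ 6 * A t + 2 * R\<^sup>2 * sig R ^ 6 * A t" using VA W by linarith
  also have "\<dots> = (1 + 2 * R\<^sup>2) * sig R ^ 6 * A t" by (simp add: algebra_simps)
  finally show ?T .
qed

lemma local_decay:
  assumes R: "R > 0"
  shows "((\<lambda>t. LINT r:{-R..R}|lebesgue. (v t r)\<^sup>2 + (g t r)\<^sup>2 + (w t r)\<^sup>2) \<longlongrightarrow> 0) at_top"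
proof (rule Lim_null_comparison)
  show "\<forall>\<^sub>F t in at_top. norm (LINT r:{-R..R}|lebesgue. (v t r)\<^sup>2 + (g t r)\<^sup>2 + (w t r)\<^sup>2) \<le> (1 + 2 * R\<^sup>2) * sig R ^ 6 * A t"
    using eventually_ge_at_top[of 0]
  proof eventually_elim
    case (elim t)
    have "0 \<le> (LINT r:{-R..R}|lebesgue. (v t r)\<^sup>2 + (g t r)\<^sup>2 + (w t r)\<^sup>2)"
      unfolding set_lebesgue_integral_def by (rule Bochner_Integration.integral_nonneg) simp
    then show ?case using local_bound(3)[OF elim R] by simp
  qed
  show "((\<lambda>t. (1 + 2 * R\<^sup>2) * sig R ^ 6 * A t) \<longlongrightarrow> 0) at_top"
    by (rule tendsto_mult_right_zero[OF A_tendsto])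
qed

text \<open>Local decay handles a large interval. Outside it the weight is at most (1/R) / (1 +
  r^2), and \<open>Q\<close> is only bounded, which suffices: the additional factor 1/|r| makes the
  tail small.\<close>

lemma weighted_decay:
  "((\<lambda>t. LINT r|lebesgue. min 1 (inverse \<bar>r\<bar>) / (1 + r\<^sup>2) * (w t r)\<^sup>2) \<longlongrightarrow> 0) at_top"
proof (rule tendstoI)
  fix e :: real assume e: "e > 0"
  define R where "R = 2 / e + 1"
  have R: "R > 0" "R \<ge> 1" using e by (auto simp: R_def add_pos_pos)
  have "1 / R < e / 2"
  proof -
    have "2 / e < R" by (simp add: R_def)
    then show ?thesis using e R by (simp add: field_simps)
  qed
  have "\<forall>\<^sub>F t in at_top. 2 * R\<^sup>2 * sig R ^ 6 * A t < e / 2"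
    by (rule order_tendstoD(2)[OF tendsto_mult_right_zero[OF A_tendsto]]) (use e in simp)
  then show "\<forall>\<^sub>F t in at_top. dist (LINT r|lebesgue. min 1 (inverse \<bar>r\<bar>) / (1 + r\<^sup>2) * (w t r)\<^sup>2) 0 < e"
    using eventually_ge_at_top[of 0]
  proof eventually_elim
    case (elim t)
    let ?m = "\<lambda>r::real. min 1 (inverse \<bar>r\<bar>) / (1 + r\<^sup>2)"
    note t = elim(2)
    note wi = profile.integrable_w2[OF prof[OF t]]
    have m0: "0 \<le> ?m r" for r using one_add_sq_pos[of r] by simp
    \<comment> \<open>At r = 0 the convention for \<open>inverse\<close> makes the weight 0 instead
      of 1, which changes nothing: the bound holds and a single point has measure zero.\<close>
    have mle: "?m r \<le> indicator {-R..R} r + 1 / R * (1 / sig r ^ 4)" for r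
    proof (cases "r \<in> {-R..R}")
      case True
      have "?m r \<le> 1 / (1 + r\<^sup>2)" using one_add_sq_pos[of r] by (intro divide_right_mono) auto
      also have "\<dots> \<le> 1" using one_add_sq_pos[of r] by simp
      finally have "?m r \<le> 1" .
      moreover have "0 \<le> 1 / R * (1 / sig r ^ 4)" using R sig_pos[of r] by simp
      moreover have "indicator {-R..R} r = (1::real)" using True by simp
      ultimately show ?thesis by linarith
    next
      case False
      then have "R \<le> \<bar>r\<bar>" by auto
      then have "inverse \<bar>r\<bar> \<le> 1 / R" using R by (simp add: field_simps)
      then have "?m r \<le> 1 / R / (1 + r\<^sup>2)" using one_add_sq_pos[of r] by (intro divide_right_mono) auto
      then show ?thesis using False by (simp add: sig_4)
    qed
    have "(LINT r|lebesgue. ?m r * (w t r)\<^sup>2) \<le> (LINT r|lebesgue. indicator {-R..R} r *\<^sub>R (w t r)\<^sup>2 + 1 / R * ((w t r)\<^sup>2 / sig r ^ 4))"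
    proof (rule integral_mono_AE')
      show "integrable lebesgue (\<lambda>r. indicator {-R..R} r *\<^sub>R (w t r)\<^sup>2 + 1 / R * ((w t r)\<^sup>2 / sig r ^ 4))"
        by (rule Bochner_Integration.integrable_add[OF local_bound(1)[OF t R(1), unfolded set_integrable_def] integrable_mult_right[OF wi]])
      show "AE r in lebesgue. ?m r * (w t r)\<^sup>2 \<le> indicator {-R..R} r *\<^sub>R (w t r)\<^sup>2 + 1 / R * ((w t r)\<^sup>2 / sig r ^ 4)"
      proof (rule AE_I2)
        fix r
        show "?m r * (w t r)\<^sup>2 \<le> indicator {-R..R} r *\<^sub>R (w t r)\<^sup>2 + 1 / R * ((w t r)\<^sup>2 / sig r ^ 4)"
          using mult_right_mono[OF mle[of r] zero_le_power2, of "w t r"] by (simp add: distrib_right)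
      qed
      have "0 \<le> indicator {-R..R} r *\<^sub>R (w t r)\<^sup>2 + 1 / R * ((w t r)\<^sup>2 / sig r ^ 4)" for r
        using R(1) sig_pos[of r] by simp
      then show "AE r in lebesgue. 0 \<le> indicator {-R..R} r *\<^sub>R (w t r)\<^sup>2 + 1 / R * ((w t r)\<^sup>2 / sig r ^ 4)"
        by simp
    qed
    also have "\<dots> = (LINT r:{-R..R}|lebesgue. (w t r)\<^sup>2) + 1 / R * Q t"
      unfolding profile.Q_def[OF prof[OF t]] set_lebesgue_integral_def integral_mult_right_zero[symmetric]
      by (rule Bochner_Integration.integral_add[OF local_bound(1)[OF t R(1), unfolded set_integrable_def] integrable_mult_right[OF wi]])
    also have "\<dots> < e / 2 + e / 2"
    proof (rule add_le_less_mono)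
      show "(LINT r:{-R..R}|lebesgue. (w t r)\<^sup>2) \<le> e / 2" using local_bound(2)[OF t R(1)] elim(1) by linarith
      have "1 / R * Q t \<le> 1 / R * 1" using v_small(2)[OF t] R by (intro mult_left_mono) auto
      then show "1 / R * Q t < e / 2" using \<open>1 / R < e / 2\<close> by linarith
    qed
    finally have "(LINT r|lebesgue. ?m r * (w t r)\<^sup>2) < e" by simp
    moreover have "0 \<le> (LINT r|lebesgue. ?m r * (w t r)\<^sup>2)"
      by (rule Bochner_Integration.integral_nonneg) (rule mult_nonneg_nonneg[OF m0 zero_le_power2])
    ultimately show ?case by simp
  qed
qed

end

section \<open>From energy solutions to the first-order system\<close>

lemma energy_spaceD:
  assumes "(u1, u2) \<in> energy_space"
  shows "odd_ae u1" "has_weak_deriv u1 (weak_deriv u1)" "in_L2 (weak_deriv u1)" "in_L2 u2"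
    "in_L2 (\<lambda>r. u1 r / sqrt (1 + r\<^sup>2))" "u1 \<in> borel_measurable lebesgue"
    "AE r in lebesgue. u1 r = primitive (weak_deriv u1) r" "primitive (weak_deriv u1) \<in> borel_measurable lebesgue"
proof -
  show o: "odd_ae u1" and i: "in_L2 (weak_deriv u1)" and "in_L2 u2" "in_L2 (\<lambda>r. u1 r / sqrt (1 + r\<^sup>2))"
    using assms by (auto simp: energy_space_def)
  show h: "has_weak_deriv u1 (weak_deriv u1)"
    using assms by (auto simp: energy_space_def intro: weak_deriv_has)
  show "u1 \<in> borel_measurable lebesgue"
    using h by (intro locally_integrable_measurable) (simp add: has_weak_deriv_def)
  show "AE r in lebesgue. u1 r = primitive (weak_deriv u1) r" by (rule weak_deriv_primitive[OF h o])
  show "primitive (weak_deriv u1) \<in> borel_measurable lebesgue"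
    by (rule borel_measurable_lebesgue_continuous[OF ac_deriv_continuous[OF ac_deriv_primitive[OF in_L2_locally_integrable[OF i]]]])
qed

lemma energy_norm_ge:
  "L2_norm_fun (\<lambda>r. u1 r / sqrt (1 + r\<^sup>2)) \<le> energy_norm u1 u2"
  "L2_norm_fun (weak_deriv u1) \<le> energy_norm u1 u2" "L2_norm_fun u2 \<le> energy_norm u1 u2"
  using L2_norm_nonneg[of "\<lambda>r. u1 r / sqrt (1 + r\<^sup>2)"] L2_norm_nonneg[of "weak_deriv u1"] L2_norm_nonneg[of u2]
  by (auto simp: energy_norm_def)

lemma measurable_div_sig2:
  assumes "f \<in> borel_measurable lebesgue" shows "(\<lambda>r. f r / (sig r)\<^sup>2) \<in> borel_measurable lebesgue"
  by (intro borel_measurable_divide borel_measurable_power assms borel_measurable_lebesgue_continuous continuous_sig)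

text \<open>All data of an energy solution are classes modulo null sets, so w1 may be replaced by
  the continuous primitive of its weak derivative in every norm and every pairing.\<close>

lemma energy_solution_wave:
  assumes sol: "energy_solution w1 w2"
  shows "wave (\<lambda>t. weak_deriv (w1 t)) w2"
proof -
  let ?g = "\<lambda>t. weak_deriv (w1 t)"
  have E: "(w1 t, w2 t) \<in> energy_space" if "t \<ge> 0" for t
    using sol that by (auto simp: energy_solution_def energy_continuous_def)
  note e = energy_spaceD[OF E]
  have lim: "((\<lambda>s. energy_norm (\<lambda>r. w1 s r - w1 t r) (\<lambda>r. w2 s r - w2 t r)) \<longlongrightarrow> 0) (at t within {0..})" if "t \<ge> 0" for t
    using sol that by (auto simp: energy_solution_def energy_continuous_def)
  \<comment> \<open>Stated for a general H because it is needed for w1 itself and for the nonlinear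
    term.\<close>
  have int_eq: "(LINT r|lebesgue. H r (w1 s r) * \<phi> r) = (LINT r|lebesgue. H r (primitive (?g s) r) * \<phi> r)"
    if s: "s \<ge> 0" and \<phi>: "test_function \<phi>"
      and H: "\<And>f. f \<in> borel_measurable lebesgue \<Longrightarrow> (\<lambda>r. H r (f r)) \<in> borel_measurable lebesgue" for s \<phi> H
  proof (rule integral_cong_AE)
    show "(\<lambda>r. H r (w1 s r) * \<phi> r) \<in> borel_measurable lebesgue" "(\<lambda>r. H r (primitive (?g s) r) * \<phi> r) \<in> borel_measurable lebesgue"
      by (intro borel_measurable_times measurable_test_function[OF \<phi>] H e(6,8)[OF s])+
    show "AE r in lebesgue. H r (w1 s r) * \<phi> r = H r (primitive (?g s) r) * \<phi> r"
      using e(7)[OF s] by eventually_elim simp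
  qed
  show ?thesis
  proof
    show "L2_continuous ?g"
      unfolding L2_continuous_def
    proof (intro conjI allI impI)
      show "in_L2 (?g t)" if "t \<ge> 0" for t by (rule e(3)[OF that])
      fix t :: real assume t: "t \<ge> 0"
      show "((\<lambda>s. L2_norm_fun (\<lambda>r. ?g s r - ?g t r)) \<longlongrightarrow> 0) (at t within {0..})"
      proof (rule Lim_null_comparison[OF _ lim[OF t]])
        show "\<forall>\<^sub>F s in at t within {0..}. norm (L2_norm_fun (\<lambda>r. ?g s r - ?g t r))
            \<le> energy_norm (\<lambda>r. w1 s r - w1 t r) (\<lambda>r. w2 s r - w2 t r)"
          using eventually_within_nonneg
        proof eventually_elim
          case (elim s)
          \<comment> \<open>The energy norm contains the chosen weak derivative of the difference;
            by uniqueness it agrees almost everywhere with the difference of the chosen weak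
            derivatives.\<close>
          have h: "has_weak_deriv (\<lambda>r. w1 s r - w1 t r) (\<lambda>r. ?g s r - ?g t r)"
            by (rule has_weak_deriv_diff[OF e(2)[OF elim] e(2)[OF t]])
          note h' = weak_deriv_has[OF h]
          have "L2_norm_fun (\<lambda>r. ?g s r - ?g t r) = L2_norm_fun (weak_deriv (\<lambda>r. w1 s r - w1 t r))"
            by (rule L2_norm_cong_AE[OF _ _ has_weak_deriv_unique[OF h h']])
              (use h h' in \<open>auto simp: has_weak_deriv_def intro: locally_integrable_measurable\<close>)
          then show ?case using energy_norm_ge(2)[of "\<lambda>r. w1 s r - w1 t r"] by (simp add: L2_norm_nonneg)
        qed
      qed
    qed
    show "L2_continuous w2"
      unfolding L2_continuous_def
    proof (intro conjI allI impI)
      show "in_L2 (w2 t)" if "t \<ge> 0" for t by (rule e(4)[OF that])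
      fix t :: real assume t: "t \<ge> 0"
      show "((\<lambda>s. L2_norm_fun (\<lambda>r. w2 s r - w2 t r)) \<longlongrightarrow> 0) (at t within {0..})"
        by (rule Lim_null_comparison[OF _ lim[OF t]])
          (use energy_norm_ge(3) in \<open>simp add: L2_norm_nonneg\<close>)
    qed
  next
    fix t :: real assume t: "t \<ge> 0"
    show "in_L2 (\<lambda>r. primitive (?g t) r / (sig r)\<^sup>2)"
    proof (rule in_L2_cong_AE[OF measurable_div_sig2[OF e(8)[OF t]] e(5)[OF t]])
      show "AE r in lebesgue. primitive (?g t) r / (sig r)\<^sup>2 = w1 t r / sqrt (1 + r\<^sup>2)"
        using e(7)[OF t] by eventually_elim (simp add: sig_2)
    qed
    show "((\<lambda>s. L2_norm_fun (\<lambda>r. (primitive (?g s) r - primitive (?g t) r) / (sig r)\<^sup>2)) \<longlongrightarrow> 0) (at t within {0..})"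
    proof (rule Lim_null_comparison[OF _ lim[OF t]])
      show "\<forall>\<^sub>F s in at t within {0..}. norm (L2_norm_fun (\<lambda>r. (primitive (?g s) r - primitive (?g t) r) / (sig r)\<^sup>2))
          \<le> energy_norm (\<lambda>r. w1 s r - w1 t r) (\<lambda>r. w2 s r - w2 t r)"
        using eventually_within_nonneg
      proof eventually_elim
        case (elim s)
        have "L2_norm_fun (\<lambda>r. (primitive (?g s) r - primitive (?g t) r) / (sig r)\<^sup>2)
            = L2_norm_fun (\<lambda>r. (w1 s r - w1 t r) / (sig r)\<^sup>2)"
        proof (rule L2_norm_cong_AE)
          show "AE r in lebesgue. (primitive (?g s) r - primitive (?g t) r) / (sig r)\<^sup>2 = (w1 s r - w1 t r) / (sig r)\<^sup>2"
            using e(7)[OF elim] e(7)[OF t] by eventually_elim simp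
        qed (intro measurable_div_sig2 borel_measurable_diff e(6,8) elim t)+
        then show ?case using energy_norm_ge(1)[of "\<lambda>r. w1 s r - w1 t r"] by (simp add: L2_norm_nonneg sig_2)
      qed
    qed
  next
    fix \<phi> and t :: real assume \<phi>: "test_function \<phi>" and t: "t \<ge> 0"
    have D1: "((\<lambda>s. LINT r|lebesgue. w1 s r * \<phi> r) has_real_derivative (LINT r|lebesgue. w2 t r * \<phi> r)) (at t within {0..})"
      and D2: "((\<lambda>s. LINT r|lebesgue. w2 s r * \<phi> r) has_real_derivative
           (LINT r|lebesgue. w1 t r * (deriv ^^ 2) \<phi> r) - (LINT r|lebesgue. nonlin r (w1 t r) * \<phi> r)) (at t within {0..})"
      using sol \<phi> t unfolding energy_solution_def nonlin_def by blast+
    have t0: "t \<in> {0..}" using t by simp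
    show "((\<lambda>s. LINT r|lebesgue. primitive (?g s) r * \<phi> r) has_real_derivative (LINT r|lebesgue. w2 t r * \<phi> r)) (at t within {0..})"
      by (rule has_field_derivative_transform_within[OF D1 zero_less_one t0])
        (use int_eq[OF _ \<phi>, of _ "\<lambda>r y. y"] in auto)
    have "(LINT r|lebesgue. w1 t r * (deriv ^^ 2) \<phi> r) = - (LINT r|lebesgue. ?g t r * deriv \<phi> r)"
      using e(2)[OF t] test_function_deriv[OF \<phi>] by (simp add: has_weak_deriv_def eval_nat_numeral)
    then show "((\<lambda>s. LINT r|lebesgue. w2 s r * \<phi> r) has_real_derivative
        - (LINT r|lebesgue. ?g t r * deriv \<phi> r) - (LINT r|lebesgue. nonlin r (primitive (?g t) r) * \<phi> r)) (at t within {0..})"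
      using D2 int_eq[where H = nonlin, OF t \<phi> measurable_nonlin] by simp
  qed
qed

theorem theorem2p2:
  "\<exists>\<delta>>0. \<forall>w1 w2 :: real \<Rightarrow> real \<Rightarrow> real.
     (w1 0, w2 0) \<in> energy_space \<longrightarrow>
     energy_norm (w1 0) (w2 0) < \<delta> \<longrightarrow>
     energy_solution w1 w2 \<longrightarrow>
       (\<forall>R>0. ((\<lambda>t. LINT r:{-R..R}|lebesgue.
                   \<bar>w2 t r\<bar>\<^sup>2 + \<bar>weak_deriv (w1 t) r\<bar>\<^sup>2 + \<bar>w1 t r\<bar>\<^sup>2) \<longlongrightarrow> 0) at_top) \<and>
       ((\<lambda>t. LINT r|lebesgue. min 1 (inverse \<bar>r\<bar>) / (1 + r\<^sup>2) * \<bar>w1 t r\<bar>\<^sup>2) \<longlongrightarrow> 0) at_top"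
\<comment> \<open>Any bound works for which 6 \<delta> stays below the threshold 1/1000 of
  \<open>virial_static\<close> and the energy stays in the range of \<open>energy_lower\<close>; the
  value is not optimised.\<close>
proof (intro exI[of _ "1 / 100000"] conjI[of "(0::real) < 1 / 100000"] allI impI)
  fix w1 w2 :: "real \<Rightarrow> real \<Rightarrow> real"
  assume init: "(w1 0, w2 0) \<in> energy_space" and sm: "energy_norm (w1 0) (w2 0) < 1 / 100000"
    and sol: "energy_solution w1 w2"
  let ?g = "\<lambda>t. weak_deriv (w1 t)"
  note e0 = energy_spaceD[OF init]
  have "L2_norm_fun (\<lambda>r. primitive (?g 0) r / (sig r)\<^sup>2) = L2_norm_fun (\<lambda>r. w1 0 r / (sig r)\<^sup>2)"
  proof (rule L2_norm_cong_AE)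
    show "AE r in lebesgue. primitive (?g 0) r / (sig r)\<^sup>2 = w1 0 r / (sig r)\<^sup>2"
      using e0(7) by eventually_elim simp
  qed (intro measurable_div_sig2 e0(6,8))+
  then have "L2_norm_fun (\<lambda>r. primitive (?g 0) r / (sig r)\<^sup>2) \<le> energy_norm (w1 0) (w2 0)"
    using energy_norm_ge(1)[of "w1 0" "w2 0"] by (simp add: sig_2)
  then interpret small_wave ?g w2
    using energy_solution_wave[OF sol] energy_norm_ge(2,3)[of "w1 0" "w2 0"] energy_norm_ge(3)[of "w2 0" "w1 0"] sm
    by (intro small_wave.intro small_wave_axioms.intro) auto
  have E: "(w1 t, w2 t) \<in> energy_space" if "t \<ge> 0" for t
    using sol that by (auto simp: energy_solution_def energy_continuous_def)
  note e = energy_spaceD[OF E]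
  have t0: "\<forall>\<^sub>F t in at_top. (0::real) \<le> t" by (rule eventually_ge_at_top)
  show "(\<forall>R>0. ((\<lambda>t. LINT r:{-R..R}|lebesgue.
                   \<bar>w2 t r\<bar>\<^sup>2 + \<bar>weak_deriv (w1 t) r\<bar>\<^sup>2 + \<bar>w1 t r\<bar>\<^sup>2) \<longlongrightarrow> 0) at_top) \<and>
       ((\<lambda>t. LINT r|lebesgue. min 1 (inverse \<bar>r\<bar>) / (1 + r\<^sup>2) * \<bar>w1 t r\<bar>\<^sup>2) \<longlongrightarrow> 0) at_top"
  proof (intro conjI allI impI)
    fix R :: real assume R: "R > 0"
    \<comment> \<open>The replacement of w1 by its continuous representative is undone; the identity
      is known for nonnegative times only, which is enough for the limit.\<close>
    have "\<forall>\<^sub>F t in at_top. (LINT r:{-R..R}|lebesgue. (w2 t r)\<^sup>2 + (?g t r)\<^sup>2 + (primitive (?g t) r)\<^sup>2)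
        = (LINT r:{-R..R}|lebesgue. \<bar>w2 t r\<bar>\<^sup>2 + \<bar>weak_deriv (w1 t) r\<bar>\<^sup>2 + \<bar>w1 t r\<bar>\<^sup>2)"
      using t0
    proof eventually_elim
      case (elim t)
      note m = in_L2_measurable[OF e(4)[OF elim]] in_L2_measurable[OF e(3)[OF elim]] e(6)[OF elim] e(8)[OF elim]
      show ?case
        unfolding set_lebesgue_integral_def real_scaleR_def power2_abs
      proof (rule integral_cong_AE)
        show "AE r in lebesgue. indicator {-R..R} r * ((w2 t r)\<^sup>2 + (?g t r)\<^sup>2 + (primitive (?g t) r)\<^sup>2)
            = indicator {-R..R} r * ((w2 t r)\<^sup>2 + (?g t r)\<^sup>2 + (w1 t r)\<^sup>2)"
          using e(7)[OF elim] by eventually_elim simp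
      qed (intro borel_measurable_times borel_measurable_add borel_measurable_power m measurable_lebesgue_indicator)+
    qed
    with local_decay[OF R]
    show "((\<lambda>t. LINT r:{-R..R}|lebesgue. \<bar>w2 t r\<bar>\<^sup>2 + \<bar>weak_deriv (w1 t) r\<bar>\<^sup>2 + \<bar>w1 t r\<bar>\<^sup>2) \<longlongrightarrow> 0) at_top"
      by (rule Lim_transform_eventually)
  next
    have mm: "(\<lambda>r::real. min 1 (inverse \<bar>r\<bar>) / (1 + r\<^sup>2)) \<in> borel_measurable lebesgue"
      by (rule measurable_completion) measurable
    have "\<forall>\<^sub>F t in at_top. (LINT r|lebesgue. min 1 (inverse \<bar>r\<bar>) / (1 + r\<^sup>2) * (primitive (?g t) r)\<^sup>2)
        = (LINT r|lebesgue. min 1 (inverse \<bar>r\<bar>) / (1 + r\<^sup>2) * \<bar>w1 t r\<bar>\<^sup>2)"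
      using t0
    proof eventually_elim
      case (elim t)
      show ?case
        unfolding power2_abs
      proof (rule integral_cong_AE)
        show "AE r in lebesgue. min 1 (inverse \<bar>r\<bar>) / (1 + r\<^sup>2) * (primitive (?g t) r)\<^sup>2
            = min 1 (inverse \<bar>r\<bar>) / (1 + r\<^sup>2) * (w1 t r)\<^sup>2"
          using e(7)[OF elim] by eventually_elim simp
      qed (intro borel_measurable_times borel_measurable_power mm e(6,8)[OF elim])+
    qed
    with weighted_decay
    show "((\<lambda>t. LINT r|lebesgue. min 1 (inverse \<bar>r\<bar>) / (1 + r\<^sup>2) * \<bar>w1 t r\<bar>\<^sup>2) \<longlongrightarrow> 0) at_top"
      by (rule Lim_transform_eventually)
  qed
qed simp

end
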